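(* Let $V:\mathbb{R}^d\to\mathbb{R}$, $\pi\propto e^{-V}$, $\mathsf{k}$ a symmetric positive-definite kernel on $\mathbb{R}^d$, and $p(0)$ a probability density on $(\mathbb{R}^d)^N$. Suppose: (a) $\mathsf{k}$ and all its partial derivatives up to order $2$ are uniformly bounded by $B\in(0,\infty)$; (b) $\inf_{z\in\mathbb{R}^d}V(z)>0$ and, for some $A>0$ and $\alpha\in[0,1/2)$, $\|\nabla V(x)\|\le AV(x)^\alpha$ for all $x\in\mathbb{R}^d$; (c) $\sup_{z\in\mathbb{R}^d}\|H_V(z)\|_{op}=C_V<\infty$, where $H_V$ is the Hessian of $V$; (d) $\sup_{z\in\mathbb{R}^d}\{\nabla_2\mathsf{k}(z,z)\cdot\nabla V(z)+\mathsf{k}(z,z)\Delta V(z)-\Delta_2\mathsf{k}(z,z)\}=c^*d$ for some constant $c^*>0$; (e) $\mathsf{KL}(p(0)\|\pi^{\otimes N})\le C_{KL}Nd$ for some constant $C_{KL}>0$. All these constants are independent of $d,N$. Let the initial locations $(x_1(0),\dots,x_N(0))$ of the discrete-time SVGD dynamics with step-size $\eta$ be sampled from $$p_K(0):=p(0)\,\vert\,\mathcal{S}_K,\qquad\mathcal{S}_K:=\Big\{\underline x\in(\mathbb{R}^d)^N:N^{-1}\sum_iV(x_i)\le K\Big\},$$ for some $K>0$ satisfying $\int_{\mathcal{S}_K}p(0,\underline z)\,d\underline z\ge1/2$. Then there exist positive constants $a,b$ depending only on the constants appearing in (a)-(e) such that with $$\eta=\frac{a}{d^{\frac{1+\alpha}{2(1-\alpha)}}+\sqrt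 d\,K^\alpha+d}\,N^{-\frac{1+\alpha}{1-2\alpha}},\qquad T=N^{\frac{2-\alpha}{1-2\alpha}},$$ we have $$\mathbb{E}_{p_K(0)}\Big[\frac1T\sum_{n=0}^{T-1}\mathsf{KSD}^2(\mu^N_n\|\pi)\Big]\le\frac{b\,d\big(d^{\frac{1+\alpha}{2(1-\alpha)}}+\sqrt d\,K^\alpha+d\big)}{N}.$$ In particular, if instead $(x_1(0),\dots,x_N(0))$ is sampled from $p(0)$, then for any $\epsilon>0$, $$\mathbb{P}\left(\frac1T\sum_{n=0}^{T-1}\mathsf{KSD}^2(\mu^N_n\|\pi)>\frac{b\,d\big(d^{\frac{1+\alpha}{2(1-\alpha)}}+\sqrt d\,K^\alpha+d\big)}{N\epsilon}\right)\le\epsilon+\int_{\mathcal{S}_K^c}p(0,\underline z)\,d\underline z.$$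
   Context: $\pi$ is the probability density on $\mathbb{R}^d$ proportional to $e^{-V}$, and $\pi^{\otimes N}$ is its $N$-fold product. The discrete-time $N$-particle SVGD dynamics with step-size $\eta>0$ is, for $n\in\mathbb{N}_0$ and $1\le i\le N$, $$x_i(n+1)=x_i(n)-\frac{\eta}{N}\sum_{j=1}^N\big[\mathsf{k}(x_i(n),x_j(n))\nabla V(x_j(n))-\nabla_2\mathsf{k}(x_i(n),x_j(n))\big],$$ and $\mu^N_n=\frac1N\sum_{i=1}^N\delta_{x_i(n)}$. $T$ is the number of iterations (understood as an integer). $p(0)\vert\mathcal{S}_K$ is the restriction of the density $p(0)$ to $\mathcal{S}_K$, renormalized to a probability density, i.e. $p_K(0,\underline x)=p(0,\underline x)\mathbf{1}_{\mathcal{S}_K}(\underline x)/\int_{\mathcal{S}_K}p(0,\underline z)d\underline z$. $\nabla_1,\nabla_2$ are gradients in the first, second argument; $\nabla_2\mathsf{k}(z,z)$ and $\Delta_2\mathsf{k}(z,z)$ are the gradient and Laplacian of $\mathsf{k}(z,\cdot)$ evaluated at $z$; $\|\cdot\|_{op}$ is the operator norm. Relative entropy: $\mathsf{KL}(p\|\pi^{\otimes N})=\int\log\big(p(\underline z)/\pi^{\otimes N}(\underline z)\big)p(\underline z)\,d\underline z$. Kernelized Stein Discrepancy: let $\mathcal{H}_0$ be the RKHS of $\mathsf{k}$, $\mathcal{H}=\mathcal{H}_0\times\dots\times\mathcal{H}_0$ ($d$ copies), and $\mathcal{T}_\pi\phi(x)=-\nabla V(x)\cdot\phi(x)+\nabla\cdot\phi(x)$.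 Then $\mathsf{KSD}(P\|\pi)=\sup\{\mathbb{E}_{X\sim P}[\mathcal{T}_\pi\phi(X)]:\phi\in\mathcal{H},\|\phi\|_{\mathcal{H}}\le1\}$; it has the explicit form $$\mathsf{KSD}^2(P\|\pi)=\mathbb{E}_{(X,Y)\sim P\otimes P}\big[\nabla V(X)\cdot\mathsf{k}(X,Y)\nabla V(Y)-\nabla V(X)\cdot\nabla_2\mathsf{k}(X,Y)-\nabla V(Y)\cdot\nabla_1\mathsf{k}(X,Y)+\nabla_1\cdot\nabla_2\mathsf{k}(X,Y)\big].$$ *)

theory Defs
  imports "HOL-Probability.Probability"
begin

text \<open>
  The constants of the theorem have to be independent of the dimension \<open>d\<close> and of the number of
  particles \<open>N\<close>, so both are quantified inside the statement and cannot be encoded in types.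
  A point of \<open>\<real>\<^sup>d\<close> is therefore an element of \<open>{..<d} \<rightarrow>\<^sub>E UNIV\<close>, and a configuration of \<open>N\<close> particles
  is an element of the corresponding product over \<open>{..<N}\<close>. The Euclidean norm is
  \<open>\<lambda>x. L2_set x {..<d}\<close>.
\<close>

type_synonym vec = "nat \<Rightarrow> real"
type_synonym config = "nat \<Rightarrow> vec"

abbreviation Rd :: "nat \<Rightarrow> vec set" where
  "Rd d \<equiv> {..<d} \<rightarrow>\<^sub>E UNIV"

definition leb :: "nat \<Rightarrow> vec measure" where
  "leb d = Pi\<^sub>M {..<d} (\<lambda>_. lborel)"

definition lebN :: "nat \<Rightarrow> nat \<Rightarrow> config measure" where
  "lebN N d = Pi\<^sub>M {..<N} (\<lambda>_. leb d)"

lemma space_leb: "space (leb d) = Rd d"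
  by (simp add: leb_def space_PiM)

lemma space_lebN: "space (lebN N d) = {..<N} \<rightarrow>\<^sub>E Rd d"
  by (simp add: lebN_def space_PiM space_leb)

section \<open>Differential calculus on \<open>\<real>\<^sup>d\<close>\<close>

definition partial :: "nat \<Rightarrow> (vec \<Rightarrow> real) \<Rightarrow> vec \<Rightarrow> real" where
  "partial i f x = deriv (\<lambda>t. f (x(i := t))) (x i)"

definition laplacian :: "nat \<Rightarrow> (vec \<Rightarrow> real) \<Rightarrow> vec \<Rightarrow> real" where
  "laplacian d f x = (\<Sum>i<d. partial i (partial i f) x)"

text \<open>
  Total (Frechet) differentiability at every point of \<open>\<real>\<^sup>d\<close>. The derivative \<open>g\<close> is then necessarily
  the vector of partial derivatives, which in particular exist in the sense of \<^const>\<open>deriv\<close>.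
\<close>

definition differentiable_Rd :: "nat \<Rightarrow> (vec \<Rightarrow> real) \<Rightarrow> bool" where
  "differentiable_Rd d f \<longleftrightarrow>
     (\<forall>x\<in>Rd d. \<exists>g::vec. \<forall>\<epsilon>>0. \<exists>\<delta>>0. \<forall>y\<in>Rd d. L2_set (\<lambda>i. y i - x i) {..<d} < \<delta> \<longrightarrow>
        \<bar>f y - f x - (\<Sum>i<d. g i * (y i - x i))\<bar> \<le> \<epsilon> * L2_set (\<lambda>i. y i - x i) {..<d})"

definition twice_differentiable_Rd :: "nat \<Rightarrow> (vec \<Rightarrow> real) \<Rightarrow> bool" where
  "twice_differentiable_Rd d f \<longleftrightarrow>
     differentiable_Rd d f \<and> (\<forall>i<d. differentiable_Rd d (partial i f))"

definition hessian :: "(vec \<Rightarrow> real) \<Rightarrow> vec \<Rightarrow> nat \<Rightarrow> nat \<Rightarrow> real" where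
  "hessian f x i j = partial i (partial j f) x"

definition op_norm :: "nat \<Rightarrow> (nat \<Rightarrow> nat \<Rightarrow> real) \<Rightarrow> real" where
  "op_norm d M =
     (SUP v\<in>{v\<in>Rd d. L2_set v {..<d} \<le> 1}. L2_set (\<lambda>i. \<Sum>j<d. M i j * v j) {..<d})"

section \<open>Kernels and their reproducing kernel Hilbert spaces\<close>

text \<open>
  A kernel regarded as a function on \<open>\<real>\<^sup>2\<^sup>d\<close>; its partial derivatives are those of \<open>k\<close> in both
  arguments, including the mixed ones.
\<close>

definition joint :: "nat \<Rightarrow> (vec \<Rightarrow> vec \<Rightarrow> real) \<Rightarrow> vec \<Rightarrow> real" where
  "joint d k z = k (\<lambda>i\<in>{..<d}. z i) (\<lambda>i\<in>{..<d}. z (d + i))"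

definition symmetric_pd_kernel :: "nat \<Rightarrow> (vec \<Rightarrow> vec \<Rightarrow> real) \<Rightarrow> bool" where
  "symmetric_pd_kernel d k \<longleftrightarrow>
     (\<forall>x\<in>Rd d. \<forall>y\<in>Rd d. k x y = k y x) \<and>
     (\<forall>X c. finite X \<and> X \<subseteq> Rd d \<longrightarrow> (\<Sum>x\<in>X. \<Sum>y\<in>X. c x * c y * k x y) \<ge> 0)"

definition lin_comb ::
    "nat \<Rightarrow> real \<Rightarrow> (vec \<Rightarrow> real) \<Rightarrow> real \<Rightarrow> (vec \<Rightarrow> real) \<Rightarrow> vec \<Rightarrow> real" where
  "lin_comb d a f b g = (\<lambda>x\<in>Rd d. a * f x + b * g x)"

text \<open>
  \<open>H\<close> with inner product \<open>ip\<close> is the RKHS of \<open>k\<close>: a Hilbert space of functions on \<open>\<real>\<^sup>d\<close> that contains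
  all sections \<open>k x\<close> and has the reproducing property. For a symmetric positive-definite kernel,
  such a space exists and is unique (Moore-Aronszajn). Its elements are taken to be
  \<^const>\<open>extensional\<close>, so that equal functions on \<open>\<real>\<^sup>d\<close> are equal.
\<close>

locale rkhs =
  fixes d :: nat and k :: "vec \<Rightarrow> vec \<Rightarrow> real"
    and H :: "(vec \<Rightarrow> real) set" and ip :: "(vec \<Rightarrow> real) \<Rightarrow> (vec \<Rightarrow> real) \<Rightarrow> real"
  assumes H_extensional: "H \<subseteq> extensional (Rd d)"
    and H_nonempty: "H \<noteq> {}"
    and H_lin_comb: "\<And>a b f g. f \<in> H \<Longrightarrow> g \<in> H \<Longrightarrow> lin_comb d a f b g \<in> H"
    and ip_sym: "\<And>f g. f \<in> H \<Longrightarrow> g \<in> H \<Longrightarrow> ip f g = ip g f"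
    and ip_lin_comb: "\<And>a b f g h. f \<in> H \<Longrightarrow> g \<in> H \<Longrightarrow> h \<in> H \<Longrightarrow>
          ip (lin_comb d a f b g) h = a * ip f h + b * ip g h"
    and ip_nonneg: "\<And>f. f \<in> H \<Longrightarrow> ip f f \<ge> 0"
    and ip_definite: "\<And>f x. f \<in> H \<Longrightarrow> ip f f = 0 \<Longrightarrow> x \<in> Rd d \<Longrightarrow> f x = 0"
    and complete: "\<And>F::nat \<Rightarrow> vec \<Rightarrow> real. (\<And>n. F n \<in> H) \<Longrightarrow>
          (\<And>\<epsilon>. \<epsilon> > 0 \<Longrightarrow> \<exists>M. \<forall>m\<ge>M. \<forall>n\<ge>M.
             sqrt (ip (lin_comb d 1 (F m) (-1) (F n)) (lin_comb d 1 (F m) (-1) (F n))) < \<epsilon>) \<Longrightarrow>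
          \<exists>f\<in>H. (\<lambda>n. sqrt (ip (lin_comb d 1 (F n) (-1) f) (lin_comb d 1 (F n) (-1) f)))
             \<longlonglongrightarrow> 0"
    and sections_mem: "\<And>x. x \<in> Rd d \<Longrightarrow> restrict (k x) (Rd d) \<in> H"
    and reproducing: "\<And>f x. f \<in> H \<Longrightarrow> x \<in> Rd d \<Longrightarrow> ip f (restrict (k x) (Rd d)) = f x"

section \<open>Kernelized Stein discrepancy\<close>

definition stein_op :: "nat \<Rightarrow> (vec \<Rightarrow> real) \<Rightarrow> (nat \<Rightarrow> vec \<Rightarrow> real) \<Rightarrow> vec \<Rightarrow> real" where
  "stein_op d V \<phi> x = - (\<Sum>i<d. partial i V x * \<phi> i x) + (\<Sum>i<d. partial i (\<phi> i) x)"

text \<open>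
  \<open>KSD(P \<parallel> \<pi>)\<close> for \<open>\<pi> \<propto> exp (- V)\<close>. For finitely supported \<open>P\<close> and a twice differentiable kernel, the
  supremum is that of a bounded linear functional over the unit ball of the \<open>d\<close>-fold product
  of the RKHS, hence a genuine real supremum.
\<close>

definition ksd ::
    "nat \<Rightarrow> (vec \<Rightarrow> real) \<Rightarrow> (vec \<Rightarrow> real) set \<Rightarrow> ((vec \<Rightarrow> real) \<Rightarrow> (vec \<Rightarrow> real) \<Rightarrow> real) \<Rightarrow>
     vec measure \<Rightarrow> real" where
  "ksd d V H ip P =
     (SUP \<phi>\<in>{\<phi>. (\<forall>i<d. \<phi> i \<in> H) \<and> sqrt (\<Sum>i<d. ip (\<phi> i) (\<phi> i)) \<le> 1}.
        \<integral>x. stein_op d V \<phi> x \<partial>P)"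

section \<open>Particle dynamics and densities\<close>

definition svgd_step ::
    "nat \<Rightarrow> nat \<Rightarrow> (vec \<Rightarrow> real) \<Rightarrow> (vec \<Rightarrow> vec \<Rightarrow> real) \<Rightarrow> real \<Rightarrow> config \<Rightarrow> config" where
  "svgd_step d N V k \<eta> x = (\<lambda>i\<in>{..<N}. \<lambda>l\<in>{..<d}. x i l - \<eta> / real N *
     (\<Sum>j<N. k (x i) (x j) * partial l V (x j) - partial l (k (x i)) (x j)))"

definition svgd ::
    "nat \<Rightarrow> nat \<Rightarrow> (vec \<Rightarrow> real) \<Rightarrow> (vec \<Rightarrow> vec \<Rightarrow> real) \<Rightarrow> real \<Rightarrow> config \<Rightarrow> nat \<Rightarrow> config" where
  "svgd d N V k \<eta> x n = (svgd_step d N V k \<eta> ^^ n) x"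

definition empirical :: "nat \<Rightarrow> config \<Rightarrow> vec pmf" where
  "empirical N x = map_pmf x (pmf_of_set {..<N})"

definition avg_ksd_sq ::
    "nat \<Rightarrow> nat \<Rightarrow> (vec \<Rightarrow> real) \<Rightarrow> (vec \<Rightarrow> vec \<Rightarrow> real) \<Rightarrow>
     (vec \<Rightarrow> real) set \<Rightarrow> ((vec \<Rightarrow> real) \<Rightarrow> (vec \<Rightarrow> real) \<Rightarrow> real) \<Rightarrow>
     real \<Rightarrow> nat \<Rightarrow> config \<Rightarrow> real" where
  "avg_ksd_sq d N V k H ip \<eta> T x =
     (1 / real T) * (\<Sum>n<T. (ksd d V H ip (measure_pmf (empirical N (svgd d N V k \<eta> x n))))\<^sup>2)"

definition target :: "nat \<Rightarrow> (vec \<Rightarrow> real) \<Rightarrow> vec \<Rightarrow> real" where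
  "target d V x = exp (- V x) / (\<integral>z. exp (- V z) \<partial>leb d)"

definition target_prod :: "nat \<Rightarrow> nat \<Rightarrow> (vec \<Rightarrow> real) \<Rightarrow> config \<Rightarrow> real" where
  "target_prod d N V x = (\<Prod>i<N. target d V (x i))"

definition prob_density :: "'a measure \<Rightarrow> ('a \<Rightarrow> real) \<Rightarrow> bool" where
  "prob_density M p \<longleftrightarrow>
     p \<in> borel_measurable M \<and> (\<forall>x\<in>space M. p x \<ge> 0) \<and> integrable M p \<and> (\<integral>x. p x \<partial>M) = 1"

text \<open>
  \<open>KL(p \<parallel> q) \<le> C\<close> for densities with respect to \<open>M\<close>. Note the argument order of
  \<^const>\<open>KL_divergence\<close>: the reference measure comes first. As the Bochner integral of a
  non-integrable function is 0, integrability is required explicitly; it amounts to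
  finiteness of the relative entropy, whose integrand always has an integrable negative part.
\<close>

definition KL_le :: "'a measure \<Rightarrow> ('a \<Rightarrow> real) \<Rightarrow> ('a \<Rightarrow> real) \<Rightarrow> real \<Rightarrow> bool" where
  "KL_le M p q C \<longleftrightarrow>
     integrable (density M p) (entropy_density (exp 1) (density M q) (density M p)) \<and>
     KL_divergence (exp 1) (density M q) (density M p) \<le> C"

definition sublevel :: "nat \<Rightarrow> nat \<Rightarrow> (vec \<Rightarrow> real) \<Rightarrow> real \<Rightarrow> config set" where
  "sublevel d N V K = {x \<in> space (lebN N d). (1 / real N) * (\<Sum>i<N. V (x i)) \<le> K}"

definition restricted_density :: "'a measure \<Rightarrow> ('a \<Rightarrow> real) \<Rightarrow> 'a set \<Rightarrow> 'a \<Rightarrow> real" where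
  "restricted_density M p S x = p x * indicator S x / (LINT z:S|M. p z)"

end

theory Submission
  imports Defs
begin

text \<open>
  Let \<open>\<Phi> = id - \<eta> G\<close> be one step of the dynamics on configurations. The trace of the derivative of
  \<open>G\<close> and the first-order decrease of the potential \<open>\<Sum>\<^sub>i V(x\<^sub>i)\<close> add up to \<open>N KSD\<^sup>2\<close> minus a diagonal term
  bounded by \<open>c d\<close>. Hence the density \<open>\<pi>(\<Phi> x) |det D\<Phi>(x)|\<close> of the pulled back target dominates
  \<open>\<pi>(x) exp (\<eta> N KSD\<^sup>2 - error)\<close>, and iterating along a trajectory gives an exponential moment bound
  under the target, which Gibbs' variational principle turns into the bound on the mean under any
  law of finite relative entropy. On a sublevel set of the mean potential the trajectory stays in a larger
  sublevel set up to time \<open>T\<close>, so \<open>G\<close> may be cut off outside and \<open>\<Phi>\<close> becomes a small Lipschitz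
  perturbation of the identity.

  The dimension is a variable, so the library's change of variables, whose dimension is a type, does
  not apply. Instead the coordinates are changed one at a time: each factor is a one-dimensional
  substitution, whose derivative is a pivot (Schur complement) of \<open>D\<Phi>\<close>. With \<open>M = D\<Phi> - id\<close>, the product of
  the pivots is at least \<open>exp (tr M - 2 \<parallel>M\<parallel>\<^sup>2)\<close> in the Frobenius norm, which replaces the determinant.
\<close>

section \<open>Gradients on coordinate spaces\<close>

text \<open>The second derivatives of \<open>V\<close> and of the kernel exist pointwise and are
  bounded, but need not be continuous. So D\<Phi> may be discontinuous, and neither the C^1 inverse
  function theorem nor the integral form of Taylor's formula applies. Mean value theorems,
  contractions and substitution for everywhere differentiable functions of one variable replace
  them. Since only an inequality between integrals is wanted, lower bounds for the pivots suffice.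

  The exponents come from three balances. Below a level U the mean potential grows per unit of time
  by at most a multiple of sqrt(d) U^\<alpha>. Over the total time \<eta> T, about a N / D, it
  therefore stays below U once U^(1-\<alpha>) \<ge> N and \<open>a\<close> is small, whence U = 2 K
  + N^(1/(1-\<alpha>)). The second-order error of a step is of order \<eta>^2 N d (U^(2\<alpha>) +
  d), which the step size keeps below a multiple of \<eta> D. Finally the entropy, of order N d, is
  divided by \<eta> N T, which gives the rate d D / N.\<close>

definition nearby :: "'i set \<Rightarrow> ('i \<Rightarrow> real) \<Rightarrow> ('i \<Rightarrow> real) filter" where
  "nearby I x = inf (filtercomap (\<lambda>y. L2_set (\<lambda>i. y i - x i) I) (nhds 0)) (principal (I \<rightarrow>\<^sub>E UNIV))"

definition has_grad :: "'i set \<Rightarrow> (('i \<Rightarrow> real) \<Rightarrow> real) \<Rightarrow> ('i \<Rightarrow> real) \<Rightarrow> ('i \<Rightarrow> real) \<Rightarrow> bool" where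
  "has_grad I f g x \<longleftrightarrow> (\<forall>\<epsilon>>0. \<exists>\<delta>>0. \<forall>y\<in>I \<rightarrow>\<^sub>E UNIV. L2_set (\<lambda>i. y i - x i) I < \<delta> \<longrightarrow>
     \<bar>f y - f x - (\<Sum>i\<in>I. g i * (y i - x i))\<bar> \<le> \<epsilon> * L2_set (\<lambda>i. y i - x i) I)"

lemma differentiable_Rd_iff_has_grad:
  "differentiable_Rd d f \<longleftrightarrow> (\<forall>x\<in>Rd d. \<exists>g. has_grad {..<d} f g x)"
  by (simp add: differentiable_Rd_def has_grad_def)

lemma eventually_nearby:
  "eventually P (nearby I x) \<longleftrightarrow>
     (\<exists>\<delta>>0. \<forall>y\<in>I \<rightarrow>\<^sub>E UNIV. L2_set (\<lambda>i. y i - x i) I < \<delta> \<longrightarrow> P y)"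
  unfolding nearby_def eventually_inf_principal eventually_filtercomap eventually_nhds_metric dist_real_def
  apply safe
  subgoal for Q d by (intro exI[of _ d]) auto
  subgoal for d by (intro exI[of _ "\<lambda>r. \<bar>r\<bar> < d"]) auto
  done

lemma L2_set_cauchy: "\<bar>\<Sum>i\<in>I. f i * g i\<bar> \<le> L2_set f I * L2_set g I"
proof -
  have "\<bar>\<Sum>i\<in>I. f i * g i\<bar> \<le> (\<Sum>i\<in>I. \<bar>f i\<bar> * \<bar>g i\<bar>)"
    by (metis (no_types, lifting) abs_mult sum.cong sum_abs)
  then show ?thesis using L2_set_mult_ineq order_trans by blast
qed

lemma coords_eqI:
  fixes x y :: "'i \<Rightarrow> real"
  shows "x \<in> I \<rightarrow>\<^sub>E UNIV \<Longrightarrow> y \<in> I \<rightarrow>\<^sub>E UNIV \<Longrightarrow> (\<And>i. i \<in> I \<Longrightarrow> x i = y i) \<Longrightarrow> x = y"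
  by (rule PiE_ext)

text \<open>This turns the epsilon-delta definition into a limit, so that the calculus rules follow
  from limit rules. The filter \<open>nearby\<close> is not punctured: at \<open>x\<close> itself
  the quotient is 0/0 = 0.\<close>

lemma has_grad_tendsto:
  assumes "finite I" "x \<in> I \<rightarrow>\<^sub>E UNIV"
  shows "has_grad I f g x \<longleftrightarrow> ((\<lambda>y. (f y - f x - (\<Sum>i\<in>I. g i * (y i - x i))) / L2_set (\<lambda>i. y i - x i) I) \<longlongrightarrow> 0) (nearby I x)"
    (is "_ \<longleftrightarrow> (?r \<longlongrightarrow> 0) _")
proof -
  have eq: "\<bar>?r y\<bar> \<le> \<epsilon> \<longleftrightarrow> \<bar>f y - f x - (\<Sum>i\<in>I. g i * (y i - x i))\<bar> \<le> \<epsilon> * L2_set (\<lambda>i. y i - x i) I"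
    if "y \<in> I \<rightarrow>\<^sub>E UNIV" "\<epsilon> > 0" for y \<epsilon>
  proof (cases "L2_set (\<lambda>i. y i - x i) I = 0")
    case True
    then have "\<forall>i\<in>I. y i = x i" using assms by (simp add: L2_set_eq_0_iff)
    then have "y = x" using that assms by (intro coords_eqI) auto
    then show ?thesis using that by (simp add: L2_set_def)
  next
    case False
    then have "L2_set (\<lambda>i. y i - x i) I > 0" using L2_set_nonneg order_le_less by metis
    then show ?thesis by (simp add: abs_divide pos_divide_le_eq)
  qed
  show ?thesis
  proof
    assume h: "has_grad I f g x"
    show "(?r \<longlongrightarrow> 0) (nearby I x)"
    proof (rule tendstoI)
      fix e :: real assume "e > 0"
      then have e2: "e/2 > 0" by simp
      from h[unfolded has_grad_def, rule_format, OF e2] obtain \<delta> where "\<delta> > 0"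
        and *: "\<And>y. y\<in>I \<rightarrow>\<^sub>E UNIV \<Longrightarrow> L2_set (\<lambda>i. y i - x i) I < \<delta> \<Longrightarrow>
          \<bar>f y - f x - (\<Sum>i\<in>I. g i * (y i - x i))\<bar> \<le> e/2 * L2_set (\<lambda>i. y i - x i) I" by blast
      show "\<forall>\<^sub>F y in nearby I x. dist (?r y) 0 < e"
        unfolding eventually_nearby
      proof (intro exI[of _ \<delta>] conjI ballI impI)
        fix y assume y: "y\<in>I \<rightarrow>\<^sub>E (UNIV::real set)" "L2_set (\<lambda>i. y i - x i) I < \<delta>"
        from *[OF y] have "\<bar>?r y\<bar> \<le> e/2" using eq[OF y(1) e2] by blast
        then show "dist (?r y) 0 < e" using \<open>e > 0\<close> unfolding dist_real_def by linarith
      qed fact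
    qed
  next
    assume h: "(?r \<longlongrightarrow> 0) (nearby I x)"
    show "has_grad I f g x"
      unfolding has_grad_def
    proof (intro allI impI)
      fix e :: real assume "e > 0"
      from tendstoD[OF h this] obtain \<delta> where "\<delta> > 0"
        and *: "\<And>y. y\<in>I \<rightarrow>\<^sub>E UNIV \<Longrightarrow> L2_set (\<lambda>i. y i - x i) I < \<delta> \<Longrightarrow> dist (?r y) 0 < e"
        unfolding eventually_nearby by blast
      show "\<exists>\<delta>>0. \<forall>y\<in>I \<rightarrow>\<^sub>E UNIV. L2_set (\<lambda>i. y i - x i) I < \<delta> \<longrightarrow>
          \<bar>f y - f x - (\<Sum>i\<in>I. g i * (y i - x i))\<bar> \<le> e * L2_set (\<lambda>i. y i - x i) I"
      proof (intro exI[of _ \<delta>] conjI ballI impI)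
        fix y assume y: "y\<in>I \<rightarrow>\<^sub>E (UNIV::real set)" "L2_set (\<lambda>i. y i - x i) I < \<delta>"
        from *[OF y] have "\<bar>?r y\<bar> \<le> e" unfolding dist_real_def by linarith
        then show "\<bar>f y - f x - (\<Sum>i\<in>I. g i * (y i - x i))\<bar> \<le> e * L2_set (\<lambda>i. y i - x i) I"
          using eq[OF y(1) \<open>e > 0\<close>] by blast
      qed fact
    qed
  qed
qed

lemma tendsto_dist_nearby: "((\<lambda>y. L2_set (\<lambda>i. y i - x i) I) \<longlongrightarrow> 0) (nearby I x)"
  unfolding nearby_def by (rule tendsto_mono[OF inf_le1 filterlim_filtercomap])

lemma filterlim_nearby:
  assumes "((\<lambda>a. L2_set (\<lambda>i. y a i - x i) I) \<longlongrightarrow> 0) F" "\<forall>\<^sub>F a in F. y a \<in> I \<rightarrow>\<^sub>E UNIV"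
  shows "filterlim y (nearby I x) F"
  unfolding nearby_def
  by (intro filterlim_inf[THEN iffD2] conjI)
     (use assms in \<open>auto simp: filterlim_principal filterlim_filtercomap_iff comp_def\<close>)

text \<open>The linear part over the distance has no limit, but it is bounded. Paired with a factor
  tending to 0 it disappears, which handles the cross terms in the product and chain rules.\<close>

lemma linear_quotient_bounded:
  "\<bar>(\<Sum>i\<in>I. g i * (y i - x i)) / L2_set (\<lambda>i. y i - x i) I\<bar> \<le> L2_set g I"
proof (cases "L2_set (\<lambda>i. y i - x i) I = 0")
  case False
  then have "L2_set (\<lambda>i. y i - x i) I > 0" using L2_set_nonneg order_le_less by metis
  then show ?thesis using L2_set_cauchy[of g "\<lambda>i. y i - x i" I] by (simp add: abs_divide pos_divide_le_eq)
qed simp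

lemma tendsto_mult_bounded_0:
  fixes q l :: "'a \<Rightarrow> real"
  assumes "(q \<longlongrightarrow> 0) F" "\<And>y. \<bar>l y\<bar> \<le> C"
  shows "((\<lambda>y. q y * l y) \<longlongrightarrow> 0) F"
  by (rule tendsto_0_le[OF assms(1), of _ C]) (auto simp: abs_mult intro!: always_eventually mult_left_mono assms(2))

lemma has_grad_cont:
  assumes "finite I" "x \<in> I \<rightarrow>\<^sub>E UNIV" "has_grad I f g x"
  shows "(f \<longlongrightarrow> f x) (nearby I x)"
proof -
  define r where "r y = (f y - f x - (\<Sum>i\<in>I. g i * (y i - x i))) / L2_set (\<lambda>i. y i - x i) I" for y
  define l where "l y = (\<Sum>i\<in>I. g i * (y i - x i)) / L2_set (\<lambda>i. y i - x i) I" for y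
  have r: "(r \<longlongrightarrow> 0) (nearby I x)" using assms has_grad_tendsto unfolding r_def by blast
  have l: "\<bar>l y\<bar> \<le> L2_set g I" for y unfolding l_def by (rule linear_quotient_bounded)
  have eq: "f x + (L2_set (\<lambda>i. y i - x i) I * r y + L2_set (\<lambda>i. y i - x i) I * l y) = f y"
    if "y \<in> I \<rightarrow>\<^sub>E UNIV" for y
  proof (cases "L2_set (\<lambda>i. y i - x i) I = 0")
    case True
    then have "\<forall>i\<in>I. y i = x i" using assms by (simp add: L2_set_eq_0_iff)
    then have "y = x" using that assms by (intro coords_eqI) auto
    then show ?thesis by (simp add: L2_set_def)
  qed (simp add: r_def l_def)
  have "((\<lambda>y. f x + (L2_set (\<lambda>i. y i - x i) I * r y + L2_set (\<lambda>i. y i - x i) I * l y)) \<longlongrightarrow> f x + (0 * 0 + 0)) (nearby I x)"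
    by (intro tendsto_intros tendsto_mult_bounded_0[OF _ l] tendsto_dist_nearby r)
  moreover have "\<forall>\<^sub>F y in nearby I x. f x + (L2_set (\<lambda>i. y i - x i) I * r y + L2_set (\<lambda>i. y i - x i) I * l y) = f y"
    unfolding eventually_nearby using eq by (intro exI[of _ 1]) auto
  ultimately show ?thesis using tendsto_cong by fastforce
qed

lemma has_grad_cong:
  assumes "has_grad I f g x" "\<And>y. y \<in> I \<rightarrow>\<^sub>E UNIV \<Longrightarrow> f y = f' y" "\<And>i. i \<in> I \<Longrightarrow> g i = g' i"
    "x \<in> I \<rightarrow>\<^sub>E UNIV"
  shows "has_grad I f' g' x"
proof -
  have "(\<Sum>i\<in>I. g i * h i) = (\<Sum>i\<in>I. g' i * h i)" for h using assms(3) by (intro sum.cong) auto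
  then show ?thesis using assms(1,2,4) by (simp add: has_grad_def)
qed

lemma has_grad_const: "has_grad I (\<lambda>_. c) (\<lambda>_. 0) x"
  unfolding has_grad_def by (intro allI impI exI[of _ 1]) auto

lemma has_grad_add:
  assumes "finite I" "x \<in> I \<rightarrow>\<^sub>E UNIV" "has_grad I f g x" "has_grad I f' g' x"
  shows "has_grad I (\<lambda>y. f y + f' y) (\<lambda>i. g i + g' i) x"
proof -
  have "((\<lambda>y. (f y - f x - (\<Sum>i\<in>I. g i * (y i - x i))) / L2_set (\<lambda>i. y i - x i) I
    + (f' y - f' x - (\<Sum>i\<in>I. g' i * (y i - x i))) / L2_set (\<lambda>i. y i - x i) I) \<longlongrightarrow> 0 + 0) (nearby I x)"
    using assms has_grad_tendsto by (intro tendsto_add) blast+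
  moreover have "(f y - f x - (\<Sum>i\<in>I. g i * (y i - x i))) / L2_set (\<lambda>i. y i - x i) I
    + (f' y - f' x - (\<Sum>i\<in>I. g' i * (y i - x i))) / L2_set (\<lambda>i. y i - x i) I
    = (f y + f' y - (f x + f' x) - (\<Sum>i\<in>I. (g i + g' i) * (y i - x i))) / L2_set (\<lambda>i. y i - x i) I" for y
    unfolding add_divide_distrib[symmetric] distrib_right sum.distrib
    by (rule arg_cong2[where f="(/)"]) auto
  ultimately show ?thesis
    unfolding has_grad_tendsto[OF assms(1,2)] by simp
qed

lemma has_grad_mult:
  assumes "finite I" "x \<in> I \<rightarrow>\<^sub>E UNIV" "has_grad I f g x" "has_grad I f' g' x"
  shows "has_grad I (\<lambda>y. f y * f' y) (\<lambda>i. g i * f' x + f x * g' i) x"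
proof -
  let ?n = "\<lambda>y. L2_set (\<lambda>i. y i - x i) I"
  note r = assms(3)[unfolded has_grad_tendsto[OF assms(1,2)]]
  note r' = assms(4)[unfolded has_grad_tendsto[OF assms(1,2)]]
  have c: "(f' \<longlongrightarrow> f' x) (nearby I x)" by (rule has_grad_cont[OF assms(1,2,4)])
  then have c0: "((\<lambda>y. f' y - f' x) \<longlongrightarrow> 0) (nearby I x)" by (simp add: LIM_zero)
  \<comment> \<open>The remainder of the product consists of the two single remainders and the
    linear part of \<open>f\<close> times the increment of \<open>f'\<close>; the last is a
    vanishing factor times a bounded quotient.\<close>
  have "((\<lambda>y. f' y * ((f y - f x - (\<Sum>i\<in>I. g i * (y i - x i))) / ?n y)
    + f x * ((f' y - f' x - (\<Sum>i\<in>I. g' i * (y i - x i))) / ?n y)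
    + (f' y - f' x) * ((\<Sum>i\<in>I. g i * (y i - x i)) / ?n y)) \<longlongrightarrow> f' x * 0 + f x * 0 + 0) (nearby I x)"
    by (rule tendsto_add[OF tendsto_add[OF tendsto_mult[OF c r] tendsto_mult[OF tendsto_const r']]
          tendsto_mult_bounded_0[OF c0 linear_quotient_bounded]])
  moreover have "f' y * ((f y - f x - (\<Sum>i\<in>I. g i * (y i - x i))) / ?n y)
    + f x * ((f' y - f' x - (\<Sum>i\<in>I. g' i * (y i - x i))) / ?n y)
    + (f' y - f' x) * ((\<Sum>i\<in>I. g i * (y i - x i)) / ?n y)
    = (f y * f' y - f x * f' x - (\<Sum>i\<in>I. (g i * f' x + f x * g' i) * (y i - x i))) / ?n y" for y
  proof -
    have "(\<Sum>i\<in>I. (g i * f' x + f x * g' i) * (y i - x i))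
      = f' x * (\<Sum>i\<in>I. g i * (y i - x i)) + f x * (\<Sum>i\<in>I. g' i * (y i - x i))"
      unfolding sum_distrib_left sum.distrib[symmetric] by (intro sum.cong) (auto simp: algebra_simps)
    then show ?thesis
      unfolding times_divide_eq_right add_divide_distrib[symmetric]
      by (intro arg_cong2[where f="(/)"]) (auto simp: algebra_simps)
  qed
  ultimately show ?thesis unfolding has_grad_tendsto[OF assms(1,2)] by simp
qed

lemma has_grad_cmult:
  assumes "finite I" "x \<in> I \<rightarrow>\<^sub>E UNIV" "has_grad I f g x"
  shows "has_grad I (\<lambda>y. c * f y) (\<lambda>i. c * g i) x"
  using has_grad_mult[OF assms(1,2) has_grad_const assms(3), of c] by simp

lemma has_grad_sum:
  assumes "finite I" "x \<in> I \<rightarrow>\<^sub>E UNIV" "finite J" "\<And>j. j \<in> J \<Longrightarrow> has_grad I (f j) (g j) x"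
  shows "has_grad I (\<lambda>y. \<Sum>j\<in>J. f j y) (\<lambda>i. \<Sum>j\<in>J. g j i) x"
  using assms(3,4)
proof (induction J rule: finite_induct)
  case empty
  then show ?case by (simp add: has_grad_const)
next
  case (insert j J)
  then show ?case using has_grad_add[OF assms(1,2), of "f j" "g j"] by simp
qed

text \<open>Caratheodory's slope function \<open>q\<close> of \<open>h\<close> avoids dividing by
  \<open>f y - f x\<close>, which may vanish arbitrarily close to \<open>x\<close>.\<close>

lemma has_grad_compose_real:
  assumes "finite I" "x \<in> I \<rightarrow>\<^sub>E UNIV" "has_grad I f g x" "(h has_real_derivative h') (at (f x))"
  shows "has_grad I (\<lambda>y. h (f y)) (\<lambda>i. h' * g i) x"
proof -
  let ?n = "\<lambda>y. L2_set (\<lambda>i. y i - x i) I"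
  obtain q where q: "\<And>z. h z - h (f x) = q z * (z - f x)" "isCont q (f x)" "q (f x) = h'"
    using assms(4) unfolding CARAT_DERIV by blast
  have f: "(f \<longlongrightarrow> f x) (nearby I x)" by (rule has_grad_cont[OF assms(1-3)])
  have qf: "((\<lambda>y. q (f y)) \<longlongrightarrow> h') (nearby I x)"
    using isCont_tendsto_compose[OF q(2) f] q(3) by simp
  then have c0: "((\<lambda>y. q (f y) - h') \<longlongrightarrow> 0) (nearby I x)" by (simp add: LIM_zero)
  have "((\<lambda>y. q (f y) * ((f y - f x - (\<Sum>i\<in>I. g i * (y i - x i))) / ?n y)
     + (q (f y) - h') * ((\<Sum>i\<in>I. g i * (y i - x i)) / ?n y)) \<longlongrightarrow> h' * 0 + 0) (nearby I x)"
    by (rule tendsto_add[OF tendsto_mult[OF qf assms(3)[unfolded has_grad_tendsto[OF assms(1,2)]]]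
          tendsto_mult_bounded_0[OF c0 linear_quotient_bounded]])
  moreover have "q (f y) * ((f y - f x - (\<Sum>i\<in>I. g i * (y i - x i))) / ?n y)
     + (q (f y) - h') * ((\<Sum>i\<in>I. g i * (y i - x i)) / ?n y)
     = (h (f y) - h (f x) - (\<Sum>i\<in>I. (h' * g i) * (y i - x i))) / ?n y" for y
    unfolding q(1) times_divide_eq_right add_divide_distrib[symmetric] mult.assoc sum_distrib_left[symmetric]
    by (intro arg_cong2[where f="(/)"]) (auto simp: algebra_simps)
  ultimately show ?thesis unfolding has_grad_tendsto[OF assms(1,2)] by simp
qed

text \<open>Along the curve the remainder quotient tends to 0. It is multiplied by the distance from
  \<open>y t0\<close> divided by |t - t0|, which tends to the norm of \<open>v\<close>.\<close>

lemma has_grad_curve: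
  assumes "finite I" "\<And>t. y t \<in> I \<rightarrow>\<^sub>E UNIV" "has_grad I f g (y t0)"
    and v: "\<And>i. i \<in> I \<Longrightarrow> ((\<lambda>t. y t i) has_real_derivative v i) (at t0)"
  shows "((\<lambda>t. f (y t)) has_real_derivative (\<Sum>i\<in>I. g i * v i)) (at t0)"
proof -
  let ?x = "y t0"
  define r where "r z = (f z - f ?x - (\<Sum>i\<in>I. g i * (z i - ?x i))) / L2_set (\<lambda>i. z i - ?x i) I" for z
  have r: "(r \<longlongrightarrow> 0) (nearby I ?x)" using assms has_grad_tendsto unfolding r_def by blast
  have quot: "((\<lambda>t. (y t i - ?x i) / (t - t0)) \<longlongrightarrow> v i) (at t0)" if "i \<in> I" for i
    using v[OF that] by (simp add: has_field_derivative_iff)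
  have L2q: "((\<lambda>t. L2_set (\<lambda>i. (y t i - ?x i) / (t - t0)) I) \<longlongrightarrow> L2_set v I) (at t0)"
    unfolding L2_set_def by (intro tendsto_intros quot)
  have "((\<lambda>t. y t i - ?x i) \<longlongrightarrow> 0) (at t0)" if "i \<in> I" for i
    using DERIV_isCont[OF v[OF that]] by (simp add: isCont_def LIM_zero)
  then have "((\<lambda>t. L2_set (\<lambda>i. y t i - ?x i) I) \<longlongrightarrow> L2_set (\<lambda>i. 0) I) (at t0)"
    unfolding L2_set_def by (intro tendsto_intros) auto
  then have "filterlim y (nearby I ?x) (at t0)"
    using assms(2) by (intro filterlim_nearby) (auto simp: L2_set_def)
  then have ry: "((\<lambda>t. r (y t)) \<longlongrightarrow> 0) (at t0)" using r filterlim_compose by blast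
  then have "((\<lambda>t. \<bar>r (y t)\<bar> * L2_set (\<lambda>i. (y t i - ?x i) / (t - t0)) I) \<longlongrightarrow> 0 * L2_set v I) (at t0)"
    using L2q by (intro tendsto_mult tendsto_rabs_zero)
  then have "((\<lambda>t. r (y t) * L2_set (\<lambda>i. y t i - ?x i) I / (t - t0)) \<longlongrightarrow> 0) (at t0)"
  proof -
    assume "((\<lambda>t. \<bar>r (y t)\<bar> * L2_set (\<lambda>i. (y t i - ?x i) / (t - t0)) I) \<longlongrightarrow> 0 * L2_set v I) (at t0)"
    then have l: "((\<lambda>t. \<bar>r (y t)\<bar> * L2_set (\<lambda>i. (y t i - ?x i) / (t - t0)) I) \<longlongrightarrow> 0) (at t0)" by simp
    have "L2_set (\<lambda>i. (y t i - ?x i) / (t - t0)) I = L2_set (\<lambda>i. y t i - ?x i) I / \<bar>t - t0\<bar>" for t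
      by (simp add: L2_set_def power_divide sum_divide_distrib[symmetric] real_sqrt_divide)
    then have "\<bar>r (y t) * L2_set (\<lambda>i. y t i - ?x i) I / (t - t0)\<bar> = \<bar>r (y t)\<bar> * L2_set (\<lambda>i. (y t i - ?x i) / (t - t0)) I" for t
      by (simp add: abs_mult)
    then have "((\<lambda>t. \<bar>r (y t) * L2_set (\<lambda>i. y t i - ?x i) I / (t - t0)\<bar>) \<longlongrightarrow> 0) (at t0)"
      using l by presburger
    then show ?thesis by (rule tendsto_rabs_zero_cancel)
  qed
  then have "((\<lambda>t. (\<Sum>i\<in>I. g i * ((y t i - ?x i) / (t - t0))) + r (y t) * L2_set (\<lambda>i. y t i - ?x i) I / (t - t0)) \<longlongrightarrow> (\<Sum>i\<in>I. g i * v i) + 0) (at t0)"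
    by (intro tendsto_add tendsto_sum tendsto_mult tendsto_const quot)
  moreover have "(\<Sum>i\<in>I. g i * ((y t i - ?x i) / (t - t0))) + r (y t) * L2_set (\<lambda>i. y t i - ?x i) I / (t - t0)
     = (f (y t) - f ?x) / (t - t0)" for t
  proof -
    have "r (y t) * L2_set (\<lambda>i. y t i - ?x i) I = f (y t) - f ?x - (\<Sum>i\<in>I. g i * (y t i - ?x i))"
    proof (cases "L2_set (\<lambda>i. y t i - ?x i) I = 0")
      case True
      then have "\<forall>i\<in>I. y t i = ?x i" using assms by (simp add: L2_set_eq_0_iff)
      then have "y t = ?x" by (intro coords_eqI[OF assms(2) assms(2)]) simp
      then show ?thesis by (simp add: L2_set_def)
    qed (simp add: r_def)
    then show ?thesis
      unfolding times_divide_eq_right sum_divide_distrib[symmetric] add_divide_distrib[symmetric] by simp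
  qed
  ultimately show ?thesis by (simp add: has_field_derivative_iff)
qed

lemma has_grad_coord:
  assumes "finite I" "x \<in> I \<rightarrow>\<^sub>E UNIV" "has_grad I f g x" "i \<in> I"
  shows "((\<lambda>t. f (x(i := t))) has_real_derivative g i) (at (x i))"
proof -
  have "((\<lambda>t. f (x(i := t))) has_real_derivative (\<Sum>l\<in>I. g l * (if l = i then 1 else 0))) (at (x i))"
  proof (rule has_grad_curve[where y="\<lambda>t. x(i := t)"])
    show "x(i := t) \<in> I \<rightarrow>\<^sub>E UNIV" for t using assms by (auto simp: PiE_iff extensional_def)
    show "has_grad I f g (x(i := x i))" using assms by simp
    show "((\<lambda>t. (x(i := t)) l) has_real_derivative (if l = i then 1 else 0)) (at (x i))" if "l \<in> I" for l
      by (auto intro!: derivative_eq_intros)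
  qed fact
  moreover have "(\<Sum>l\<in>I. g l * (if l = i then 1 else 0)) = (\<Sum>l\<in>I. if l = i then g l else 0)"
    by (intro sum.cong) auto
  ultimately show ?thesis using assms(1,4) by simp
qed

lemma has_grad_partial:
  assumes "differentiable_Rd d f" "x \<in> Rd d"
  shows "has_grad {..<d} f (\<lambda>i. partial i f x) x"
proof -
  obtain g where g: "has_grad {..<d} f g x" using assms differentiable_Rd_iff_has_grad by blast
  have "partial i f x = g i" if "i < d" for i
    unfolding partial_def using has_grad_coord[OF _ assms(2) g, of i] that by (intro DERIV_imp_deriv) auto
  then show ?thesis using has_grad_cong[OF g, of f] assms(2) by auto
qed

section \<open>Measurability from continuity and from coordinate derivatives\<close>

text \<open>Composed with restriction to \<open>I\<close>, the function is continuous on the full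
  product space. Since the index type is countable, the Borel sets there are those of the product
  sigma-algebra.\<close>

lemma borel_measurable_cont:
  fixes f :: "('i::countable \<Rightarrow> real) \<Rightarrow> real"
  assumes "finite I" "\<And>x. x \<in> I \<rightarrow>\<^sub>E UNIV \<Longrightarrow> (f \<longlongrightarrow> f x) (nearby I x)"
  shows "f \<in> borel_measurable (PiM I (\<lambda>_. borel))"
proof -
  have "continuous_on UNIV (\<lambda>x. f (restrict x I))"
    unfolding continuous_on_eq_continuous_at[OF open_UNIV]
  proof
    fix x :: "'i \<Rightarrow> real" assume "x \<in> UNIV"
    have c: "((\<lambda>y. y i) \<longlongrightarrow> x i) (at x)" for i
      using continuous_on_product_coordinates[of i] unfolding continuous_on_def by auto
    have "((\<lambda>y. sqrt (\<Sum>i\<in>I. (y i - x i)\<^sup>2)) \<longlongrightarrow> sqrt (\<Sum>i\<in>I. (x i - x i)\<^sup>2)) (at x)"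
      by (intro tendsto_real_sqrt tendsto_sum tendsto_power tendsto_diff tendsto_const c)
    then have "filterlim (\<lambda>y. restrict y I) (nearby I (restrict x I)) (at x)"
      by (intro filterlim_nearby) (auto simp: L2_set_def)
    then show "isCont (\<lambda>x. f (restrict x I)) x"
      unfolding isCont_def using assms(2)[of "restrict x I"] filterlim_compose by fastforce
  qed
  then have "(\<lambda>x. f (restrict x I)) \<in> borel_measurable borel"
    by (rule borel_measurable_continuous_onI)
  then have m: "(\<lambda>x. f (restrict x I)) \<in> borel_measurable (PiM UNIV (\<lambda>_. borel))"
    using measurable_cong_sets[OF sets_PiM_equal_borel refl] by blast
  \<comment> \<open>Outside \<open>I\<close> every point of the smaller product has the value
    \<open>undefined\<close>, so those coordinates are constant.\<close>
  have "(\<lambda>x. x) \<in> measurable (PiM I (\<lambda>_. borel)) (PiM UNIV (\<lambda>_. borel :: real measure))"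
  proof (rule measurable_PiM_single')
    fix i show "(\<lambda>x. x i) \<in> borel_measurable (PiM I (\<lambda>_. borel :: real measure))"
    proof (cases "i \<in> I")
      case False
      have "(\<lambda>x. x i) \<in> borel_measurable (PiM I (\<lambda>_. borel :: real measure)) \<longleftrightarrow> (\<lambda>x. undefined::real) \<in> borel_measurable (PiM I (\<lambda>_. borel :: real measure))"
        using False by (intro measurable_cong) (auto simp: space_PiM PiE_def extensional_def)
      then show ?thesis by simp
    qed simp
  qed auto
  from measurable_compose[OF this m]
  have "(\<lambda>x. f (restrict x I)) \<in> borel_measurable (PiM I (\<lambda>_. borel))" .
  moreover have "f (restrict x I) = f x" if "x \<in> space (PiM I (\<lambda>_. borel))" for x
    using that by (simp add: space_PiM PiE_restrict)
  ultimately show ?thesis using measurable_cong by (metis (mono_tags, lifting))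
qed

text \<open>The derivative is a pointwise limit of difference quotients with increments 1/(n+1), so
  it is measurable even where it is discontinuous.\<close>

lemma borel_measurable_coord_deriv:
  fixes f :: "('i::countable \<Rightarrow> real) \<Rightarrow> real"
  assumes [measurable]: "f \<in> borel_measurable (PiM I (\<lambda>_. borel))" and i: "i \<in> I"
    and D: "\<And>x. x \<in> I \<rightarrow>\<^sub>E UNIV \<Longrightarrow> ((\<lambda>t. f (x(i := t))) has_real_derivative D x) (at (x i))"
  shows "D \<in> borel_measurable (PiM I (\<lambda>_. borel))"
proof (rule borel_measurable_LIMSEQ_real)
  let ?h = "\<lambda>n. 1 / real (Suc n)"
  fix x :: "'i \<Rightarrow> real" assume "x \<in> space (PiM I (\<lambda>_. borel))"
  then have "((\<lambda>t. f (x(i := t))) has_real_derivative D x) (at (x i))" by (intro D) (simp add: space_PiM)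
  then have "((\<lambda>h. (f (x(i := x i + h)) - f (x(i := x i))) / h) \<longlongrightarrow> D x) (at 0)"
    by (simp add: DERIV_def)
  moreover have "filterlim ?h (at 0) sequentially"
    unfolding filterlim_at using lim_inverse_n'[THEN LIMSEQ_Suc] by simp
  ultimately show "(\<lambda>n. (f (x(i := x i + ?h n)) - f x) / ?h n) \<longlonglongrightarrow> D x"
    using filterlim_compose by fastforce
next
  fix n
  let ?c = "1 / real (Suc n)"
  have "(\<lambda>x. x(i := x i + ?c)) \<in> measurable (PiM I (\<lambda>_. borel)) (PiM I (\<lambda>_. borel :: real measure))"
    by (rule measurable_fun_upd[where J=I]) (use i in auto)
  from measurable_compose[OF this assms(1)]
  show "(\<lambda>x. (f (x(i := x i + ?c)) - f x) / ?c) \<in> borel_measurable (PiM I (\<lambda>_. borel))"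
    by measurable
qed

text \<open>Testing the increment against a fixed direction reduces this to the real mean value theorem.\<close>

lemma lipschitz_of_gradient_bound:
  assumes "finite I" "C \<ge> 0"
    and "\<And>x i. x \<in> I \<rightarrow>\<^sub>E UNIV \<Longrightarrow> i \<in> J \<Longrightarrow> has_grad I (g i) (M x i) x"
    and bd: "\<And>x u v. x \<in> I \<rightarrow>\<^sub>E UNIV \<Longrightarrow> (\<Sum>i\<in>J. \<Sum>j\<in>I. u i * M x i j * v j) \<le> C * L2_set u J * L2_set v I"
    and xy: "x \<in> I \<rightarrow>\<^sub>E UNIV" "y \<in> I \<rightarrow>\<^sub>E UNIV"
  shows "L2_set (\<lambda>i. g i y - g i x) J \<le> C * L2_set (\<lambda>i. y i - x i) I"
proof -
  define z where "z t = (\<lambda>i\<in>I. x i + t * (y i - x i))" for t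
  define u where "u i = g i y - g i x" for i
  have z: "z t \<in> I \<rightarrow>\<^sub>E UNIV" for t by (auto simp: z_def)
  have "((\<lambda>t. \<Sum>i\<in>J. u i * g i (z t)) has_real_derivative (\<Sum>i\<in>J. u i * (\<Sum>j\<in>I. M (z t) i j * (y j - x j)))) (at t)" for t
  proof (intro DERIV_sum DERIV_cmult)
    fix i assume "i \<in> J"
    have "((\<lambda>t. z t j) has_real_derivative y j - x j) (at t)" if "j \<in> I" for j
      unfolding z_def using that by (auto intro!: derivative_eq_intros)
    then show "((\<lambda>t. g i (z t)) has_real_derivative (\<Sum>j\<in>I. M (z t) i j * (y j - x j))) (at t)"
      by (rule has_grad_curve[OF assms(1) z assms(3)[OF z \<open>i \<in> J\<close>]])
  qed
  then obtain t where t: "(\<Sum>i\<in>J. u i * g i (z 1)) - (\<Sum>i\<in>J. u i * g i (z 0))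
    = (1 - 0) * (\<Sum>i\<in>J. u i * (\<Sum>j\<in>I. M (z t) i j * (y j - x j)))"
    using MVT2[of 0 1 "\<lambda>t. \<Sum>i\<in>J. u i * g i (z t)"] by fastforce
  have z1: "z 1 = y" "z 0 = x" using xy by (auto simp: z_def PiE_def extensional_def)
  have "(L2_set u J)^2 = (\<Sum>i\<in>J. u i * g i (z 1)) - (\<Sum>i\<in>J. u i * g i (z 0))"
  proof -
    have "(L2_set u J)^2 = (\<Sum>i\<in>J. (u i)^2)" by (simp add: L2_set_def sum_nonneg)
    then show ?thesis
      by (simp add: sum_subtractf[symmetric] z1 u_def power2_eq_square right_diff_distrib)
  qed
  also have "\<dots> = (\<Sum>i\<in>J. \<Sum>j\<in>I. u i * M (z t) i j * (y j - x j))"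
    unfolding t by (simp add: sum_distrib_left mult.assoc)
  also have "\<dots> \<le> C * L2_set u J * L2_set (\<lambda>i. y i - x i) I" by (rule bd[OF z])
  finally have *: "L2_set u J * L2_set u J \<le> L2_set u J * (C * L2_set (\<lambda>i. y i - x i) I)"
    by (simp add: power2_eq_square algebra_simps)
  have "L2_set u J \<le> C * L2_set (\<lambda>i. y i - x i) I"
  proof (cases "L2_set u J = 0")
    case True then show ?thesis using assms by simp
  next
    case False then have "L2_set u J > 0" using L2_set_nonneg order_le_less by metis
    then show ?thesis using * by simp
  qed
  then show ?thesis by (simp add: u_def[abs_def])
qed

lemma matrix_vector_frobenius:
  "L2_set (\<lambda>i. \<Sum>j\<in>I. M i j * v j) J \<le> sqrt (\<Sum>i\<in>J. \<Sum>j\<in>I. (M i j)\<^sup>2) * L2_set v I"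
proof -
  have "(\<Sum>i\<in>J. (\<Sum>j\<in>I. M i j * v j)\<^sup>2) \<le> (\<Sum>i\<in>J. (\<Sum>j\<in>I. (M i j)\<^sup>2) * (\<Sum>j\<in>I. (v j)\<^sup>2))"
    by (intro sum_mono Cauchy_Schwarz_ineq_sum)
  then show ?thesis unfolding L2_set_def
    by (simp add: sum_distrib_right[symmetric] real_sqrt_mult[symmetric])
qed

lemma bilinear_frobenius_bound:
  "(\<Sum>i\<in>J. \<Sum>j\<in>I. u i * M i j * v j) \<le> sqrt (\<Sum>i\<in>J. \<Sum>j\<in>I. (M i j)\<^sup>2) * L2_set u J * L2_set v I"
proof -
  have "(\<Sum>i\<in>J. \<Sum>j\<in>I. u i * M i j * v j) = (\<Sum>i\<in>J. u i * (\<Sum>j\<in>I. M i j * v j))"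
    by (simp add: sum_distrib_left mult.assoc)
  also have "\<dots> \<le> L2_set u J * L2_set (\<lambda>i. \<Sum>j\<in>I. M i j * v j) J"
    using L2_set_cauchy[of u "\<lambda>i. \<Sum>j\<in>I. M i j * v j" J] by linarith
  also have "L2_set (\<lambda>i. \<Sum>j\<in>I. M i j * v j) J \<le> sqrt (\<Sum>i\<in>J. \<Sum>j\<in>I. (M i j)\<^sup>2) * L2_set v I"
    by (rule matrix_vector_frobenius)
  finally show ?thesis by (simp add: mult_left_mono mult.left_commute mult.assoc)
qed

section \<open>Change of variables for perturbations of the identity\<close>

text \<open>Push the measure with density \<open>f\<close> forward along \<open>F\<close>. By the
  fundamental theorem of calculus for nonnegative derivatives, the image gives each open interval
  its length, so it is Lebesgue measure. No continuity of \<open>f\<close> is involved.\<close>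

lemma nn_integral_substitution_expanding:
  fixes F f :: "real \<Rightarrow> real" and \<phi> :: "real \<Rightarrow> ennreal"
  assumes D: "\<And>t. (F has_real_derivative f t) (at t)" and f: "\<And>t. f t \<ge> 1/2"
    and \<phi>[measurable]: "\<phi> \<in> borel_measurable borel"
  shows "(\<integral>\<^sup>+t. \<phi> (F t) * ennreal (f t) \<partial>lborel) = (\<integral>\<^sup>+t. \<phi> t \<partial>lborel)"
proof -
  have cont: "isCont F t" for t using D DERIV_isCont by blast
  then have contU: "continuous_on S F" for S by (simp add: continuous_at_imp_continuous_on)
  have [measurable]: "F \<in> borel_measurable borel"
    using contU by (rule borel_measurable_continuous_onI)
  have [measurable]: "f \<in> borel_measurable borel"
  proof (rule borel_measurable_LIMSEQ_real)
    fix t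
    have "((\<lambda>h. (F (t + h) - F t) / h) \<longlongrightarrow> f t) (at 0)" using D by (simp add: DERIV_def)
    moreover have "filterlim (\<lambda>n. 1 / real (Suc n)) (at 0) sequentially"
      unfolding filterlim_at using lim_inverse_n'[THEN LIMSEQ_Suc] by simp
    ultimately show "(\<lambda>n. (F (t + 1 / real (Suc n)) - F t) / (1 / real (Suc n))) \<longlonglongrightarrow> f t"
      using filterlim_compose by fastforce
  qed measurable
  have mono: "F s < F t" if "s < t" for s t
    using that by (rule DERIV_pos_imp_increasing) (use D f in \<open>meson half_gt_zero less_le_trans zero_less_one\<close>)
  have growth: "F t - F s \<ge> (t - s) / 2" if le: "s \<le> t" for s t
  proof (cases "s = t")
    case False
    then have "s < t" using le by simp
    from MVT2[OF this D] obtain z where "F t - F s = (t - s) * f z" by blast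
    moreover have "(t - s) * (1/2) \<le> (t - s) * f z" using f[of z] \<open>s < t\<close> by (intro mult_left_mono) auto
    ultimately show ?thesis by simp
  qed simp
  have surj: "\<exists>t. F t = y" for y
  proof -
    \<comment> \<open>As the slope is at least 1/2, \<open>F\<close> reaches the value
      \<open>y\<close> within distance 2 |y - F 0| of 0.\<close>
    define r where "r = 2 * \<bar>y - F 0\<bar>"
    have r: "r \<ge> 0" by (simp add: r_def)
    have "F (- r) \<le> y" using growth[of "- r" 0] r by (simp add: r_def)
    moreover have "y \<le> F r" using growth[of 0 r] r by (simp add: r_def)
    ultimately show ?thesis using IVT'[of F "- r" y r] contU r by fastforce
  qed
  define \<nu> where "\<nu> = distr (density lborel (\<lambda>t. ennreal (f t))) lborel F"
  have "lborel = \<nu>"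
  proof (rule lborel_eqI)
    show "sets \<nu> = sets borel" by (simp add: \<nu>_def)
    fix l u :: real assume "\<And>b. b \<in> Basis \<Longrightarrow> l \<bullet> b \<le> u \<bullet> b"
    then have lu: "l \<le> u" by simp
    obtain a b where ab: "F a = l" "F b = u" using surj by meson
    have le: "a \<le> b" using lu mono[of b a] ab by force
    have F: "F t \<in> {l<..<u} \<longleftrightarrow> t \<in> {a<..<b}" for t
      using mono[of a t] mono[of t a] mono[of b t] mono[of t b] ab
      by (metis greaterThanLessThan_iff less_asym linorder_neqE_linordered_idom)
    have "emeasure \<nu> {l<..<u} = emeasure (density lborel (\<lambda>t. ennreal (f t))) {a<..<b}"
      unfolding \<nu>_def by (subst emeasure_distr) (auto intro!: arg_cong2[where f=emeasure] simp: F[unfolded greaterThanLessThan_iff])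
    also have "\<dots> = (\<integral>\<^sup>+t. ennreal (f t) * indicator {a<..<b} t \<partial>lborel)"
      by (subst emeasure_density) auto
    also have "\<dots> = (\<integral>\<^sup>+t. ennreal (f t) * indicator {a..b} t \<partial>lborel)"
    proof (rule nn_integral_cong_AE)
      have "AE t in lborel. t \<noteq> a \<and> t \<noteq> b"
        by (intro AE_conjI AE_lborel_singleton)
      then show "AE t in lborel. ennreal (f t) * indicator {a<..<b} t = ennreal (f t) * indicator {a..b} t"
        by eventually_elim (auto simp: indicator_def)
    qed
    also have "\<dots> = ennreal (F b - F a)"
      by (intro nn_integral_FTC_Icc D le) (use f in \<open>auto intro: order_trans[of 0 "1/2"]\<close>)
    finally show "emeasure \<nu> (box l u) = (\<Prod>b\<in>Basis. (u - l) \<bullet> b)"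
      using ab by simp
  qed
  then have "(\<integral>\<^sup>+t. \<phi> t \<partial>lborel) = (\<integral>\<^sup>+t. \<phi> t \<partial>\<nu>)" by simp
  also have "\<dots> = (\<integral>\<^sup>+t. ennreal (f t) * \<phi> (F t) \<partial>lborel)"
    unfolding \<nu>_def by (simp add: nn_integral_distr nn_integral_density)
  finally show ?thesis by (simp add: mult.commute)
qed

text \<open>Here \<open>m\<close> is a diagonal entry of the matrix and \<open>s\<close> bounds the
  Schur correction. With z = m^2 + s, the inequality exp t \<le> 1 / (1 - t) reduces the claim to (1
  - m + 2z)(1 + m - s) \<ge> 1. The product is 1 + z plus terms that lose at most 5z/9.\<close>

lemma exp_le_pivot:
  fixes m s :: real
  assumes "s \<ge> 0" "m\<^sup>2 + s \<le> 1/36"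
  shows "exp (m - 2 * (m\<^sup>2 + s)) \<le> 1 + m - s"
proof -
  define z where "z = m\<^sup>2 + s"
  have z: "0 \<le> z" "z \<le> 1/36" "s \<le> z" using assms by (auto simp: z_def)
  have "m\<^sup>2 \<le> (1/6)\<^sup>2" using assms by (simp add: power2_eq_square)
  then have m: "\<bar>m\<bar> \<le> 1/6" using abs_le_square_iff[of m "1/6"] by simp
  have pos: "1 - m + 2 * z > 0" using m z by auto
  have "(1 - m + 2 * z) * (1 + m - s) = 1 + (z + m * s + 2 * (z * m) - 2 * (z * s))"
    by (simp add: z_def power2_eq_square algebra_simps)
  moreover have "m * s \<ge> - (1/6) * s" "z * m \<ge> z * (- (1/6))"
    using m z assms mult_right_mono[of "- (1/6)" m s] mult_left_mono[of "- (1/6)" m z] by auto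
  moreover have "z * s \<le> z * (1/36)" using z by (intro mult_left_mono) auto
  ultimately have "(1 - m + 2 * z) * (1 + m - s) \<ge> 1" using z by simp
  then have le: "1 / (1 - m + 2 * z) \<le> 1 + m - s" using pos by (simp add: divide_le_eq mult.commute)
  have "1 - m + 2 * z \<le> exp (- (m - 2 * z))" using exp_ge_add_one_self[of "- (m - 2*z)"] by linarith
  then have "exp (m - 2 * z) * (1 - m + 2 * z) \<le> exp (m - 2 * z) * exp (- (m - 2 * z))"
    by (intro mult_left_mono) auto
  also have "\<dots> = 1" by (simp only: exp_add[symmetric] add.right_inverse exp_zero)
  finally have "exp (m - 2 * z) \<le> 1 / (1 - m + 2 * z)" using pos by (simp only: pos_le_divide_eq)
  then show ?thesis using le by (simp add: z_def)
qed

lemma L2_set_abs [simp]: "L2_set (\<lambda>i. \<bar>f i\<bar>) I = L2_set f I"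
  by (simp add: L2_set_def)

lemma L2_set_diff_commute: "L2_set (\<lambda>i. f i - g i) I = L2_set (\<lambda>i. g i - f i) I"
  by (simp add: L2_set_def power2_commute)

lemma abs_le_L2_set: "finite I \<Longrightarrow> i \<in> I \<Longrightarrow> \<bar>f i\<bar> \<le> L2_set f I"
  using member_le_L2_set[of I i "\<lambda>i. \<bar>f i\<bar>"] by simp

section \<open>Inverting a small Lipschitz perturbation of the identity\<close>

lemma tendsto_telescope_geometric:
  fixes s :: "nat \<Rightarrow> real"
  assumes "\<And>n. \<bar>s (Suc n) - s n\<bar> \<le> C * (1/2) ^ n"
  shows "convergent s"
proof -
  have "summable (\<lambda>n. C * (1/2) ^ n)" by (intro summable_mult summable_geometric) auto
  then have "summable (\<lambda>n. s (Suc n) - s n)"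
    by (rule summable_comparison_test'[where N=0]) (unfold real_norm_def, rule assms)
  then have "convergent (\<lambda>n. \<Sum>k<n. s (Suc k) - s k)" by (simp add: summable_iff_convergent)
  then have "convergent (\<lambda>n. s n - s 0)" by (simp add: sum_lessThan_telescope)
  from convergent_add[OF this convergent_const[of "s 0"]] show ?thesis by simp
qed

text \<open>Picard iteration of x -> b - h(x), which contracts the Euclidean distance by 1/2, so
  that every coordinate converges geometrically. It serves twice: for the nonlinear shifts, and for
  the linear system of a tangent vector in \<open>pivot\<close>.\<close>

lemma perturbed_identity_surj:
  fixes h :: "'i \<Rightarrow> ('i \<Rightarrow> real) \<Rightarrow> real"
  assumes fin: "finite I"
    and lip: "\<And>x y. x \<in> I \<rightarrow>\<^sub>E UNIV \<Longrightarrow> y \<in> I \<rightarrow>\<^sub>E UNIV \<Longrightarrow>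
      L2_set (\<lambda>i. h i y - h i x) I \<le> 1/2 * L2_set (\<lambda>i. y i - x i) I"
    and b: "b \<in> I \<rightarrow>\<^sub>E UNIV"
  obtains x where "x \<in> I \<rightarrow>\<^sub>E UNIV" "\<And>i. i \<in> I \<Longrightarrow> x i + h i x = b i"
proof -
  define s where "s = rec_nat b (\<lambda>_ x. \<lambda>i\<in>I. b i - h i x)"
  have s0: "s 0 = b" and sS: "s (Suc n) = (\<lambda>i\<in>I. b i - h i (s n))" for n by (simp_all add: s_def)
  have sE: "s n \<in> I \<rightarrow>\<^sub>E UNIV" for n by (cases n) (auto simp: s0 sS b)
  define C where "C = L2_set (\<lambda>i. s 1 i - s 0 i) I"
  have geo: "L2_set (\<lambda>i. s (Suc n) i - s n i) I \<le> C * (1/2) ^ n" for n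
  proof (induction n)
    case (Suc n)
    have "L2_set (\<lambda>i. s (Suc (Suc n)) i - s (Suc n) i) I = L2_set (\<lambda>i. h i (s n) - h i (s (Suc n))) I"
      by (intro L2_set_cong) (auto simp: sS)
    also have "\<dots> \<le> 1/2 * L2_set (\<lambda>i. s (Suc n) i - s n i) I"
      using lip[OF sE[of n] sE[of "Suc n"]]
      unfolding L2_set_diff_commute[of "\<lambda>i. h i (s n)" "\<lambda>i. h i (s (Suc n))"] .
    finally show ?case using Suc by simp
  qed (simp add: C_def)
  have "convergent (\<lambda>n. s n i)" if "i \<in> I" for i
    using abs_le_L2_set[OF fin that, of "\<lambda>i. s (Suc _) i - s _ i"] geo
    by (intro tendsto_telescope_geometric[where C=C]) (rule order_trans)
  then obtain L where L: "\<And>i. i \<in> I \<Longrightarrow> (\<lambda>n. s n i) \<longlonglongrightarrow> L i"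
    unfolding convergent_def by metis
  define x where "x = restrict L I"
  have xE: "x \<in> I \<rightarrow>\<^sub>E UNIV" by (simp add: x_def)
  have x: "(\<lambda>n. s n i) \<longlonglongrightarrow> x i" if "i \<in> I" for i using L that by (simp add: x_def)
  have "(\<lambda>n. sqrt (\<Sum>i\<in>I. (s n i - x i)\<^sup>2)) \<longlonglongrightarrow> sqrt (\<Sum>i\<in>I. (x i - x i)\<^sup>2)"
    by (intro tendsto_real_sqrt tendsto_sum tendsto_power tendsto_diff tendsto_const x)
  then have d0: "(\<lambda>n. L2_set (\<lambda>i. s n i - x i) I) \<longlonglongrightarrow> 0" by (simp add: L2_set_def)
  have "x i + h i x = b i" if i: "i \<in> I" for i
  proof -
    have "(\<lambda>n. h i (s n) - h i x) \<longlonglongrightarrow> 0"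
    proof (rule tendsto_0_le[OF d0, of _ "1/2"], rule always_eventually, rule allI)
      fix n
      show "norm (h i (s n) - h i x) \<le> norm (L2_set (\<lambda>i. s n i - x i) I) * (1/2)"
        using abs_le_L2_set[OF fin i, of "\<lambda>i. h i (s n) - h i x"] lip[OF xE sE[of n]] by simp
    qed
    then have "(\<lambda>n. b i - h i (s n)) \<longlonglongrightarrow> b i - h i x"
      using tendsto_diff[OF tendsto_const[of "b i - h i x"]] by fastforce
    moreover have "(\<lambda>n. b i - h i (s n)) \<longlonglongrightarrow> x i"
      using LIMSEQ_Suc[OF x[OF i]] i by (simp add: sS)
    ultimately show ?thesis using LIMSEQ_unique by fastforce
  qed
  then show ?thesis using that xE by blast
qed

section \<open>Shifting one coordinate at a time\<close>

text \<open>The bound 1/36 gives every block of the matrix Frobenius norm at most 1/6. This leaves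
  room for all later constants: the shifts have inverses with Lipschitz constant 2, and the pivots
  are at least 1/2.\<close>

locale perturbation =
  fixes I :: "'i::countable set" and g :: "'i \<Rightarrow> ('i \<Rightarrow> real) \<Rightarrow> real"
    and M :: "('i \<Rightarrow> real) \<Rightarrow> 'i \<Rightarrow> 'i \<Rightarrow> real"
  assumes fin: "finite I"
    and grad: "\<And>x i. x \<in> I \<rightarrow>\<^sub>E UNIV \<Longrightarrow> i \<in> I \<Longrightarrow> has_grad I (g i) (M x i) x"
    and small: "\<And>x. x \<in> I \<rightarrow>\<^sub>E UNIV \<Longrightarrow> (\<Sum>i\<in>I. \<Sum>j\<in>I. (M x i j)\<^sup>2) \<le> 1/36"
begin

abbreviation "E \<equiv> I \<rightarrow>\<^sub>E (UNIV :: real set)"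

text \<open>These maps interpolate between the identity, for empty \<open>J\<close>, and the full
  perturbation, for \<open>J = I\<close>. Enlarging \<open>J\<close> by one index changes one
  coordinate of the image.\<close>

definition shift :: "'i set \<Rightarrow> ('i \<Rightarrow> real) \<Rightarrow> 'i \<Rightarrow> real" where
  "shift J x = (\<lambda>i\<in>I. if i \<in> J then x i + g i x else x i)"

definition unshift :: "'i set \<Rightarrow> ('i \<Rightarrow> real) \<Rightarrow> 'i \<Rightarrow> real" where
  "unshift J = inv_into E (shift J)"

lemma shift_in: "shift J x \<in> E"
  by (simp add: shift_def)

lemma sub_small:
  assumes "x \<in> E" "J \<subseteq> I" "L \<subseteq> I"
  shows "(\<Sum>i\<in>J. \<Sum>j\<in>L. (M x i j)\<^sup>2) \<le> 1/36" "sqrt (\<Sum>i\<in>J. \<Sum>j\<in>L. (M x i j)\<^sup>2) \<le> 1/6"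
proof -
  have "(\<Sum>i\<in>J. \<Sum>j\<in>L. (M x i j)\<^sup>2) \<le> (\<Sum>i\<in>I. \<Sum>j\<in>I. (M x i j)\<^sup>2)"
    by (rule order_trans[OF sum_mono sum_mono2]) (use assms fin in \<open>auto intro!: sum_mono2 sum_nonneg\<close>)
  also have "\<dots> \<le> 1/36" using small assms by blast
  finally show *: "(\<Sum>i\<in>J. \<Sum>j\<in>L. (M x i j)\<^sup>2) \<le> 1/36" .
  then have "sqrt (\<Sum>i\<in>J. \<Sum>j\<in>L. (M x i j)\<^sup>2) \<le> sqrt ((1/6)\<^sup>2)"
    by (intro real_sqrt_le_mono) (simp add: power2_eq_square)
  then show "sqrt (\<Sum>i\<in>J. \<Sum>j\<in>L. (M x i j)\<^sup>2) \<le> 1/6" by (simp only: real_sqrt_abs)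
qed

lemma mult_sub_small:
  assumes "x \<in> E" "J \<subseteq> I" "L \<subseteq> I"
  shows "L2_set (\<lambda>i. \<Sum>j\<in>L. M x i j * v j) J \<le> 1/6 * L2_set v L"
  by (rule order_trans[OF matrix_vector_frobenius])
     (rule mult_right_mono[OF sub_small(2)[OF assms] L2_set_nonneg])

lemma g_lipschitz:
  assumes "x \<in> E" "y \<in> E" "J \<subseteq> I"
  shows "L2_set (\<lambda>i. g i y - g i x) J \<le> 1/6 * L2_set (\<lambda>i. y i - x i) I"
proof (rule lipschitz_of_gradient_bound[where M=M])
  fix x u v assume x: "x \<in> E"
  have "(\<Sum>i\<in>J. \<Sum>j\<in>I. u i * M x i j * v j) \<le> sqrt (\<Sum>i\<in>J. \<Sum>j\<in>I. (M x i j)\<^sup>2) * L2_set u J * L2_set v I"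
    by (rule bilinear_frobenius_bound)
  also have "\<dots> \<le> 1/6 * L2_set u J * L2_set v I"
    using sub_small(2)[OF x assms(3) order_refl] by (intro mult_right_mono) auto
  finally show "(\<Sum>i\<in>J. \<Sum>j\<in>I. u i * M x i j * v j) \<le> 1/6 * L2_set u J * L2_set v I" .
qed (use assms fin grad in auto)

lemma L2_set_restrict: "J \<subseteq> I \<Longrightarrow> L2_set (\<lambda>i. if i \<in> J then f i else 0) I = L2_set f J"
  unfolding L2_set_def using fin
  by (intro arg_cong[where f=sqrt] sum.mono_neutral_cong_right) auto

lemma shift_surj:
  assumes "b \<in> E" "J \<subseteq> I"
  obtains x where "x \<in> E" "shift J x = b"
proof -
  obtain x where x: "x \<in> E" "\<And>i. i \<in> I \<Longrightarrow> x i + (if i \<in> J then g i x else 0) = b i"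
  proof (rule perturbed_identity_surj[OF fin _ assms(1), where h="\<lambda>i x. if i \<in> J then g i x else 0"])
    fix x y assume xy: "x \<in> E" "y \<in> E"
    have "L2_set (\<lambda>i. (if i \<in> J then g i y else 0) - (if i \<in> J then g i x else 0)) I = L2_set (\<lambda>i. g i y - g i x) J"
      unfolding L2_set_restrict[OF assms(2), symmetric] by (intro L2_set_cong) auto
    also have "\<dots> \<le> 1/6 * L2_set (\<lambda>i. y i - x i) I" by (rule g_lipschitz) fact+
    finally show "L2_set (\<lambda>i. (if i \<in> J then g i y else 0) - (if i \<in> J then g i x else 0)) I \<le> 1/2 * L2_set (\<lambda>i. y i - x i) I"
      using L2_set_nonneg[of "\<lambda>i. y i - x i" I] by linarith
  qed auto
  then have "shift J x = b" by (intro coords_eqI[OF shift_in assms(1)]) (force simp: shift_def)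
  then show ?thesis using that x by blast
qed

text \<open>By the triangle inequality a shift shrinks distances by at most the factor 1 - 1/6,
  which is more than 1/2. Injectivity and the Lipschitz bound of the inverse both follow.\<close>

lemma shift_expanding:
  assumes "x \<in> E" "y \<in> E" "J \<subseteq> I"
  shows "L2_set (\<lambda>i. y i - x i) I \<le> 2 * L2_set (\<lambda>i. shift J y i - shift J x i) I"
proof -
  have "L2_set (\<lambda>i. y i - x i) I = L2_set (\<lambda>i. (shift J y i - shift J x i) + (if i \<in> J then g i x - g i y else 0)) I"
    by (intro L2_set_cong) (auto simp: shift_def)
  also have "\<dots> \<le> L2_set (\<lambda>i. shift J y i - shift J x i) I + L2_set (\<lambda>i. g i x - g i y) J"
    unfolding L2_set_restrict[OF assms(3), symmetric] by (rule L2_set_triangle_ineq)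
  also have "L2_set (\<lambda>i. g i x - g i y) J \<le> 1/6 * L2_set (\<lambda>i. y i - x i) I"
    using g_lipschitz[OF assms(2,1,3)] L2_set_diff_commute[of x y I] by simp
  finally show ?thesis using L2_set_nonneg[of "\<lambda>i. y i - x i" I] by linarith
qed

lemma shift_inj: "J \<subseteq> I \<Longrightarrow> inj_on (shift J) E"
proof (rule inj_onI)
  fix x y assume J: "J \<subseteq> I" and xy: "x \<in> E" "y \<in> E" "shift J x = shift J y"
  then have "L2_set (\<lambda>i. y i - x i) I \<le> 0" using shift_expanding[of x y J] by (simp add: L2_set_def)
  then have "L2_set (\<lambda>i. y i - x i) I = 0" using L2_set_nonneg[of "\<lambda>i. y i - x i" I] by linarith
  then have "\<forall>i\<in>I. y i - x i = 0" using L2_set_eq_0_iff[OF fin, of "\<lambda>i. y i - x i"] by simp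
  then show "x = y" using xy by (intro coords_eqI[OF xy(1,2)]) simp
qed

lemma unshift:
  assumes "J \<subseteq> I"
  shows "y \<in> E \<Longrightarrow> unshift J y \<in> E" "y \<in> E \<Longrightarrow> shift J (unshift J y) = y"
    "x \<in> E \<Longrightarrow> unshift J (shift J x) = x"
proof -
  have img: "y \<in> shift J ` E" if y: "y \<in> E" for y
  proof -
    obtain x where "x \<in> E" "shift J x = y" using shift_surj[OF y assms] .
    then show ?thesis by (intro image_eqI[of y _ x]) auto
  qed
  show "unshift J y \<in> E" if "y \<in> E"
    unfolding unshift_def by (rule inv_into_into[OF img[OF that]])
  show "shift J (unshift J y) = y" if "y \<in> E"
    unfolding unshift_def by (rule f_inv_into_f[OF img[OF that]])
  show "unshift J (shift J x) = x" if "x \<in> E"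
    unfolding unshift_def by (rule inv_into_f_f[OF shift_inj[OF assms] that])
qed

lemma unshift_lipschitz:
  assumes "J \<subseteq> I" "x \<in> E" "y \<in> E"
  shows "L2_set (\<lambda>i. unshift J y i - unshift J x i) I \<le> 2 * L2_set (\<lambda>i. y i - x i) I"
  using shift_expanding[OF unshift(1)[OF assms(1,2)] unshift(1)[OF assms(1,3)] assms(1)]
    unshift(2)[OF assms(1)] assms by simp

lemma measurable_g: "i \<in> I \<Longrightarrow> g i \<in> borel_measurable (PiM I (\<lambda>_. borel))"
  by (rule borel_measurable_cont[OF fin has_grad_cont[OF fin _ grad]])

lemma measurable_M: "i \<in> I \<Longrightarrow> j \<in> I \<Longrightarrow> (\<lambda>x. M x i j) \<in> borel_measurable (PiM I (\<lambda>_. borel))"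
  by (rule borel_measurable_coord_deriv[OF measurable_g _ has_grad_coord[OF fin _ grad]])

lemma measurable_unshift:
  assumes "J \<subseteq> I"
  shows "unshift J \<in> measurable (PiM I (\<lambda>_. borel)) (PiM I (\<lambda>_. borel))"
proof (rule measurable_PiM_single')
  fix i assume i: "i \<in> I"
  show "(\<lambda>x. unshift J x i) \<in> borel_measurable (PiM I (\<lambda>_. borel))"
  proof (rule borel_measurable_cont[OF fin])
    fix x assume x: "x \<in> E"
    have "((\<lambda>y. unshift J y i - unshift J x i) \<longlongrightarrow> 0) (nearby I x)"
    proof (rule tendsto_0_le[OF tendsto_dist_nearby[of x I], of _ 2], unfold eventually_nearby, intro exI[of _ 1] conjI ballI impI)
      fix y assume y: "y \<in> E"
      have "\<bar>unshift J y i - unshift J x i\<bar> \<le> 2 * L2_set (\<lambda>i. y i - x i) I"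
        using abs_le_L2_set[OF fin i, of "\<lambda>i. unshift J y i - unshift J x i"] unshift_lipschitz[OF assms x y] by linarith
      then show "norm (unshift J y i - unshift J x i) \<le> norm (L2_set (\<lambda>i. y i - x i) I) * 2" by simp
    qed simp
    then show "((\<lambda>y. unshift J y i) \<longlongrightarrow> unshift J x i) (nearby I x)" by (simp add: LIM_zero_iff)
  qed
next
  show "unshift J \<in> space (PiM I (\<lambda>_. borel)) \<rightarrow> I \<rightarrow>\<^sub>E space borel"
    using unshift(1)[OF assms] by (simp add: space_PiM)
qed

text \<open>The derivative of the last coordinate of \<^term>\<open>shift (insert j J)\<close> read in the coordinates
  \<^term>\<open>shift J\<close> is the Schur complement of the block \<open>J\<close> in the Jacobian.\<close>

lemma pivot:
  assumes J: "J \<subseteq> I" and j: "j \<in> I" "j \<notin> J" and y: "y \<in> E"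
  obtains D where
    "((\<lambda>t. t + g j (unshift J (y(j := t)))) has_real_derivative D) (at (y j))"
    "D \<ge> 1 + M (unshift J y) j j - ((\<Sum>l\<in>J. (M (unshift J y) j l)\<^sup>2) + (\<Sum>l\<in>J. (M (unshift J y) l j)\<^sup>2))"
proof -
  define X where "X t = unshift J (y(j := t))" for t
  define x where "x = unshift J y"
  let ?t0 = "y j"
  have yt: "y(j := t) \<in> E" for t using y j by (auto simp: PiE_iff extensional_def)
  have XE: "X t \<in> E" for t unfolding X_def by (rule unshift(1)[OF J yt])
  have xE: "x \<in> E" and X0: "X ?t0 = x" using XE[of ?t0] by (auto simp: X_def x_def)
  have finJ: "finite J" using J fin finite_subset by blast
  \<comment> \<open>The prospective derivative of \<open>X\<close> at \<open>y j\<close>: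
    differentiating \<open>shift J (X t) = y(j := t)\<close> formally gives this linear system,
    solvable since the block has norm at most 1/6.\<close>
  obtain v where v: "v \<in> E" "\<And>i. i \<in> I \<Longrightarrow> v i + (if i \<in> J then (\<Sum>l\<in>I. M x i l * v l) else 0) = (\<lambda>i\<in>I. if i = j then 1 else 0) i"
  proof (rule perturbed_identity_surj[OF fin, where h="\<lambda>i v. if i \<in> J then (\<Sum>l\<in>I. M x i l * v l) else 0" and b="\<lambda>i\<in>I. if i = j then 1 else 0"])
    fix v w assume "v \<in> E" "w \<in> E"
    have "L2_set (\<lambda>i. (if i \<in> J then (\<Sum>l\<in>I. M x i l * w l) else 0) - (if i \<in> J then (\<Sum>l\<in>I. M x i l * v l) else 0)) I
      = L2_set (\<lambda>i. \<Sum>l\<in>I. M x i l * (w l - v l)) J"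
      unfolding L2_set_restrict[OF J, symmetric]
      by (intro L2_set_cong) (auto simp: right_diff_distrib sum_subtractf)
    also have "\<dots> \<le> 1/6 * L2_set (\<lambda>i. w i - v i) I" by (rule mult_sub_small[OF xE J order_refl])
    finally show "L2_set (\<lambda>i. (if i \<in> J then (\<Sum>l\<in>I. M x i l * w l) else 0) - (if i \<in> J then (\<Sum>l\<in>I. M x i l * v l) else 0)) I
       \<le> 1/2 * L2_set (\<lambda>i. w i - v i) I"
      using L2_set_nonneg[of "\<lambda>i. w i - v i" I] by linarith
  qed auto
  have vj: "v j = 1" using v(2)[OF j(1)] j by simp
  have v0: "v i = 0" if "i \<in> I" "i \<notin> J" "i \<noteq> j" for i using v(2)[OF that(1)] that by simp
  have sum_v: "(\<Sum>l\<in>I. a l * v l) = a j + (\<Sum>l\<in>J. a l * v l)" for a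
  proof -
    have "(\<Sum>l\<in>I. a l * v l) = (\<Sum>l\<in>insert j J. a l * v l)"
      using J j fin v0 by (intro sum.mono_neutral_right) auto
    then show ?thesis using j finJ vj by simp
  qed
  define r where "r i z = (g i z - g i x - (\<Sum>l\<in>I. M x i l * (z l - x l))) / L2_set (\<lambda>l. z l - x l) I" for i z
  have rI: "(r i \<longlongrightarrow> 0) (nearby I x)" if "i \<in> I" for i
    using grad[OF xE that] has_grad_tendsto[OF fin xE] unfolding r_def by blast
  have r: "g i z - g i x = (\<Sum>l\<in>I. M x i l * (z l - x l)) + r i z * L2_set (\<lambda>l. z l - x l) I" if "z \<in> E" for i z
  proof (cases "L2_set (\<lambda>l. z l - x l) I = 0")
    case True
    then have "z = x" using that xE fin by (intro coords_eqI) (auto simp: L2_set_eq_0_iff)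
    then show ?thesis by (simp add: L2_set_def)
  qed (simp add: r_def)
  \<comment> \<open>Lipschitz continuity of \<open>X\<close> comes first. It allows the remainders
    \<open>r\<close> to be evaluated along \<open>X\<close> before \<open>X\<close> is known to be
    differentiable.\<close>
  have dX: "L2_set (\<lambda>i. X t i - x i) I \<le> 2 * \<bar>t - ?t0\<bar>" for t
  proof -
    have "L2_set (\<lambda>i. (y(j := t)) i - y i) I = L2_set (\<lambda>i. if i \<in> {j} then t - ?t0 else 0) I"
      by (intro L2_set_cong) auto
    also have "\<dots> = \<bar>t - ?t0\<bar>" using j by (subst L2_set_restrict) auto
    finally show ?thesis using unshift_lipschitz[OF J y yt[of t]] by (simp add: X_def x_def)
  qed
  have Xlim: "filterlim X (nearby I x) (at ?t0)"
  proof (rule filterlim_nearby)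
    have "((\<lambda>t. t - ?t0) \<longlongrightarrow> 0) (at ?t0)" by (simp add: LIM_zero)
    then show "((\<lambda>t. L2_set (\<lambda>i. X t i - x i) I) \<longlongrightarrow> 0) (at ?t0)"
      by (rule tendsto_0_le[where K=2]) (auto intro!: always_eventually simp: dX mult.commute)
  qed (simp add: XE)
  \<comment> \<open>The deviation \<open>e\<close> from the linear prediction solves the same linear
    system with the remainders on the right-hand side. The matrix contributes at most 1/6 of the
    norm of \<open>e\<close>, which is absorbed on the left.\<close>
  have err: "\<bar>X t i - x i - (t - ?t0) * v i\<bar> \<le> 4 * (\<Sum>k\<in>J. \<bar>r k (X t)\<bar>) * \<bar>t - ?t0\<bar>" if i: "i \<in> I" for t i
  proof -
    define e where "e i = X t i - x i - (t - ?t0) * v i" for i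
    let ?n = "L2_set (\<lambda>l. X t l - x l) I"
    have e: "e i = (if i \<in> J then - (\<Sum>l\<in>I. M x i l * e l) - r i (X t) * ?n else 0)" if i: "i \<in> I" for i
    proof -
      have s1: "shift J (X t) i = (y(j := t)) i" "shift J x i = y i"
        unfolding X_def x_def using unshift(2)[OF J] yt y by auto
      show ?thesis
      proof (cases "i \<in> J")
        case True
        then have "i \<noteq> j" using j by auto
        have "X t i + g i (X t) = y i" "x i + g i x = y i" using s1 i True \<open>i \<noteq> j\<close> by (auto simp: shift_def)
        then have "X t i - x i = - (g i (X t) - g i x)" by simp
        also have "\<dots> = - (\<Sum>l\<in>I. M x i l * (X t l - x l)) - r i (X t) * ?n" using r[OF XE[of t], of i] by simp
        finally have a: "X t i - x i = - (\<Sum>l\<in>I. M x i l * (X t l - x l)) - r i (X t) * ?n" .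
        have b: "v i = - (\<Sum>l\<in>I. M x i l * v l)" using v(2)[OF i] True \<open>i \<noteq> j\<close> i by simp
        have c: "(\<Sum>l\<in>I. M x i l * e l) = (\<Sum>l\<in>I. M x i l * (X t l - x l)) - (t - ?t0) * (\<Sum>l\<in>I. M x i l * v l)"
          unfolding e_def by (simp add: right_diff_distrib sum_subtractf sum_distrib_left mult.left_commute)
        show ?thesis unfolding c using True a b by (simp add: e_def)
      next
        case False
        have "X t i = (y(j := t)) i" "x i = y i" using s1 i False by (auto simp: shift_def)
        then show ?thesis using False i v0[OF i False] vj by (cases "i = j") (auto simp: e_def)
      qed
    qed
    have "L2_set e I = L2_set (\<lambda>i. if i \<in> J then - (\<Sum>l\<in>I. M x i l * e l) - r i (X t) * ?n else 0) I"
      by (intro L2_set_cong refl e)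
    also have "\<dots> = L2_set (\<lambda>i. (\<Sum>l\<in>I. M x i l * e l) + r i (X t) * ?n) J"
      by (subst L2_set_restrict[OF J]) (simp add: L2_set_def power2_eq_square algebra_simps)
    also have "\<dots> \<le> L2_set (\<lambda>i. \<Sum>l\<in>I. M x i l * e l) J + L2_set (\<lambda>i. r i (X t) * ?n) J"
      by (rule L2_set_triangle_ineq)
    also have "L2_set (\<lambda>i. \<Sum>l\<in>I. M x i l * e l) J \<le> 1/6 * L2_set e I" by (rule mult_sub_small[OF xE J order_refl])
    also have "L2_set (\<lambda>i. r i (X t) * ?n) J = ?n * L2_set (\<lambda>i. r i (X t)) J"
      by (simp add: L2_set_left_distrib mult.commute)
    also have "L2_set (\<lambda>i. r i (X t)) J \<le> (\<Sum>k\<in>J. \<bar>r k (X t)\<bar>)" by (rule L2_set_le_sum_abs)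
    finally have "L2_set e I \<le> 1/6 * L2_set e I + ?n * (\<Sum>k\<in>J. \<bar>r k (X t)\<bar>)"
      by (simp add: mult_left_mono)
    also have "?n * (\<Sum>k\<in>J. \<bar>r k (X t)\<bar>) \<le> (2 * \<bar>t - ?t0\<bar>) * (\<Sum>k\<in>J. \<bar>r k (X t)\<bar>)"
      by (intro mult_right_mono dX sum_nonneg) auto
    finally have "L2_set e I \<le> 2 * ((2 * \<bar>t - ?t0\<bar>) * (\<Sum>k\<in>J. \<bar>r k (X t)\<bar>))"
      using L2_set_nonneg[of e I] by linarith
    moreover have "\<bar>e i\<bar> \<le> L2_set e I" by (rule abs_le_L2_set[OF fin i])
    ultimately show ?thesis by (simp add: e_def mult.commute mult.left_commute)
  qed
  have "((\<lambda>t. \<Sum>k\<in>J. \<bar>r k (X t)\<bar>) \<longlongrightarrow> (\<Sum>k\<in>J. 0)) (at ?t0)"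
    using J by (intro tendsto_sum tendsto_rabs_zero filterlim_compose[OF rI Xlim]) auto
  then have r0: "((\<lambda>t. \<Sum>k\<in>J. \<bar>r k (X t)\<bar>) \<longlongrightarrow> 0) (at ?t0)" by simp
  have "((\<lambda>t. X t i) has_real_derivative v i) (at ?t0)" if i: "i \<in> I" for i
  proof -
    have "((\<lambda>t. (X t i - x i) / (t - ?t0) - v i) \<longlongrightarrow> 0) (at ?t0)"
    proof (rule tendsto_0_le[OF r0, where K=4])
      show "\<forall>\<^sub>F t in at ?t0. norm ((X t i - x i) / (t - ?t0) - v i) \<le> norm (\<Sum>k\<in>J. \<bar>r k (X t)\<bar>) * 4"
        unfolding eventually_at_filter
      proof (intro always_eventually allI impI)
        fix t assume t: "t \<noteq> ?t0"
        have "(X t i - x i) / (t - ?t0) - v i = (X t i - x i - (t - ?t0) * v i) / (t - ?t0)"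
          using t by (simp add: field_simps)
        then have "\<bar>(X t i - x i) / (t - ?t0) - v i\<bar> = \<bar>X t i - x i - (t - ?t0) * v i\<bar> / \<bar>t - ?t0\<bar>"
          by (simp only: abs_divide)
        also have "\<dots> \<le> 4 * (\<Sum>k\<in>J. \<bar>r k (X t)\<bar>)"
          using err[OF i, of t] t by (simp add: pos_divide_le_eq)
        finally show "norm ((X t i - x i) / (t - ?t0) - v i) \<le> norm (\<Sum>k\<in>J. \<bar>r k (X t)\<bar>) * 4"
          by (simp add: sum_nonneg)
      qed
    qed
    then have "((\<lambda>t. (X t i - X ?t0 i) / (t - ?t0)) \<longlongrightarrow> v i) (at ?t0)" by (simp add: LIM_zero_iff X0)
    then show ?thesis by (simp add: has_field_derivative_iff)
  qed
  then have "((\<lambda>t. g j (X t)) has_real_derivative (\<Sum>i\<in>I. M x j i * v i)) (at ?t0)"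
    by (intro has_grad_curve[OF fin XE]) (simp_all add: X0 grad[OF xE j(1)])
  then have der: "((\<lambda>t. t + g j (X t)) has_real_derivative 1 + (\<Sum>i\<in>I. M x j i * v i)) (at ?t0)"
    by (auto intro!: derivative_eq_intros)
  let ?c = "\<lambda>i. M x i j" let ?r = "M x j"
  \<comment> \<open>On \<open>J\<close> the tangent vector solves v = -(c + M v), with c the part of
    column \<open>j\<close> in \<open>J\<close>; hence its norm is at most twice that of c.\<close>
  have "L2_set v J = L2_set (\<lambda>i. ?c i + (\<Sum>l\<in>J. M x i l * v l)) J"
  proof -
    have "v i = - (?c i + (\<Sum>l\<in>J. M x i l * v l))" if "i \<in> J" for i
    proof -
      have "i \<noteq> j" "i \<in> I" using that j J by auto
      then have "v i + (\<Sum>l\<in>I. M x i l * v l) = 0" using v(2)[of i] that by simp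
      then show ?thesis unfolding sum_v by simp
    qed
    then have "(v i)\<^sup>2 = (?c i + (\<Sum>l\<in>J. M x i l * v l))\<^sup>2" if "i \<in> J" for i
      using that by (metis power2_minus)
    then show ?thesis unfolding L2_set_def by simp
  qed
  also have "\<dots> \<le> L2_set ?c J + L2_set (\<lambda>i. \<Sum>l\<in>J. M x i l * v l) J" by (rule L2_set_triangle_ineq)
  also have "L2_set (\<lambda>i. \<Sum>l\<in>J. M x i l * v l) J \<le> 1/6 * L2_set v J" by (rule mult_sub_small[OF xE J J])
  finally have vJ: "L2_set v J \<le> 2 * L2_set ?c J" using L2_set_nonneg[of v J] by linarith
  \<comment> \<open>The Schur correction is the row times the tangent vector, at most 2 |r| |c|
    \<le> |r|^2 + |c|^2.\<close>
  have "\<bar>\<Sum>l\<in>J. ?r l * v l\<bar> \<le> L2_set ?r J * L2_set v J" by (rule L2_set_cauchy)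
  also have "\<dots> \<le> L2_set ?r J * (2 * L2_set ?c J)" using vJ by (intro mult_left_mono) auto
  also have "\<dots> \<le> (L2_set ?r J)\<^sup>2 + (L2_set ?c J)\<^sup>2"
    using sum_squares_bound[of "L2_set ?r J" "L2_set ?c J"] by simp
  also have "\<dots> = (\<Sum>l\<in>J. (?r l)\<^sup>2) + (\<Sum>l\<in>J. (?c l)\<^sup>2)" by (simp add: L2_set_def sum_nonneg)
  finally have "1 + (\<Sum>i\<in>I. M x j i * v i) \<ge> 1 + M x j j - ((\<Sum>l\<in>J. (?r l)\<^sup>2) + (\<Sum>l\<in>J. (?c l)\<^sup>2))"
    unfolding sum_v by simp
  then show ?thesis using that der by (simp add: X_def x_def)
qed

text \<open>A lower bound for the product of the pivots. Each off-diagonal entry is charged to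
  exactly one pivot, that of the later of its two indices in the order of elimination.\<close>

definition jac :: "'i set \<Rightarrow> ('i \<Rightarrow> real) \<Rightarrow> real" where
  "jac J x = exp ((\<Sum>i\<in>J. M x i i) - 2 * (\<Sum>i\<in>J. \<Sum>l\<in>J. (M x i l)\<^sup>2))"

lemma sets_lborel_PiM: "sets (PiM I (\<lambda>_. lborel :: real measure)) = sets (PiM I (\<lambda>_. borel))"
  by (intro sets_PiM_cong) auto

lemma measurable_lborel_PiM:
  "borel_measurable (PiM I (\<lambda>_. lborel :: real measure)) = borel_measurable (PiM I (\<lambda>_. borel))"
  by (intro measurable_cong_sets sets_lborel_PiM) simp

text \<open>Induction on \<open>J\<close>. The next shift is the previous one followed by a map
  \<open>\<Lambda>\<close> that moves only coordinate \<open>j\<close>. The induction hypothesis,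
  applied to \<open>\<phi>\<close> composed with \<open>\<Lambda>\<close> and weighted by the pivot
  bound \<open>\<rho>\<close>, removes the previous shift. Fubini and the one-dimensional
  substitution remove \<open>\<Lambda>\<close>.\<close>

lemma nn_integral_shift_le:
  assumes "J \<subseteq> I" "\<phi> \<in> borel_measurable (PiM I (\<lambda>_. borel))"
  shows "(\<integral>\<^sup>+x. \<phi> (shift J x) * ennreal (jac J x) \<partial>PiM I (\<lambda>_. lborel)) \<le> (\<integral>\<^sup>+x. \<phi> x \<partial>PiM I (\<lambda>_. lborel))"
proof -
  have "finite J" using assms(1) fin finite_subset by blast
  then show ?thesis using assms
  proof (induction J arbitrary: \<phi> rule: finite_induct)
    case empty
    have "shift {} x = x" if "x \<in> E" for x
      by (rule coords_eqI[OF shift_in that]) (simp add: shift_def)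
    then show ?case by (intro nn_integral_mono) (simp add: jac_def space_PiM)
  next
    case (insert j J)
    note [measurable] = insert.prems(2)
    have J: "J \<subseteq> I" and j: "j \<in> I" "j \<notin> J" using insert by auto
    define \<rho> where "\<rho> y = 1 + M (unshift J y) j j - ((\<Sum>l\<in>J. (M (unshift J y) j l)\<^sup>2) + (\<Sum>l\<in>J. (M (unshift J y) l j)\<^sup>2))" for y
    define \<Lambda> where "\<Lambda> y = y(j := y j + g j (unshift J y))" for y
    have [measurable]: "unshift J \<in> measurable (PiM I (\<lambda>_. borel)) (PiM I (\<lambda>_. borel))"
      by (rule measurable_unshift[OF J])
    have [measurable]: "(\<lambda>x. M (unshift J x) a b) \<in> borel_measurable (PiM I (\<lambda>_. borel))" if "a \<in> I" "b \<in> I" for a b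
      by (rule measurable_compose[OF _ measurable_M]) (use that in measurable)
    have [measurable]: "(\<lambda>x. g j (unshift J x)) \<in> borel_measurable (PiM I (\<lambda>_. borel))"
      by (rule measurable_compose[OF _ measurable_g]) (use j in measurable)
    have \<rho>m[measurable]: "\<rho> \<in> borel_measurable (PiM I (\<lambda>_. borel))"
      unfolding \<rho>_def using J j by (intro borel_measurable_diff borel_measurable_add borel_measurable_sum borel_measurable_power) auto
    have \<Lambda>m[measurable]: "\<Lambda> \<in> measurable (PiM I (\<lambda>_. borel)) (PiM I (\<lambda>_. borel))"
      unfolding \<Lambda>_def using j by (intro measurable_fun_upd[where J=I]) auto
    have \<phi>\<Lambda>: "(\<lambda>y. \<phi> (\<Lambda> y) * ennreal (\<rho> y)) \<in> borel_measurable (PiM I (\<lambda>_. borel))"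
      by measurable
    have factor: "shift (insert j J) x = \<Lambda> (shift J x)" if x: "x \<in> E" for x
      unfolding \<Lambda>_def unshift(3)[OF J x] using j by (intro ext) (auto simp: shift_def)
    have pivots: "(M x j j)\<^sup>2 + ((\<Sum>l\<in>J. (M x j l)\<^sup>2) + (\<Sum>l\<in>J. (M x l j)\<^sup>2)) \<le> 1/36" if x: "x \<in> E" for x
    proof -
      have "(M x j j)\<^sup>2 + ((\<Sum>l\<in>J. (M x j l)\<^sup>2) + (\<Sum>l\<in>J. (M x l j)\<^sup>2))
        \<le> (\<Sum>i\<in>insert j J. \<Sum>l\<in>insert j J. (M x i l)\<^sup>2)"
        using insert.hyps by (simp add: sum.distrib sum_nonneg)
      then show ?thesis using sub_small(1)[OF x insert.prems(1) insert.prems(1)] by linarith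
    qed
    have jac: "jac (insert j J) x \<le> \<rho> (shift J x) * jac J x" if x: "x \<in> E" for x
    proof -
      let ?s = "(\<Sum>l\<in>J. (M x j l)\<^sup>2) + (\<Sum>l\<in>J. (M x l j)\<^sup>2)"
      have "jac (insert j J) x = exp (M x j j - 2 * ((M x j j)\<^sup>2 + ?s)) * jac J x"
        unfolding jac_def exp_add[symmetric] using insert.hyps by (simp add: sum.distrib algebra_simps)
      also have "\<dots> \<le> (1 + M x j j - ?s) * jac J x"
        using pivots[OF x] by (intro mult_right_mono exp_le_pivot) (auto intro!: add_nonneg_nonneg sum_nonneg simp: jac_def)
      finally show ?thesis by (simp add: \<rho>_def unshift(3)[OF J x])
    qed
    have \<rho>_ge: "\<rho> y \<ge> 1/2" if y: "y \<in> E" for y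
    proof -
      let ?x = "unshift J y"
      let ?s = "(\<Sum>l\<in>J. (M ?x j l)\<^sup>2) + (\<Sum>l\<in>J. (M ?x l j)\<^sup>2)"
      have p: "(M ?x j j)\<^sup>2 + ?s \<le> 1/36" "0 \<le> ?s"
        using pivots[OF unshift(1)[OF J y]] by (auto intro!: add_nonneg_nonneg sum_nonneg)
      then have "(M ?x j j)\<^sup>2 \<le> (1/6)\<^sup>2" by (simp add: power2_eq_square)
      then have "\<bar>M ?x j j\<bar> \<le> 1/6" using abs_le_square_iff[of "M ?x j j" "1/6"] by simp
      moreover have "?s \<le> 1/36" using p zero_le_power2[of "M ?x j j"] by linarith
      ultimately show ?thesis unfolding \<rho>_def by linarith
    qed
    have "(\<integral>\<^sup>+x. \<phi> (shift (insert j J) x) * ennreal (jac (insert j J) x) \<partial>PiM I (\<lambda>_. lborel))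
      \<le> (\<integral>\<^sup>+x. (\<phi> (\<Lambda> (shift J x)) * ennreal (\<rho> (shift J x))) * ennreal (jac J x) \<partial>PiM I (\<lambda>_. lborel))"
    proof (rule nn_integral_mono)
      fix x assume "x \<in> space (PiM I (\<lambda>_. lborel :: real measure))"
      then have x: "x \<in> E" by (simp add: space_PiM)
      have "ennreal (jac (insert j J) x) \<le> ennreal (\<rho> (shift J x)) * ennreal (jac J x)"
        using jac[OF x] \<rho>_ge[OF shift_in[of J x]] by (subst ennreal_mult[symmetric]) (auto simp: jac_def intro!: ennreal_leI)
      then show "\<phi> (shift (insert j J) x) * ennreal (jac (insert j J) x) \<le> (\<phi> (\<Lambda> (shift J x)) * ennreal (\<rho> (shift J x))) * ennreal (jac J x)"
        unfolding factor[OF x] mult.assoc by (rule mult_left_mono) simp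
    qed
    also have "\<dots> \<le> (\<integral>\<^sup>+y. \<phi> (\<Lambda> y) * ennreal (\<rho> y) \<partial>PiM I (\<lambda>_. lborel))"
      by (rule insert.IH[OF J \<phi>\<Lambda>])
    also have "\<dots> \<le> (\<integral>\<^sup>+y. \<phi> y \<partial>PiM I (\<lambda>_. lborel))"
    proof -
      define I' where "I' = I - {j}"
      have I: "I = insert j I'" "finite I'" "j \<notin> I'" using j fin by (auto simp: I'_def)
      interpret product_sigma_finite "\<lambda>_::'i. lborel :: real measure" by standard
      have split: "(\<integral>\<^sup>+y. f y \<partial>PiM I (\<lambda>_. lborel)) = (\<integral>\<^sup>+x. (\<integral>\<^sup>+t. f (x(j := t)) \<partial>lborel) \<partial>PiM I' (\<lambda>_. lborel))"
        if "f \<in> borel_measurable (PiM I (\<lambda>_. borel))" for f :: "('i \<Rightarrow> real) \<Rightarrow> ennreal"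
      proof -
        have "f \<in> borel_measurable (PiM (insert j I') (\<lambda>_. lborel))"
          using that unfolding measurable_lborel_PiM[unfolded I(1)] I(1) .
        then show ?thesis unfolding I(1) by (rule product_nn_integral_insert[OF I(2,3)])
      qed
      show ?thesis
        unfolding split[OF \<phi>\<Lambda>] split[OF insert.prems(2)]
      proof (rule nn_integral_mono)
        fix x assume "x \<in> space (PiM I' (\<lambda>_. lborel :: real measure))"
        then have x: "x(j := t) \<in> E" for t using j by (auto simp: space_PiM I'_def PiE_iff extensional_def)
        define F where "F t = t + g j (unshift J (x(j := t)))" for t
        have "\<exists>D. (F has_real_derivative D) (at t) \<and> D \<ge> \<rho> (x(j := t))" for t
          using pivot[OF J j x[of t]] by (fastforce simp: F_def[abs_def] \<rho>_def)
        then obtain f where f: "\<And>t. (F has_real_derivative f t) (at t)" "\<And>t. f t \<ge> \<rho> (x(j := t))" by metis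
        have f2: "f t \<ge> 1/2" for t using f(2)[of t] \<rho>_ge[OF x[of t]] by linarith
        \<comment> \<open>Here \<open>x\<close> has no coordinate \<open>j\<close>. Filling it with
          0 first gives a constant point of the full product, to which measurability of an update
          applies.\<close>
        have "(\<lambda>t. (x(j := 0))(j := t)) \<in> measurable borel (PiM I (\<lambda>_. borel))"
        proof (rule measurable_fun_upd[where J=I])
          show "(\<lambda>t. x(j := 0)) \<in> measurable borel (PiM I (\<lambda>_. borel))"
            by (rule measurable_const) (use x[of 0] in \<open>simp add: space_PiM\<close>)
        qed (use j in auto)
        from measurable_compose[OF this insert.prems(2)]
        have \<phi>x: "(\<lambda>t. \<phi> (x(j := t))) \<in> borel_measurable borel" by (simp only: fun_upd_upd)
        have "(\<integral>\<^sup>+t. \<phi> (\<Lambda> (x(j := t))) * ennreal (\<rho> (x(j := t))) \<partial>lborel) \<le> (\<integral>\<^sup>+t. \<phi> (x(j := F t)) * ennreal (f t) \<partial>lborel)"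
          using f(2) by (intro nn_integral_mono mult_mono ennreal_leI) (auto simp: \<Lambda>_def F_def)
        also have "\<dots> = (\<integral>\<^sup>+t. \<phi> (x(j := t)) \<partial>lborel)"
          by (rule nn_integral_substitution_expanding[OF f(1) f2 \<phi>x])
        finally show "(\<integral>\<^sup>+t. \<phi> (\<Lambda> (x(j := t))) * ennreal (\<rho> (x(j := t))) \<partial>lborel) \<le> (\<integral>\<^sup>+t. \<phi> (x(j := t)) \<partial>lborel)" .
      qed
    qed
    finally show ?case .
  qed
qed

end

section \<open>The discrepancy of an empirical measure\<close>

text \<open>A right inverse of the splitting in \<open>joint\<close>. Smoothness is assumed of the
  joint function on R^(2d), so the derivatives of the kernel are read off at points
  \<open>cat d x y\<close>.\<close>

definition cat :: "nat \<Rightarrow> vec \<Rightarrow> vec \<Rightarrow> vec" where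
  "cat d x y = (\<lambda>i\<in>{..<2*d}. if i < d then x i else y (i - d))"

lemma cat_in: "cat d x y \<in> Rd (2*d)"
  by (simp add: cat_def)

lemma cat_upd1: "l < d \<Longrightarrow> (cat d x y)(l := t) = cat d (x(l := t)) y"
  by (rule ext) (auto simp: cat_def)

lemma cat_upd2: "l < d \<Longrightarrow> (cat d x y)(d + l := t) = cat d x (y(l := t))"
  by (rule ext) (auto simp: cat_def)

lemma joint_cat: "x \<in> Rd d \<Longrightarrow> y \<in> Rd d \<Longrightarrow> joint d k (cat d x y) = k x y"
proof -
  assume xy: "x \<in> Rd d" "y \<in> Rd d"
  have "(\<lambda>i\<in>{..<d}. cat d x y i) = x" by (rule coords_eqI[OF _ xy(1)]) (auto simp: cat_def)
  moreover have "(\<lambda>i\<in>{..<d}. cat d x y (d + i)) = y" by (rule coords_eqI[OF _ xy(2)]) (auto simp: cat_def)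
  ultimately show ?thesis by (simp add: joint_def)
qed

lemma sum_cat:
  fixes f :: "nat \<Rightarrow> real"
  shows "(\<Sum>i<2*d. f i) = (\<Sum>l<d. f l) + (\<Sum>l<d. f (d + l))"
proof -
  have "(\<Sum>i<2*d. f i) = (\<Sum>i\<in>{..<d} \<union> {d..<2*d}. f i)" by (intro sum.cong) auto
  also have "\<dots> = (\<Sum>l<d. f l) + (\<Sum>i\<in>{d..<2*d}. f i)" by (intro sum.union_disjoint) auto
  also have "(\<Sum>i\<in>{d..<2*d}. f i) = (\<Sum>l<d. f (d + l))"
    by (rule sum.reindex_bij_witness[where i="\<lambda>l. d + l" and j="\<lambda>i. i - d"]) auto
  finally show ?thesis .
qed

lemma upd_in_Rd: "x \<in> Rd d \<Longrightarrow> l < d \<Longrightarrow> x(l := t) \<in> Rd d"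
  by (auto simp: PiE_iff extensional_def)

locale smooth_kernel =
  fixes d :: nat and k :: "vec \<Rightarrow> vec \<Rightarrow> real"
  assumes sym: "\<And>x y. x \<in> Rd d \<Longrightarrow> y \<in> Rd d \<Longrightarrow> k x y = k y x"
    and smooth: "twice_differentiable_Rd (2*d) (joint d k)"
begin

definition "k1 l x y = partial l (\<lambda>u. k u y) x"
definition "k2 l x y = partial l (k x) y"
definition "k21 l' l x y = partial l' (\<lambda>u. k2 l u y) x"
definition "k22 l' l x y = partial l' (k2 l x) y"

text \<open>The contribution of coordinate \<open>l\<close> to the Stein kernel, whose mean over
  pairs is the squared discrepancy.\<close>

abbreviation "stein V x y l \<equiv> partial l V x * k x y * partial l V y - partial l V x * k2 l x y
  - k1 l x y * partial l V y + k21 l l x y"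

lemma partial_cat1:
  assumes "x \<in> Rd d" "y \<in> Rd d" "l < d"
    and "\<And>x y. x \<in> Rd d \<Longrightarrow> y \<in> Rd d \<Longrightarrow> f (cat d x y) = F x y"
  shows "partial l f (cat d x y) = partial l (\<lambda>u. F u y) x"
proof -
  have "f ((cat d x y)(l := t)) = F (x(l := t)) y" for t
    unfolding cat_upd1[OF assms(3)] by (intro assms(4) upd_in_Rd assms(1-3))
  moreover have "cat d x y l = x l" using assms(3) by (simp add: cat_def)
  ultimately show ?thesis by (simp add: partial_def)
qed

lemma partial_cat2:
  assumes "x \<in> Rd d" "y \<in> Rd d" "l < d"
    and "\<And>x y. x \<in> Rd d \<Longrightarrow> y \<in> Rd d \<Longrightarrow> f (cat d x y) = F x y"
  shows "partial (d + l) f (cat d x y) = partial l (F x) y"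
proof -
  have "f ((cat d x y)(d + l := t)) = F x (y(l := t))" for t
    unfolding cat_upd2[OF assms(3)] by (intro assms(4) upd_in_Rd assms(1-3))
  moreover have "cat d x y (d + l) = y l" using assms(3) by (simp add: cat_def)
  ultimately show ?thesis by (simp add: partial_def)
qed

lemma k1_cat: "x \<in> Rd d \<Longrightarrow> y \<in> Rd d \<Longrightarrow> l < d \<Longrightarrow> partial l (joint d k) (cat d x y) = k1 l x y"
  unfolding k1_def by (rule partial_cat1) (auto simp: joint_cat)

lemma k2_cat: "x \<in> Rd d \<Longrightarrow> y \<in> Rd d \<Longrightarrow> l < d \<Longrightarrow> partial (d + l) (joint d k) (cat d x y) = k2 l x y"
  unfolding k2_def by (rule partial_cat2) (auto simp: joint_cat)

lemma k21_cat:
  "x \<in> Rd d \<Longrightarrow> y \<in> Rd d \<Longrightarrow> l < d \<Longrightarrow> l' < d \<Longrightarrow>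
    partial l' (partial (d + l) (joint d k)) (cat d x y) = k21 l' l x y"
  unfolding k21_def by (rule partial_cat1) (auto simp: k2_cat)

lemma k22_cat:
  "x \<in> Rd d \<Longrightarrow> y \<in> Rd d \<Longrightarrow> l < d \<Longrightarrow> l' < d \<Longrightarrow>
    partial (d + l') (partial (d + l) (joint d k)) (cat d x y) = k22 l' l x y"
  unfolding k22_def by (rule partial_cat2) (auto simp: k2_cat)

lemma joint_grad: "z \<in> Rd (2*d) \<Longrightarrow> has_grad {..<2*d} (joint d k) (\<lambda>i. partial i (joint d k) z) z"
  using smooth by (intro has_grad_partial) (simp_all add: twice_differentiable_Rd_def)

lemma joint2_grad: "z \<in> Rd (2*d) \<Longrightarrow> l < d \<Longrightarrow>
    has_grad {..<2*d} (partial (d + l) (joint d k)) (\<lambda>i. partial i (partial (d + l) (joint d k)) z) z"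
  using smooth by (intro has_grad_partial) (simp_all add: twice_differentiable_Rd_def)

lemma DERIV_cat1:
  assumes "x \<in> Rd d" "y \<in> Rd d" "l < d" "has_grad {..<2*d} f g (cat d x y)"
    and "\<And>x y. x \<in> Rd d \<Longrightarrow> y \<in> Rd d \<Longrightarrow> f (cat d x y) = F x y"
  shows "((\<lambda>t. F (x(l := t)) y) has_real_derivative g l) (at (x l))"
proof -
  have "f ((cat d x y)(l := t)) = F (x(l := t)) y" for t
    unfolding cat_upd1[OF assms(3)] by (intro assms(5) upd_in_Rd assms(1-3))
  moreover have "cat d x y l = x l" using assms(3) by (simp add: cat_def)
  ultimately show ?thesis using has_grad_coord[OF _ cat_in assms(4), of l] assms(3) by simp
qed

lemma DERIV_cat2:
  assumes "x \<in> Rd d" "y \<in> Rd d" "l < d" "has_grad {..<2*d} f g (cat d x y)"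
    and "\<And>x y. x \<in> Rd d \<Longrightarrow> y \<in> Rd d \<Longrightarrow> f (cat d x y) = F x y"
  shows "((\<lambda>t. F x (y(l := t))) has_real_derivative g (d + l)) (at (y l))"
proof -
  have "f ((cat d x y)(d + l := t)) = F x (y(l := t))" for t
    unfolding cat_upd2[OF assms(3)] by (intro assms(5) upd_in_Rd assms(1-3))
  moreover have "cat d x y (d + l) = y l" using assms(3) by (simp add: cat_def)
  ultimately show ?thesis using has_grad_coord[OF _ cat_in assms(4), of "d + l"] assms(3) by simp
qed

lemma DERIV_k1: "x \<in> Rd d \<Longrightarrow> y \<in> Rd d \<Longrightarrow> l < d \<Longrightarrow>
    ((\<lambda>t. k (x(l := t)) y) has_real_derivative k1 l x y) (at (x l))"
  using DERIV_cat1[OF _ _ _ joint_grad[OF cat_in], of x y l k] by (simp add: joint_cat k1_cat)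

lemma DERIV_k2: "x \<in> Rd d \<Longrightarrow> y \<in> Rd d \<Longrightarrow> l < d \<Longrightarrow>
    ((\<lambda>t. k x (y(l := t))) has_real_derivative k2 l x y) (at (y l))"
  using DERIV_cat2[OF _ _ _ joint_grad[OF cat_in], of x y l k] by (simp add: joint_cat k2_cat)

lemma DERIV_k21: "x \<in> Rd d \<Longrightarrow> y \<in> Rd d \<Longrightarrow> l < d \<Longrightarrow> l' < d \<Longrightarrow>
    ((\<lambda>t. k2 l (x(l' := t)) y) has_real_derivative k21 l' l x y) (at (x l'))"
  using DERIV_cat1[OF _ _ _ joint2_grad[OF cat_in], of x y l' l "k2 l"] by (simp add: k2_cat k21_cat)

text \<open>In the RKHS this is the inner product of the difference quotients, with increments
  \<open>h\<close> and \<open>h'\<close>, of the kernel section at \<open>x\<close>. Its convergence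
  is the Cauchy criterion for those quotients.\<close>

abbreviation "mixed x l h h' \<equiv> (k (x(l := x l + h)) (x(l := x l + h')) - k (x(l := x l + h)) x
  - k x (x(l := x l + h')) + k x x) / (h * h')"

text \<open>The mean value theorem in the second argument replaces the second difference by h' times
  an increment of \<open>k2 l\<close>, and total differentiability of \<open>k2 l\<close> at the
  diagonal point expands that increment. The assumption |h'| \<le> |h| makes the error small
  relative to \<open>h\<close>, so division by h h' is harmless.\<close>

lemma mixed_quotient_mvt:
  assumes x: "x \<in> Rd d" and l: "l < d" and e: "\<epsilon> > 0"
  obtains \<delta> where "\<delta> > 0" "\<And>h h'. 0 < \<bar>h'\<bar> \<Longrightarrow> \<bar>h'\<bar> \<le> \<bar>h\<bar> \<Longrightarrow> \<bar>h\<bar> < \<delta> \<Longrightarrow>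
    \<bar>mixed x l h h'
      - k21 l l x x\<bar> \<le> \<epsilon>"
proof -
  let ?f = "partial (d + l) (joint d k)" and ?z = "cat d x x"
  let ?c = "k21 l l x x" and ?c' = "k22 l l x x"
  \<comment> \<open>Two expansions are subtracted, with joint error |h| + 2 |\<sigma>| \<le> 3 |h|
    times this number.\<close>
  have e3: "\<epsilon>/3 > 0" using e by simp
  obtain \<delta> where \<delta>: "\<delta> > 0" and g: "\<And>y. y \<in> Rd (2*d) \<Longrightarrow> L2_set (\<lambda>i. y i - ?z i) {..<2*d} < \<delta> \<Longrightarrow>
    \<bar>?f y - ?f ?z - (\<Sum>i<2*d. partial i ?f ?z * (y i - ?z i))\<bar> \<le> \<epsilon>/3 * L2_set (\<lambda>i. y i - ?z i) {..<2*d}"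
    using joint2_grad[OF cat_in l, of x x, unfolded has_grad_def, rule_format, OF e3] by blast
  have f: "\<bar>k2 l (x(l := x l + a)) (x(l := x l + b)) - k2 l x x - (?c * a + ?c' * b)\<bar> \<le> \<epsilon>/3 * (\<bar>a\<bar> + \<bar>b\<bar>)"
    if "\<bar>a\<bar> + \<bar>b\<bar> < \<delta>" for a b
  proof -
    let ?y = "cat d (x(l := x l + a)) (x(l := x l + b))"
    have u: "x(l := x l + s) \<in> Rd d" for s by (rule upd_in_Rd[OF x l])
    have diff1: "?y i - ?z i = (if i = l then a else 0)" if "i < d" for i using that by (simp add: cat_def)
    have diff2: "?y (d + i) - ?z (d + i) = (if i = l then b else 0)" if "i < d" for i using that by (simp add: cat_def)
    have sums: "(\<Sum>i<2*d. G i (?y i - ?z i)) = (\<Sum>i<d. G i (if i = l then a else 0)) + (\<Sum>i<d. G (d+i) (if i = l then b else 0))" for G :: "nat \<Rightarrow> real \<Rightarrow> real"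
      unfolding sum_cat by (intro arg_cong2[where f="(+)"] sum.cong refl) (simp_all add: diff1 diff2)
    have "(\<Sum>i<2*d. \<bar>?y i - ?z i\<bar>) = \<bar>a\<bar> + \<bar>b\<bar>"
      using l by (subst sums) (simp add: if_distrib[of abs] sum.delta cong: if_cong)
    then have n: "L2_set (\<lambda>i. ?y i - ?z i) {..<2*d} \<le> \<bar>a\<bar> + \<bar>b\<bar>"
      using L2_set_le_sum_abs[of "\<lambda>i. ?y i - ?z i" "{..<2*d}"] by simp
    have s: "(\<Sum>i<2*d. partial i ?f ?z * (?y i - ?z i)) = ?c * a + ?c' * b"
      using l by (subst sums) (simp add: if_distrib[of "(*) _"] sum.delta k21_cat[OF x x l l] k22_cat[OF x x l l] cong: if_cong)
    have "\<bar>?f ?y - ?f ?z - (?c * a + ?c' * b)\<bar> \<le> \<epsilon>/3 * L2_set (\<lambda>i. ?y i - ?z i) {..<2*d}"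
      using g[OF cat_in, of "x(l := x l + a)" "x(l := x l + b)"] n that unfolding s by linarith
    also have "\<dots> \<le> \<epsilon>/3 * (\<bar>a\<bar> + \<bar>b\<bar>)" using n e3 by (intro mult_left_mono) auto
    finally show ?thesis by (simp add: k2_cat[OF u u l] k2_cat[OF x x l])
  qed
  show ?thesis
  proof (rule that[of "\<delta>/2"])
    fix h h' :: real assume h: "0 < \<bar>h'\<bar>" "\<bar>h'\<bar> \<le> \<bar>h\<bar>" "\<bar>h\<bar> < \<delta>/2"
    let ?p = "\<lambda>s. k (x(l := x l + h)) (x(l := x l + s)) - k x (x(l := x l + s))"
    have der: "(?p has_real_derivative k2 l (x(l := x l + h)) (x(l := x l + s)) - k2 l x (x(l := x l + s))) (at s)" for s
    proof -
      have u: "x(l := x l + s) \<in> Rd d" for s by (rule upd_in_Rd[OF x l])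
      have *: "((\<lambda>s. k w (x(l := x l + s))) has_real_derivative k2 l w (x(l := x l + s))) (at s)" if w: "w \<in> Rd d" for w
      proof -
        have "((\<lambda>t. k w (x(l := t))) has_real_derivative k2 l w (x(l := x l + s))) (at (x l + s))"
          using DERIV_k2[OF w u l, of s] by simp
        moreover have "((\<lambda>s. x l + s) has_real_derivative 1) (at s)" by (auto intro!: derivative_eq_intros)
        ultimately show ?thesis using DERIV_chain2[of "\<lambda>t. k w (x(l := t))" _ "\<lambda>s. x l + s" s 1 UNIV] by simp
      qed
      show ?thesis by (rule DERIV_diff[OF *[OF u] *[OF x]])
    qed
    define q where "q s = k2 l (x(l := x l + h)) (x(l := x l + s)) - k2 l x (x(l := x l + s))" for s
    have der': "(?p has_real_derivative q s) (at s)" for s unfolding q_def by (rule der)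
    have "\<exists>\<sigma>. \<bar>\<sigma>\<bar> \<le> \<bar>h'\<bar> \<and> ?p h' - ?p 0 = h' * q \<sigma>"
    proof (cases "h' > 0")
      case True
      from MVT2[OF this der'] obtain z where "0 < z" "z < h'" "?p h' - ?p 0 = (h' - 0) * q z" by blast
      then show ?thesis by (intro exI[of _ z]) simp
    next
      case False
      then have "h' < 0" using h by simp
      from MVT2[OF this der'] obtain z where "h' < z" "z < 0" "?p 0 - ?p h' = (0 - h') * q z" by blast
      then show ?thesis by (intro exI[of _ z]) simp
    qed
    then obtain \<sigma> where \<sigma>: "\<bar>\<sigma>\<bar> \<le> \<bar>h'\<bar>" and "?p h' - ?p 0 = h' * q \<sigma>" by blast
    then have p\<sigma>: "?p h' - ?p 0 = h' * (k2 l (x(l := x l + h)) (x(l := x l + \<sigma>)) - k2 l x (x(l := x l + \<sigma>)))"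
      by (simp only: q_def)
    \<comment> \<open>In the difference of the two expansions the terms with \<open>?c'\<close>
      cancel, leaving \<open>?c\<close> times \<open>h\<close>.\<close>
    have "\<bar>k2 l (x(l := x l + h)) (x(l := x l + \<sigma>)) - k2 l x x - (?c * h + ?c' * \<sigma>)\<bar> \<le> \<epsilon>/3 * (\<bar>h\<bar> + \<bar>\<sigma>\<bar>)"
      using \<sigma> h by (intro f) auto
    moreover have "\<bar>k2 l (x(l := x l + 0)) (x(l := x l + \<sigma>)) - k2 l x x - (?c * 0 + ?c' * \<sigma>)\<bar> \<le> \<epsilon>/3 * (\<bar>0\<bar> + \<bar>\<sigma>\<bar>)"
      using \<sigma> h by (intro f) auto
    moreover have "\<epsilon>/3 * (\<bar>h\<bar> + \<bar>\<sigma>\<bar>) + \<epsilon>/3 * (\<bar>0\<bar> + \<bar>\<sigma>\<bar>) \<le> \<epsilon> * \<bar>h\<bar>"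
    proof -
      have "\<epsilon>/3 * (\<bar>h\<bar> + \<bar>\<sigma>\<bar>) + \<epsilon>/3 * (\<bar>0\<bar> + \<bar>\<sigma>\<bar>) = \<epsilon>/3 * (\<bar>h\<bar> + 2 * \<bar>\<sigma>\<bar>)"
        unfolding distrib_left[symmetric] by simp
      also have "\<dots> \<le> \<epsilon>/3 * (3 * \<bar>h\<bar>)" using \<sigma> h e3 by (intro mult_left_mono) auto
      finally show ?thesis by simp
    qed
    ultimately have r: "\<bar>k2 l (x(l := x l + h)) (x(l := x l + \<sigma>)) - k2 l x (x(l := x l + \<sigma>)) - ?c * h\<bar> \<le> \<epsilon> * \<bar>h\<bar>"
      unfolding add_0_right fun_upd_triv mult_zero_right abs_zero add_0_left by linarith
    have "(?p h' - ?p 0) / (h * h') - ?c = (k2 l (x(l := x l + h)) (x(l := x l + \<sigma>)) - k2 l x (x(l := x l + \<sigma>)) - ?c * h) / h"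
      unfolding p\<sigma> using h by (simp add: field_simps)
    then have "\<bar>(?p h' - ?p 0) / (h * h') - ?c\<bar> \<le> \<epsilon>"
      using r h by (simp only: abs_divide) (simp add: pos_divide_le_eq)
    then show "\<bar>mixed x l h h' - ?c\<bar> \<le> \<epsilon>"
      by (simp add: algebra_simps)
  qed (use \<delta> in simp)
qed

text \<open>With only pointwise second derivatives the mean value theorem has to be applied in the
  variable with the smaller increment; symmetry of the kernel makes this no restriction.\<close>

lemma mixed_quotient:
  assumes x: "x \<in> Rd d" and l: "l < d" and e: "\<epsilon> > 0"
  obtains \<delta> where "\<delta> > 0" "\<And>h h'. h \<noteq> 0 \<Longrightarrow> h' \<noteq> 0 \<Longrightarrow> \<bar>h\<bar> < \<delta> \<Longrightarrow> \<bar>h'\<bar> < \<delta> \<Longrightarrow>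
    \<bar>mixed x l h h'
      - k21 l l x x\<bar> \<le> \<epsilon>"
proof -
  obtain \<delta> where \<delta>: "\<delta> > 0" and q: "\<And>h h'. 0 < \<bar>h'\<bar> \<Longrightarrow> \<bar>h'\<bar> \<le> \<bar>h\<bar> \<Longrightarrow> \<bar>h\<bar> < \<delta> \<Longrightarrow>
    \<bar>mixed x l h h'
      - k21 l l x x\<bar> \<le> \<epsilon>"
    by (rule mixed_quotient_mvt[OF assms]) (rule that)
  show ?thesis
  proof (rule that[OF \<delta>])
    fix h h' :: real assume h: "h \<noteq> 0" "h' \<noteq> 0" "\<bar>h\<bar> < \<delta>" "\<bar>h'\<bar> < \<delta>"
    have u: "x(l := x l + s) \<in> Rd d" for s by (rule upd_in_Rd[OF x l])
    have swap: "k (x(l := x l + h)) (x(l := x l + h')) - k (x(l := x l + h)) x - k x (x(l := x l + h')) + k x x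
      = k (x(l := x l + h')) (x(l := x l + h)) - k (x(l := x l + h')) x - k x (x(l := x l + h)) + k x x"
      using sym[OF u u] sym[OF x u] by simp
    show "\<bar>mixed x l h h'
      - k21 l l x x\<bar> \<le> \<epsilon>"
    proof (cases "\<bar>h'\<bar> \<le> \<bar>h\<bar>")
      case True
      then show ?thesis using q[of h' h] h by simp
    next
      case False
      then show ?thesis using q[of h h'] h unfolding swap mult.commute[of h h'] by simp
    qed
  qed
qed

end

section \<open>Derivative evaluation and the Stein functional in the RKHS\<close>

locale kernel_rkhs = smooth_kernel d k + rkhs d k H ip for d k H ip
begin

abbreviation "sect x \<equiv> restrict (k x) (Rd d)"

lemma ip_lin_comb_right: "f \<in> H \<Longrightarrow> g \<in> H \<Longrightarrow> h \<in> H \<Longrightarrow> ip h (lin_comb d a f b g) = a * ip h f + b * ip h g"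
  using ip_lin_comb[of f g h a b] ip_sym H_lin_comb by metis

lemma ip_diff_sq:
  assumes "f \<in> H" "g \<in> H"
  shows "ip (lin_comb d 1 f (-1) g) (lin_comb d 1 f (-1) g) = ip f f - 2 * ip f g + ip g g"
  using assms by (simp add: ip_lin_comb ip_lin_comb_right H_lin_comb ip_sym[of g f])

lemma cauchy_schwarz:
  assumes f: "f \<in> H" and g: "g \<in> H"
  shows "\<bar>ip f g\<bar> \<le> sqrt (ip f f) * sqrt (ip g g)"
proof -
  have q: "0 \<le> ip f f + 2 * t * ip f g + t\<^sup>2 * ip g g" for t
    using ip_nonneg[OF H_lin_comb[OF f g, of 1 t]] f g
    by (simp add: ip_lin_comb ip_lin_comb_right H_lin_comb ip_sym[of g f] power2_eq_square algebra_simps)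
  have "(ip f g)\<^sup>2 \<le> ip f f * ip g g"
  proof (cases "ip g g = 0")
    case True
    have "ip f g = 0"
    proof (rule ccontr)
      assume nz: "ip f g \<noteq> 0"
      \<comment> \<open>If \<open>ip g g = 0\<close>, the nonnegative quadratic \<open>q\<close> is
        affine in \<open>t\<close>; this choice of \<open>t\<close> would give it the value
        -1.\<close>
      have "2 * (- (ip f f + 1) / (2 * ip f g)) * ip f g = - (ip f f + 1)" using nz by simp
      then show False using q[of "- (ip f f + 1) / (2 * ip f g)"] True by simp
    qed
    then show ?thesis using True by simp
  next
    case False
    then have pos: "ip g g > 0" using ip_nonneg[OF g] by simp
    have "ip f f + 2 * (- ip f g / ip g g) * ip f g + (- ip f g / ip g g)\<^sup>2 * ip g g = ip f f - (ip f g)\<^sup>2 / ip g g"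
      using pos by (simp add: power2_eq_square field_simps)
    then have "(ip f g)\<^sup>2 / ip g g \<le> ip f f" using q[of "- ip f g / ip g g"] by simp
    then show ?thesis using pos by (simp add: pos_divide_le_eq)
  qed
  then have "sqrt ((ip f g)\<^sup>2) \<le> sqrt (ip f f * ip g g)" by (rule real_sqrt_le_mono)
  then show ?thesis by (simp add: real_sqrt_mult)
qed

text \<open>The right side minus the left is the squared norm of f - 2g + h.\<close>

lemma ip_diff_triangle:
  assumes "f \<in> H" "g \<in> H" "h \<in> H"
  shows "ip f f - 2 * ip f h + ip h h \<le> 2 * (ip f f - 2 * ip f g + ip g g) + 2 * (ip g g - 2 * ip g h + ip h h)"
proof -
  let ?u = "lin_comb d 1 (lin_comb d 1 f (-2) g) 1 h"
  have "0 \<le> ip ?u ?u" by (intro ip_nonneg H_lin_comb assms)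
  also have "ip ?u ?u = ip f f + 4 * ip g g + ip h h - 4 * ip f g + 2 * ip f h - 4 * ip g h"
    using assms by (simp add: ip_lin_comb ip_lin_comb_right H_lin_comb ip_sym[of g f] ip_sym[of h f] ip_sym[of h g])
  finally show ?thesis by simp
qed

lemma ip_sect: "\<phi> \<in> H \<Longrightarrow> x \<in> Rd d \<Longrightarrow> ip \<phi> (sect x) = \<phi> x"
  by (rule reproducing)

text \<open>The difference quotients \<open>D h\<close> of the section at \<open>x\<close> are
  Cauchy as h tends to 0, and their limit represents the partial derivative. In particular every
  element of the RKHS has partial derivatives.\<close>

lemma derivative_representer:
  assumes x: "x \<in> Rd d" and l: "l < d"
  obtains g where "g \<in> H" "\<And>\<phi>. \<phi> \<in> H \<Longrightarrow> ((\<lambda>t. \<phi> (x(l := t))) has_real_derivative ip \<phi> g) (at (x l))"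
proof -
  let ?x = "\<lambda>h. x(l := x l + h)"
  have u: "?x h \<in> Rd d" for h by (rule upd_in_Rd[OF x l])
  have sH: "sect (?x h) \<in> H" "sect x \<in> H" for h using sections_mem u x by auto
  define D where "D h = lin_comb d (1/h) (sect (?x h)) (-1/h) (sect x)" for h
  have DH: "D h \<in> H" for h unfolding D_def by (intro H_lin_comb sH)
  have ipD: "ip \<phi> (D h) = (\<phi> (?x h) - \<phi> x) / h" if "\<phi> \<in> H" for \<phi> h
    using that sH by (simp add: D_def ip_lin_comb_right ip_sect u x diff_divide_distrib)
  have DD: "ip (D h) (D h') = (k (?x h) (?x h') - k (?x h) x - k x (?x h') + k x x) / (h * h')" for h h'
  proof -
    have "D h (?x h') = (k (?x h) (?x h') - k x (?x h')) / h" "D h x = (k (?x h) x - k x x) / h"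
      using u x by (simp_all add: D_def lin_comb_def diff_divide_distrib)
    then show ?thesis using DH by (simp add: ipD diff_divide_distrib add_divide_distrib)
  qed
  \<comment> \<open>All three inner products are within \<epsilon>/4 of the same number, which
    cancels with weights 1, -2, 1.\<close>
  have cau: "\<exists>\<delta>>0. \<forall>h h'. h \<noteq> 0 \<longrightarrow> h' \<noteq> 0 \<longrightarrow> \<bar>h\<bar> < \<delta> \<longrightarrow> \<bar>h'\<bar> < \<delta> \<longrightarrow> ip (D h) (D h) - 2 * ip (D h) (D h') + ip (D h') (D h') \<le> \<epsilon>"
    if "\<epsilon> > 0" for \<epsilon>
  proof -
    have "\<epsilon>/4 > 0" using that by simp
    then obtain \<delta> where \<delta>: "\<delta> > 0" "\<And>h h'. h \<noteq> 0 \<Longrightarrow> h' \<noteq> 0 \<Longrightarrow> \<bar>h\<bar> < \<delta> \<Longrightarrow> \<bar>h'\<bar> < \<delta> \<Longrightarrow> \<bar>ip (D h) (D h') - k21 l l x x\<bar> \<le> \<epsilon>/4"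
      unfolding DD using mixed_quotient[OF x l] by metis
    show ?thesis
    proof (intro exI[of _ \<delta>] conjI allI impI)
      fix h h' :: real assume h: "h \<noteq> 0" "h' \<noteq> 0" "\<bar>h\<bar> < \<delta>" "\<bar>h'\<bar> < \<delta>"
      show "ip (D h) (D h) - 2 * ip (D h) (D h') + ip (D h') (D h') \<le> \<epsilon>"
        using \<delta>(2)[of h h] \<delta>(2)[of h h'] \<delta>(2)[of h' h'] h by linarith
    qed (rule \<delta>)
  qed
  define F where "F n = D (1 / real (Suc n))" for n
  have FH: "F n \<in> H" for n by (simp add: F_def DH)
  have Flim: "(\<lambda>n. 1 / real (Suc n)) \<longlonglongrightarrow> 0" using lim_inverse_n'[THEN LIMSEQ_Suc] by simp
  have "\<exists>g\<in>H. (\<lambda>n. sqrt (ip (lin_comb d 1 (F n) (-1) g) (lin_comb d 1 (F n) (-1) g))) \<longlonglongrightarrow> 0"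
  proof (rule complete[OF FH])
    fix \<epsilon> :: real assume e: "\<epsilon> > 0"
    then have "\<epsilon>\<^sup>2/2 > 0" by simp
    from cau[OF this] obtain \<delta> where \<delta>: "\<delta> > 0" and c: "\<And>h h'. h \<noteq> 0 \<Longrightarrow> h' \<noteq> 0 \<Longrightarrow> \<bar>h\<bar> < \<delta> \<Longrightarrow> \<bar>h'\<bar> < \<delta> \<Longrightarrow>
        ip (D h) (D h) - 2 * ip (D h) (D h') + ip (D h') (D h') \<le> \<epsilon>\<^sup>2/2" by blast
    from LIMSEQ_D[OF Flim \<delta>] obtain m0 where m0: "\<And>n. n \<ge> m0 \<Longrightarrow> \<bar>1 / real (Suc n)\<bar> < \<delta>" by auto
    show "\<exists>M. \<forall>m\<ge>M. \<forall>n\<ge>M. sqrt (ip (lin_comb d 1 (F m) (-1) (F n)) (lin_comb d 1 (F m) (-1) (F n))) < \<epsilon>"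
    proof (intro exI[of _ m0] allI impI)
      fix m n assume "m \<ge> m0" "n \<ge> m0"
      then have "ip (lin_comb d 1 (F m) (-1) (F n)) (lin_comb d 1 (F m) (-1) (F n)) \<le> \<epsilon>\<^sup>2/2"
        unfolding ip_diff_sq[OF FH FH] unfolding F_def by (intro c m0) auto
      then have "ip (lin_comb d 1 (F m) (-1) (F n)) (lin_comb d 1 (F m) (-1) (F n)) < \<epsilon>\<^sup>2" using e zero_less_power2[of \<epsilon>] by linarith
      then show "sqrt (ip (lin_comb d 1 (F m) (-1) (F n)) (lin_comb d 1 (F m) (-1) (F n))) < \<epsilon>"
        using e real_sqrt_less_mono[of _ "\<epsilon>\<^sup>2"] by fastforce
    qed
  qed
  then obtain g where g: "g \<in> H" "(\<lambda>n. sqrt (ip (lin_comb d 1 (F n) (-1) g) (lin_comb d 1 (F n) (-1) g))) \<longlonglongrightarrow> 0" by blast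
  \<comment> \<open>Completeness is stated for sequences and yields the limit along increments
    1/(n+1). The Cauchy property extends the convergence to all small increments.\<close>
  have dist: "\<exists>\<delta>>0. \<forall>h. h \<noteq> 0 \<longrightarrow> \<bar>h\<bar> < \<delta> \<longrightarrow> ip (D h) (D h) - 2 * ip (D h) g + ip g g \<le> \<epsilon>" if e: "\<epsilon> > 0" for \<epsilon>
  proof -
    have "\<epsilon>/4 > 0" using e by simp
    from cau[OF this] obtain \<delta> where \<delta>: "\<delta> > 0" and c: "\<And>h h'. h \<noteq> 0 \<Longrightarrow> h' \<noteq> 0 \<Longrightarrow> \<bar>h\<bar> < \<delta> \<Longrightarrow> \<bar>h'\<bar> < \<delta> \<Longrightarrow>
        ip (D h) (D h) - 2 * ip (D h) (D h') + ip (D h') (D h') \<le> \<epsilon>/4" by blast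
    from LIMSEQ_D[OF Flim \<delta>] obtain m0 where m0: "\<And>n. n \<ge> m0 \<Longrightarrow> \<bar>1 / real (Suc n)\<bar> < \<delta>" by auto
    have "sqrt (\<epsilon>/4) > 0" using e by simp
    from LIMSEQ_D[OF g(2) this] obtain m1 where m1: "\<And>n. n \<ge> m1 \<Longrightarrow> sqrt (ip (lin_comb d 1 (F n) (-1) g) (lin_comb d 1 (F n) (-1) g)) < sqrt (\<epsilon>/4)"
      by (auto simp: abs_less_iff)
    define n where "n = max m0 m1"
    have 1: "ip (F n) (F n) - 2 * ip (F n) g + ip g g \<le> \<epsilon>/4"
      using m1[of n] unfolding ip_diff_sq[OF FH g(1)] by (simp add: n_def)
    have "ip (D h) (D h) - 2 * ip (D h) g + ip g g \<le> \<epsilon>" if "h \<noteq> 0" "\<bar>h\<bar> < \<delta>" for h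
    proof -
      have "ip (D h) (D h) - 2 * ip (D h) (F n) + ip (F n) (F n) \<le> \<epsilon>/4"
        unfolding F_def using that m0[of n] by (intro c) (auto simp: n_def)
      then have "2 * (ip (D h) (D h) - 2 * ip (D h) (F n) + ip (F n) (F n)) + 2 * (ip (F n) (F n) - 2 * ip (F n) g + ip g g)
        \<le> 2 * (\<epsilon>/4) + 2 * (\<epsilon>/4)" using 1 by (intro add_mono mult_left_mono) auto
      also have "\<dots> = \<epsilon>" by simp
      finally show ?thesis using ip_diff_triangle[OF DH[of h] FH[of n] g(1)] by (rule order_trans[rotated])
    qed
    then show ?thesis using \<delta> by blast
  qed
  show ?thesis
  proof (rule that[OF g(1)])
    fix \<phi> assume \<phi>: "\<phi> \<in> H"
    have "((\<lambda>h. ip \<phi> (D h)) \<longlongrightarrow> ip \<phi> g) (at 0)"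
    proof (rule LIM_I)
      fix \<epsilon> :: real assume e: "\<epsilon> > 0"
      define c where "c = sqrt (ip \<phi> \<phi>) + 1"
      have c: "c > 0" "sqrt (ip \<phi> \<phi>) < c" using ip_nonneg[OF \<phi>] by (auto simp: c_def intro: add_nonneg_pos)
      have "(\<epsilon> / c)\<^sup>2 > 0" using e c by simp
      from dist[OF this] obtain \<delta> where \<delta>: "\<delta> > 0" "\<And>h. h \<noteq> 0 \<Longrightarrow> \<bar>h\<bar> < \<delta> \<Longrightarrow> ip (D h) (D h) - 2 * ip (D h) g + ip g g \<le> (\<epsilon> / c)\<^sup>2" by blast
      show "\<exists>s>0. \<forall>h. h \<noteq> 0 \<and> norm (h - 0) < s \<longrightarrow> norm (ip \<phi> (D h) - ip \<phi> g) < \<epsilon>"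
      proof (intro exI[of _ \<delta>] conjI allI impI)
        fix h :: real assume h: "h \<noteq> 0 \<and> norm (h - 0) < \<delta>"
        let ?u = "lin_comb d 1 (D h) (-1) g"
        have uH: "?u \<in> H" by (intro H_lin_comb DH g)
        have "ip \<phi> (D h) - ip \<phi> g = ip \<phi> ?u" using \<phi> DH g by (simp add: ip_lin_comb_right)
        then have "\<bar>ip \<phi> (D h) - ip \<phi> g\<bar> \<le> sqrt (ip \<phi> \<phi>) * sqrt (ip ?u ?u)" using cauchy_schwarz[OF \<phi> uH] by simp
        also have "sqrt (ip ?u ?u) \<le> \<epsilon> / c"
          using \<delta>(2)[of h] h e c by (intro real_le_lsqrt) (auto simp: ip_diff_sq[OF DH g(1)])
        finally have "\<bar>ip \<phi> (D h) - ip \<phi> g\<bar> \<le> sqrt (ip \<phi> \<phi>) * (\<epsilon> / c)" using ip_nonneg[OF \<phi>] by (simp add: mult_left_mono)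
        also have "\<dots> < c * (\<epsilon> / c)" using c e by (intro mult_strict_right_mono) auto
        finally show "norm (ip \<phi> (D h) - ip \<phi> g) < \<epsilon>" using c by simp
      qed (rule \<delta>)
    qed
    then show "((\<lambda>t. \<phi> (x(l := t))) has_real_derivative ip \<phi> g) (at (x l))"
      using x unfolding ipD[OF \<phi>] DERIV_def by simp
  qed
qed

lemma sum_representer:
  fixes n :: nat
  assumes "\<And>j. j < n \<Longrightarrow> u j \<in> H"
  shows "\<exists>\<xi>\<in>H. \<forall>\<phi>\<in>H. ip \<phi> \<xi> = (\<Sum>j<n. a j * ip \<phi> (u j))"
  using assms
proof (induction n)
  case 0
  obtain f where f: "f \<in> H" using H_nonempty by blast
  then show ?case by (intro bexI[of _ "lin_comb d 0 f 0 f"]) (auto simp: ip_lin_comb_right H_lin_comb)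
next
  case (Suc n)
  then obtain \<xi> where \<xi>: "\<xi> \<in> H" "\<forall>\<phi>\<in>H. ip \<phi> \<xi> = (\<Sum>j<n. a j * ip \<phi> (u j))" by auto
  then show ?case using Suc.prems
    by (intro bexI[of _ "lin_comb d 1 \<xi> (a n) (u n)"]) (auto simp: ip_lin_comb_right H_lin_comb)
qed

text \<open>The Riesz representer of coordinate \<open>l\<close> of the Stein functional of the
  empirical measure. Its value at \<open>y\<close> is coordinate \<open>l\<close> of the SVGD
  velocity there, which ties the dynamics to the discrepancy.\<close>

lemma stein_representer:
  fixes N :: nat and X :: config
  assumes X: "\<And>j. j < N \<Longrightarrow> X j \<in> Rd d" and l: "l < d"
  obtains \<xi> where "\<xi> \<in> H"
    "\<And>\<phi>. \<phi> \<in> H \<Longrightarrow> ip \<phi> \<xi> = 1 / real N * (\<Sum>j<N. - partial l V (X j) * \<phi> (X j) + partial l \<phi> (X j))"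
    "\<And>y. y \<in> Rd d \<Longrightarrow> \<xi> y = 1 / real N * (\<Sum>j<N. - partial l V (X j) * k y (X j) + k2 l y (X j))"
proof -
  have "\<forall>j\<in>{..<N}. \<exists>g. g \<in> H \<and> (\<forall>\<phi>\<in>H. ((\<lambda>t. \<phi> ((X j)(l := t))) has_real_derivative ip \<phi> g) (at (X j l)))"
    using derivative_representer[OF X l] by (metis lessThan_iff)
  then obtain g where g: "\<And>j. j < N \<Longrightarrow> g j \<in> H"
    "\<And>j \<phi>. j < N \<Longrightarrow> \<phi> \<in> H \<Longrightarrow> ((\<lambda>t. \<phi> ((X j)(l := t))) has_real_derivative ip \<phi> (g j)) (at (X j l))"
    by (metis lessThan_iff bchoice)
  have pg: "partial l \<phi> (X j) = ip \<phi> (g j)" if "j < N" "\<phi> \<in> H" for j \<phi>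
    unfolding partial_def using g(2)[OF that] by (rule DERIV_imp_deriv)
  obtain \<xi>1 where \<xi>1: "\<xi>1 \<in> H" "\<And>\<phi>. \<phi> \<in> H \<Longrightarrow> ip \<phi> \<xi>1 = (\<Sum>j<N. - partial l V (X j) * ip \<phi> (sect (X j)))"
    using sum_representer[of N "\<lambda>j. sect (X j)" "\<lambda>j. - partial l V (X j)"] sections_mem X by auto
  obtain \<xi>2 where \<xi>2: "\<xi>2 \<in> H" "\<And>\<phi>. \<phi> \<in> H \<Longrightarrow> ip \<phi> \<xi>2 = (\<Sum>j<N. 1 * ip \<phi> (g j))"
    using sum_representer[of N g "\<lambda>_. 1"] g by auto
  define \<xi> where "\<xi> = lin_comb d (1 / real N) \<xi>1 (1 / real N) \<xi>2"
  have \<xi>H: "\<xi> \<in> H" unfolding \<xi>_def by (intro H_lin_comb \<xi>1 \<xi>2)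
  have ip: "ip \<phi> \<xi> = 1 / real N * (\<Sum>j<N. - partial l V (X j) * \<phi> (X j) + partial l \<phi> (X j))" if \<phi>: "\<phi> \<in> H" for \<phi>
  proof -
    have "ip \<phi> \<xi> = 1 / real N * ((\<Sum>j<N. - partial l V (X j) * ip \<phi> (sect (X j))) + (\<Sum>j<N. ip \<phi> (g j)))"
      unfolding \<xi>_def using \<phi> \<xi>1 \<xi>2 by (simp add: ip_lin_comb_right add_divide_distrib)
    also have "(\<Sum>j<N. - partial l V (X j) * ip \<phi> (sect (X j))) = (\<Sum>j<N. - partial l V (X j) * \<phi> (X j))"
      using \<phi> X by (intro sum.cong) (auto simp: ip_sect)
    also have "(\<Sum>j<N. ip \<phi> (g j)) = (\<Sum>j<N. partial l \<phi> (X j))" using \<phi> by (simp add: pg)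
    finally show ?thesis unfolding sum.distrib .
  qed
  have "\<xi> y = 1 / real N * (\<Sum>j<N. - partial l V (X j) * k y (X j) + k2 l y (X j))" if y: "y \<in> Rd d" for y
  proof -
    have "\<xi> y = ip (sect y) \<xi>" using ip_sect[OF \<xi>H y] ip_sym[OF \<xi>H sections_mem[OF y]] by simp
    also have "\<dots> = 1 / real N * (\<Sum>j<N. - partial l V (X j) * sect y (X j) + partial l (sect y) (X j))"
      by (rule ip[OF sections_mem[OF y]])
    also have "\<dots> = 1 / real N * (\<Sum>j<N. - partial l V (X j) * k y (X j) + k2 l y (X j))"
    proof (intro arg_cong2[where f="(*)"] refl sum.cong)
      fix j assume "j \<in> {..<N}"
      then have "X j \<in> Rd d" "\<And>t. (X j)(l := t) \<in> Rd d" using X upd_in_Rd l by auto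
      then show "- partial l V (X j) * sect y (X j) + partial l (sect y) (X j) = - partial l V (X j) * k y (X j) + k2 l y (X j)"
        by (simp add: partial_def k2_def)
    qed
    finally show ?thesis .
  qed
  then show ?thesis using that \<xi>H ip by blast
qed

lemma integral_empirical: "N > 0 \<Longrightarrow> (\<integral>x. f x \<partial>measure_pmf (empirical N X)) = 1 / real N * (\<Sum>j<N. f (X j))" for f :: "vec \<Rightarrow> real"
  unfolding empirical_def by (simp add: integral_pmf_of_set lessThan_empty_iff)

text \<open>The discrepancy is the supremum of a linear functional over a unit ball, hence the norm
  of its representer. The squared norm is the functional evaluated at the representer itself, which
  produces the double sum.\<close>

theorem ksd_empirical:
  fixes N :: nat and X :: config
  assumes N: "N > 0" and X: "\<And>j. j < N \<Longrightarrow> X j \<in> Rd d"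
  shows "(ksd d V H ip (measure_pmf (empirical N X)))\<^sup>2 = 1 / (real N)\<^sup>2 * (\<Sum>i<N. \<Sum>j<N. \<Sum>l<d.
    stein V (X i) (X j) l)"
proof -
  define R where "R l \<xi> \<longleftrightarrow> \<xi> \<in> H \<and>
    (\<forall>\<phi>\<in>H. ip \<phi> \<xi> = 1 / real N * (\<Sum>j<N. - partial l V (X j) * \<phi> (X j) + partial l \<phi> (X j))) \<and>
    (\<forall>y\<in>Rd d. \<xi> y = 1 / real N * (\<Sum>j<N. - partial l V (X j) * k y (X j) + k2 l y (X j)))" for l \<xi>
  have "\<exists>\<xi>. R l \<xi>" if l: "l < d" for l
  proof -
    obtain \<xi> where *: "\<xi> \<in> H"
      "\<And>\<phi>. \<phi> \<in> H \<Longrightarrow> ip \<phi> \<xi> = 1 / real N * (\<Sum>j<N. - partial l V (X j) * \<phi> (X j) + partial l \<phi> (X j))"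
      "\<And>y. y \<in> Rd d \<Longrightarrow> \<xi> y = 1 / real N * (\<Sum>j<N. - partial l V (X j) * k y (X j) + k2 l y (X j))"
      by (rule stein_representer[where N=N and X=X and V=V, OF X l]) (simp, rule that)
    show ?thesis unfolding R_def by (rule exI[of _ \<xi>]) (intro conjI ballI *)
  qed
  note ex = this
  define \<xi> where "\<xi> l = (SOME f. R l f)" for l
  have R: "R l (\<xi> l)" if l: "l < d" for l unfolding \<xi>_def by (rule someI_ex[OF ex[OF l]])
  have \<xi>: "\<And>l. l < d \<Longrightarrow> \<xi> l \<in> H"
    "\<And>l \<phi>. l < d \<Longrightarrow> \<phi> \<in> H \<Longrightarrow> ip \<phi> (\<xi> l) = 1 / real N * (\<Sum>j<N. - partial l V (X j) * \<phi> (X j) + partial l \<phi> (X j))"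
    "\<And>l y. l < d \<Longrightarrow> y \<in> Rd d \<Longrightarrow> \<xi> l y = 1 / real N * (\<Sum>j<N. - partial l V (X j) * k y (X j) + k2 l y (X j))"
    using R unfolding R_def by blast+
  have L: "(\<integral>x. stein_op d V \<phi> x \<partial>measure_pmf (empirical N X)) = (\<Sum>l<d. ip (\<phi> l) (\<xi> l))" if "\<forall>l<d. \<phi> l \<in> H" for \<phi>
  proof -
    have "(\<integral>x. stein_op d V \<phi> x \<partial>measure_pmf (empirical N X))
      = 1 / real N * (\<Sum>j<N. \<Sum>l<d. - partial l V (X j) * \<phi> l (X j) + partial l (\<phi> l) (X j))"
      unfolding integral_empirical[OF N] stein_op_def by (simp add: sum_subtractf)
    also have "\<dots> = (\<Sum>l<d. 1 / real N * (\<Sum>j<N. - partial l V (X j) * \<phi> l (X j) + partial l (\<phi> l) (X j)))"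
      by (subst sum.swap) (simp only: sum_distrib_left)
    also have "\<dots> = (\<Sum>l<d. ip (\<phi> l) (\<xi> l))" using that \<xi>(2) by (intro sum.cong) auto
    finally show ?thesis .
  qed
  define S where "S = L2_set (\<lambda>l. sqrt (ip (\<xi> l) (\<xi> l))) {..<d}"
  have pos: "0 \<le> ip (\<xi> l) (\<xi> l)" if "l < d" for l by (rule ip_nonneg[OF \<xi>(1)[OF that]])
  have S2: "S\<^sup>2 = (\<Sum>l<d. ip (\<xi> l) (\<xi> l))"
  proof -
    have "(\<Sum>l<d. (sqrt (ip (\<xi> l) (\<xi> l)))\<^sup>2) = (\<Sum>l<d. ip (\<xi> l) (\<xi> l))"
      using pos by (intro sum.cong) auto
    moreover have "0 \<le> (\<Sum>l<d. ip (\<xi> l) (\<xi> l))" using pos by (intro sum_nonneg) auto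
    ultimately show ?thesis unfolding S_def L2_set_def by simp
  qed
  have "ksd d V H ip (measure_pmf (empirical N X)) = S"
    unfolding ksd_def
  proof (rule cSup_eq_maximum)
    fix v assume "v \<in> (\<lambda>\<phi>. \<integral>x. stein_op d V \<phi> x \<partial>measure_pmf (empirical N X)) ` {\<phi>. (\<forall>i<d. \<phi> i \<in> H) \<and> sqrt (\<Sum>i<d. ip (\<phi> i) (\<phi> i)) \<le> 1}"
    then obtain \<phi> where \<phi>: "\<forall>i<d. \<phi> i \<in> H" "sqrt (\<Sum>i<d. ip (\<phi> i) (\<phi> i)) \<le> 1" "v = (\<Sum>l<d. ip (\<phi> l) (\<xi> l))"
      using L by auto
    have "v \<le> (\<Sum>l<d. \<bar>sqrt (ip (\<phi> l) (\<phi> l))\<bar> * \<bar>sqrt (ip (\<xi> l) (\<xi> l))\<bar>)"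
      unfolding \<phi>(3)
    proof (rule sum_mono)
      fix l assume "l \<in> {..<d}"
      then have h: "\<phi> l \<in> H" "\<xi> l \<in> H" using \<phi>(1) \<xi>(1) by auto
      show "ip (\<phi> l) (\<xi> l) \<le> \<bar>sqrt (ip (\<phi> l) (\<phi> l))\<bar> * \<bar>sqrt (ip (\<xi> l) (\<xi> l))\<bar>"
        using cauchy_schwarz[OF h] ip_nonneg h by simp
    qed
    also have "\<dots> \<le> L2_set (\<lambda>l. sqrt (ip (\<phi> l) (\<phi> l))) {..<d} * S" unfolding S_def by (rule L2_set_mult_ineq)
    also have "L2_set (\<lambda>l. sqrt (ip (\<phi> l) (\<phi> l))) {..<d} = sqrt (\<Sum>i<d. ip (\<phi> i) (\<phi> i))"
      unfolding L2_set_def using \<phi>(1) ip_nonneg by (intro arg_cong[where f=sqrt] sum.cong) auto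
    also have "\<dots> * S \<le> 1 * S" by (intro mult_right_mono \<phi>(2)) (simp add: S_def)
    finally show "v \<le> S" by simp
  next
    \<comment> \<open>The normalised representer attains the supremum; if the representer has norm
      0, the zero function does.\<close>
    define c where "c = (if S = 0 then 0 else 1 / S)"
    define \<phi> where "\<phi> l = lin_comb d c (\<xi> l) 0 (\<xi> l)" for l
    have \<phi>H: "\<forall>l<d. \<phi> l \<in> H" using \<xi>(1) by (auto simp: \<phi>_def intro!: H_lin_comb)
    have "(\<Sum>l<d. ip (\<phi> l) (\<phi> l)) = (\<Sum>l<d. c\<^sup>2 * ip (\<xi> l) (\<xi> l))"
      using \<xi>(1) by (intro sum.cong) (auto simp: \<phi>_def ip_lin_comb ip_lin_comb_right H_lin_comb power2_eq_square)
    also have "\<dots> = c\<^sup>2 * S\<^sup>2" by (simp add: S2 sum_distrib_left)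
    also have "\<dots> \<le> 1" by (simp add: c_def power_one_over)
    finally have n: "sqrt (\<Sum>l<d. ip (\<phi> l) (\<phi> l)) \<le> 1" by simp
    have "(\<integral>x. stein_op d V \<phi> x \<partial>measure_pmf (empirical N X)) = (\<Sum>l<d. c * ip (\<xi> l) (\<xi> l))"
      unfolding L[OF \<phi>H] using \<xi>(1) by (intro sum.cong) (auto simp: \<phi>_def ip_lin_comb)
    also have "\<dots> = c * S\<^sup>2" by (simp add: S2 sum_distrib_left)
    also have "\<dots> = S" by (simp add: c_def power2_eq_square)
    finally show "S \<in> (\<lambda>\<phi>. \<integral>x. stein_op d V \<phi> x \<partial>measure_pmf (empirical N X)) ` {\<phi>. (\<forall>i<d. \<phi> i \<in> H) \<and> sqrt (\<Sum>i<d. ip (\<phi> i) (\<phi> i)) \<le> 1}"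
      using \<phi>H n by (intro image_eqI[of _ _ \<phi>]) auto
  qed
  then have "(ksd d V H ip (measure_pmf (empirical N X)))\<^sup>2 = (\<Sum>l<d. ip (\<xi> l) (\<xi> l))" using S2 by simp
  also have "\<dots> = (\<Sum>l<d. 1 / real N * (\<Sum>i<N. - partial l V (X i) * \<xi> l (X i) + partial l (\<xi> l) (X i)))"
    using \<xi> by (intro sum.cong) auto
  also have "\<dots> = (\<Sum>l<d. 1 / real N * (\<Sum>i<N. 1 / real N * (\<Sum>j<N.
      stein V (X i) (X j) l)))"
  proof (intro sum.cong arg_cong2[where f="(*)"] refl)
    fix l i assume li: "l \<in> {..<d}" "i \<in> {..<N}"
    then have l: "l < d" and i: "i < N" by auto
    have "((\<lambda>t. 1 / real N * (\<Sum>j<N. - partial l V (X j) * k ((X i)(l := t)) (X j) + k2 l ((X i)(l := t)) (X j)))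
      has_real_derivative 1 / real N * (\<Sum>j<N. - partial l V (X j) * k1 l (X i) (X j) + k21 l l (X i) (X j))) (at (X i l))"
      using X l i by (intro DERIV_cmult DERIV_sum DERIV_add DERIV_k1 DERIV_k21) auto
    moreover have "\<xi> l ((X i)(l := t)) = 1 / real N * (\<Sum>j<N. - partial l V (X j) * k ((X i)(l := t)) (X j) + k2 l ((X i)(l := t)) (X j))" for t
      by (rule \<xi>(3)[OF l upd_in_Rd[OF X[OF i] l]])
    ultimately have p: "partial l (\<xi> l) (X i) = 1 / real N * (\<Sum>j<N. - partial l V (X j) * k1 l (X i) (X j) + k21 l l (X i) (X j))"
      unfolding partial_def by (simp add: DERIV_imp_deriv)
    show "- partial l V (X i) * \<xi> l (X i) + partial l (\<xi> l) (X i) = 1 / real N * (\<Sum>j<N.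
      stein V (X i) (X j) l)"
      unfolding p \<xi>(3)[OF l X[OF i]] mult.left_commute[of "- partial l V (X i)"] distrib_left[symmetric]
        sum_distrib_left[of "- partial l V (X i)"] sum.distrib[symmetric]
      by (intro arg_cong2[where f="(*)"] sum.cong refl) (simp add: algebra_simps)
  qed
  also have "\<dots> = 1 / (real N)\<^sup>2 * (\<Sum>l<d. \<Sum>i<N. \<Sum>j<N.
    stein V (X i) (X j) l)"
    unfolding sum_distrib_left[symmetric] by (simp add: power2_eq_square)
  also have "(\<Sum>l<d. \<Sum>i<N. \<Sum>j<N.
    stein V (X i) (X j) l) = (\<Sum>i<N. \<Sum>j<N. \<Sum>l<d.
    stein V (X i) (X j) l)"
    by (subst sum.swap, rule sum.cong[OF refl], rule sum.swap)
  finally show ?thesis .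
qed

end

section \<open>Potentials and cutoffs\<close>

text \<open>The selection of coordinates need not be injective: a particle paired with itself
  supplies both arguments of the kernel. Hence the sum over all \<open>a\<close> that select the
  same coordinate.\<close>

lemma has_grad_reindex:
  assumes I: "finite I" and J: "finite J" and \<sigma>: "\<And>a. a \<in> J \<Longrightarrow> \<sigma> a \<in> I"
    and f: "has_grad J f g (\<lambda>a\<in>J. x (\<sigma> a))"
  shows "has_grad I (\<lambda>y. f (\<lambda>a\<in>J. y (\<sigma> a))) (\<lambda>i. \<Sum>a\<in>J. if \<sigma> a = i then g a else 0) x"
  unfolding has_grad_def
proof (intro allI impI)
  fix \<epsilon> :: real assume e: "\<epsilon> > 0"
  \<comment> \<open>A crude bound for the norm of the selected coordinates; adding 1 keeps it
    positive when \<open>J\<close> is empty.\<close>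
  define c where "c = real (card J) + 1"
  have c: "c > 0" by (simp add: c_def)
  have "\<epsilon> / c > 0" using e c by simp
  from f[unfolded has_grad_def, rule_format, OF this] obtain \<delta> where \<delta>: "\<delta> > 0" and
    b: "\<And>z. z \<in> J \<rightarrow>\<^sub>E UNIV \<Longrightarrow> L2_set (\<lambda>a. z a - (\<lambda>a\<in>J. x (\<sigma> a)) a) J < \<delta> \<Longrightarrow>
      \<bar>f z - f (\<lambda>a\<in>J. x (\<sigma> a)) - (\<Sum>a\<in>J. g a * (z a - (\<lambda>a\<in>J. x (\<sigma> a)) a))\<bar>
        \<le> \<epsilon> / c * L2_set (\<lambda>a. z a - (\<lambda>a\<in>J. x (\<sigma> a)) a) J" by blast
  show "\<exists>\<delta>>0. \<forall>y\<in>I \<rightarrow>\<^sub>E UNIV. L2_set (\<lambda>i. y i - x i) I < \<delta> \<longrightarrow>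
    \<bar>f (\<lambda>a\<in>J. y (\<sigma> a)) - f (\<lambda>a\<in>J. x (\<sigma> a)) - (\<Sum>i\<in>I. (\<Sum>a\<in>J. if \<sigma> a = i then g a else 0) * (y i - x i))\<bar>
      \<le> \<epsilon> * L2_set (\<lambda>i. y i - x i) I"
  proof (intro exI[of _ "\<delta> / c"] conjI ballI impI)
    fix y assume y: "y \<in> I \<rightarrow>\<^sub>E (UNIV :: real set)" "L2_set (\<lambda>i. y i - x i) I < \<delta> / c"
    let ?n = "L2_set (\<lambda>i. y i - x i) I"
    let ?z = "\<lambda>a\<in>J. y (\<sigma> a)"
    have zE: "?z \<in> J \<rightarrow>\<^sub>E UNIV" by auto
    have eq: "L2_set (\<lambda>a. ?z a - (\<lambda>a\<in>J. x (\<sigma> a)) a) J = L2_set (\<lambda>a. y (\<sigma> a) - x (\<sigma> a)) J"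
      by (intro L2_set_cong) auto
    have "L2_set (\<lambda>a. y (\<sigma> a) - x (\<sigma> a)) J \<le> (\<Sum>a\<in>J. \<bar>y (\<sigma> a) - x (\<sigma> a)\<bar>)" by (rule L2_set_le_sum_abs)
    also have "\<dots> \<le> (\<Sum>a\<in>J. ?n)"
      using abs_le_L2_set[OF I, of _ "\<lambda>i. y i - x i"] \<sigma> by (intro sum_mono) auto
    also have "\<dots> \<le> c * ?n" by (simp add: c_def distrib_right)
    finally have n: "L2_set (\<lambda>a. ?z a - (\<lambda>a\<in>J. x (\<sigma> a)) a) J \<le> c * ?n" unfolding eq .
    also have "c * ?n < \<delta>" using y(2) c by (simp add: pos_less_divide_eq mult.commute)
    finally have l: "L2_set (\<lambda>a. ?z a - (\<lambda>a\<in>J. x (\<sigma> a)) a) J < \<delta>" .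
    have s: "(\<Sum>i\<in>I. (\<Sum>a\<in>J. if \<sigma> a = i then g a else 0) * (y i - x i)) = (\<Sum>a\<in>J. g a * (?z a - (\<lambda>a\<in>J. x (\<sigma> a)) a))"
    proof -
      have "(\<Sum>i\<in>I. (\<Sum>a\<in>J. if \<sigma> a = i then g a else 0) * (y i - x i)) = (\<Sum>i\<in>I. \<Sum>a\<in>J. if \<sigma> a = i then g a * (y i - x i) else 0)"
        by (simp add: sum_distrib_right if_distrib[of "\<lambda>u. u * _"] cong: if_cong)
      also have "\<dots> = (\<Sum>a\<in>J. \<Sum>i\<in>I. if \<sigma> a = i then g a * (y i - x i) else 0)" by (rule sum.swap)
      also have "\<dots> = (\<Sum>a\<in>J. g a * (?z a - (\<lambda>a\<in>J. x (\<sigma> a)) a))"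
        using I \<sigma> by (intro sum.cong) auto
      finally show ?thesis .
    qed
    have "\<bar>f ?z - f (\<lambda>a\<in>J. x (\<sigma> a)) - (\<Sum>a\<in>J. g a * (?z a - (\<lambda>a\<in>J. x (\<sigma> a)) a))\<bar>
      \<le> \<epsilon> / c * L2_set (\<lambda>a. ?z a - (\<lambda>a\<in>J. x (\<sigma> a)) a) J"
      by (rule b[OF zE l])
    also have "\<dots> \<le> \<epsilon> / c * (c * ?n)" using n e c by (intro mult_left_mono) auto
    also have "\<dots> = \<epsilon> * ?n" using c by simp
    finally show "\<bar>f ?z - f (\<lambda>a\<in>J. x (\<sigma> a)) - (\<Sum>i\<in>I. (\<Sum>a\<in>J. if \<sigma> a = i then g a else 0) * (y i - x i))\<bar> \<le> \<epsilon> * ?n"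
      unfolding s .
  qed (use \<delta> c in simp)
qed

section \<open>Configurations in flat coordinates\<close>

text \<open>The change of variables works over one index set, whereas a configuration is a function
  into functions; pairs (particle, coordinate) index the flat copy.\<close>

definition flat_index :: "nat \<Rightarrow> nat \<Rightarrow> (nat \<times> nat) set" where
  "flat_index N d = {..<N} \<times> {..<d}"

definition unflatten :: "nat \<Rightarrow> nat \<Rightarrow> (nat \<times> nat \<Rightarrow> real) \<Rightarrow> config" where
  "unflatten N d x = (\<lambda>i\<in>{..<N}. \<lambda>l\<in>{..<d}. x (i, l))"

lemma finite_flat_index [simp]: "finite (flat_index N d)"
  by (simp add: flat_index_def)

lemma sum_flat_index: "(\<Sum>p\<in>flat_index N d. f p) = (\<Sum>i<N. \<Sum>l<d. f (i, l))"
  unfolding flat_index_def by (simp add: sum.cartesian_product)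

lemma unflatten_in: "i < N \<Longrightarrow> unflatten N d x i \<in> Rd d"
  by (simp add: unflatten_def)

lemma has_grad_particle:
  assumes i: "i < N" and x: "x \<in> flat_index N d \<rightarrow>\<^sub>E UNIV" and f: "has_grad {..<d} f g (unflatten N d x i)"
  shows "has_grad (flat_index N d) (\<lambda>y. f (unflatten N d y i)) (\<lambda>(i', l'). if i' = i then g l' else 0) x"
proof (rule has_grad_cong[OF _ _ _ x])
  show "has_grad (flat_index N d) (\<lambda>y. f (\<lambda>a\<in>{..<d}. y ((\<lambda>l. (i, l)) a))) (\<lambda>p. \<Sum>a<d. if (\<lambda>l. (i, l)) a = p then g a else 0) x"
    by (rule has_grad_reindex) (use i f in \<open>auto simp: flat_index_def unflatten_def\<close>)
  show "f (\<lambda>a\<in>{..<d}. y ((\<lambda>l. (i, l)) a)) = f (unflatten N d y i)" for y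
    using i by (simp add: unflatten_def)
  show "(\<Sum>a<d. if (\<lambda>l. (i, l)) a = p then g a else 0) = (case p of (i', l') \<Rightarrow> if i' = i then g l' else 0)"
    if p: "p \<in> flat_index N d" for p
  proof -
    obtain i' l' where [simp]: "p = (i', l')" by (cases p)
    have l': "l' < d" using p by (simp add: flat_index_def)
    have "(\<Sum>a<d. if (i, a) = (i', l') then g a else 0) = (\<Sum>a<d. if a = l' then (if i' = i then g l' else 0) else 0)"
      by (intro sum.cong) auto
    then show ?thesis using l' by simp
  qed
qed

lemma has_grad_particle_pair:
  assumes i: "i < N" and j: "j < N" and x: "x \<in> flat_index N d \<rightarrow>\<^sub>E UNIV"
    and f: "has_grad {..<2*d} f g (cat d (unflatten N d x i) (unflatten N d x j))"
  shows "has_grad (flat_index N d) (\<lambda>y. f (cat d (unflatten N d y i) (unflatten N d y j)))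
    (\<lambda>(i', l'). (if i' = i then g l' else 0) + (if i' = j then g (d + l') else 0)) x"
proof (rule has_grad_cong[OF _ _ _ x])
  let ?\<sigma> = "\<lambda>a. if a < d then (i, a) else (j, a - d)"
  have eq: "cat d (unflatten N d y i) (unflatten N d y j) = (\<lambda>a\<in>{..<2*d}. y (?\<sigma> a))" for y
    using i j by (intro ext) (auto simp: cat_def unflatten_def)
  show "has_grad (flat_index N d) (\<lambda>y. f (\<lambda>a\<in>{..<2*d}. y (?\<sigma> a))) (\<lambda>p. \<Sum>a<2*d. if ?\<sigma> a = p then g a else 0) x"
    by (rule has_grad_reindex) (use i j f eq[of x] in \<open>auto simp: flat_index_def\<close>)
  show "f (\<lambda>a\<in>{..<2*d}. y (?\<sigma> a)) = f (cat d (unflatten N d y i) (unflatten N d y j))" for y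
    unfolding eq ..
  show "(\<Sum>a<2*d. if ?\<sigma> a = p then g a else 0) = (case p of (i', l') \<Rightarrow> (if i' = i then g l' else 0) + (if i' = j then g (d + l') else 0))"
    if p: "p \<in> flat_index N d" for p
  proof -
    obtain i' l' where [simp]: "p = (i', l')" by (cases p)
    have l': "l' < d" using p by (simp add: flat_index_def)
    have "(\<Sum>a<d. if ?\<sigma> a = (i', l') then g a else 0) = (\<Sum>a<d. if a = l' then (if i' = i then g l' else 0) else 0)"
      by (intro sum.cong) auto
    moreover have "(\<Sum>a<d. if ?\<sigma> (d + a) = (i', l') then g (d + a) else 0) = (\<Sum>a<d. if a = l' then (if i' = j then g (d + l') else 0) else 0)"
      by (intro sum.cong) auto
    ultimately show ?thesis using l' by (simp add: sum_cat)
  qed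
qed

section \<open>Consequences of the Hessian and growth bounds\<close>

text \<open>The Frobenius norm bounds the set whose supremum defines the operator norm, so this is a
  genuine supremum and every unit vector obeys it.\<close>

lemma op_norm_bound:
  assumes "op_norm d M \<le> C"
  shows "L2_set (\<lambda>i. \<Sum>j<d. M i j * v j) {..<d} \<le> C * L2_set v {..<d}"
proof (cases "L2_set v {..<d} = 0")
  case True
  then have "\<forall>j\<in>{..<d}. v j = 0" by (simp add: L2_set_eq_0_iff)
  then show ?thesis using True by (simp add: L2_set_def)
next
  case False
  define r where "r = L2_set v {..<d}"
  have r: "r > 0" unfolding r_def using False L2_set_nonneg order_le_less by metis
  define w where "w = (\<lambda>j\<in>{..<d}. v j / r)"
  have w: "w \<in> Rd d" by (simp add: w_def)
  have "L2_set w {..<d} = L2_set (\<lambda>j. (1/r) * v j) {..<d}" by (intro L2_set_cong) (auto simp: w_def)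
  also have "\<dots> = (1/r) * L2_set v {..<d}" by (rule L2_set_right_distrib[symmetric]) (use r in simp)
  finally have "L2_set w {..<d} = (1/r) * r" unfolding r_def[symmetric] .
  then have w1: "L2_set w {..<d} = 1" using r by simp
  have bdd: "bdd_above ((\<lambda>v. L2_set (\<lambda>i. \<Sum>j<d. M i j * v j) {..<d}) ` {v\<in>Rd d. L2_set v {..<d} \<le> 1})"
  proof (rule bdd_aboveI2)
    fix v assume "v \<in> {v \<in> Rd d. L2_set v {..<d} \<le> 1}"
    then have v: "L2_set v {..<d} \<le> 1" by blast
    have "0 \<le> sqrt (\<Sum>i<d. \<Sum>j<d. (M i j)\<^sup>2)" by (simp add: sum_nonneg)
    from mult_left_mono[OF v this] show "L2_set (\<lambda>i. \<Sum>j<d. M i j * v j) {..<d} \<le> sqrt (\<Sum>i<d. \<Sum>j<d. (M i j)\<^sup>2)"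
      using matrix_vector_frobenius[of M v "{..<d}" "{..<d}"] by linarith
  qed
  have "L2_set (\<lambda>i. \<Sum>j<d. M i j * w j) {..<d} \<le> op_norm d M"
    unfolding op_norm_def by (rule cSUP_upper[OF _ bdd]) (use w w1 in simp)
  also have "L2_set (\<lambda>i. \<Sum>j<d. M i j * w j) {..<d} = L2_set (\<lambda>i. (1/r) * (\<Sum>j<d. M i j * v j)) {..<d}"
    by (intro L2_set_cong refl) (simp add: w_def sum_distrib_left)
  also have "\<dots> = (1/r) * L2_set (\<lambda>i. \<Sum>j<d. M i j * v j) {..<d}"
    by (rule L2_set_right_distrib[symmetric]) (use r in simp)
  finally have "L2_set (\<lambda>i. \<Sum>j<d. M i j * v j) {..<d} / r \<le> C" using assms by simp
  then show ?thesis using r by (simp add: pos_divide_le_eq r_def)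
qed

text \<open>The Jacobian of the gradient is the transpose of \<open>hessian\<close>. Swapping the
  sums in its bilinear form exchanges the two test vectors, so the operator norm bound applies as
  stated.\<close>

lemma hessian_lipschitz:
  assumes V: "twice_differentiable_Rd d V" and C: "C \<ge> 0"
    and H: "\<And>z. z \<in> Rd d \<Longrightarrow> op_norm d (hessian V z) \<le> C" and xy: "x \<in> Rd d" "y \<in> Rd d"
  shows "L2_set (\<lambda>i. partial i V y - partial i V x) {..<d} \<le> C * L2_set (\<lambda>i. y i - x i) {..<d}"
proof (rule lipschitz_of_gradient_bound[where M="\<lambda>x i j. hessian V x j i"])
  show "has_grad {..<d} (partial i V) (\<lambda>j. hessian V z j i) z" if "z \<in> Rd d" "i \<in> {..<d}" for z i
    unfolding hessian_def using V that by (intro has_grad_partial) (auto simp: twice_differentiable_Rd_def)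
  fix z u v assume z: "z \<in> Rd d"
  have "(\<Sum>i<d. \<Sum>j<d. u i * hessian V z j i * v j) = (\<Sum>j<d. \<Sum>i<d. u i * hessian V z j i * v j)"
    by (rule sum.swap)
  also have "\<dots> = (\<Sum>j<d. v j * (\<Sum>i<d. hessian V z j i * u i))"
    by (simp add: sum_distrib_left mult_ac)
  also have "\<dots> \<le> L2_set v {..<d} * L2_set (\<lambda>j. \<Sum>i<d. hessian V z j i * u i) {..<d}"
    using L2_set_cauchy[of v "\<lambda>j. \<Sum>i<d. hessian V z j i * u i" "{..<d}"] by linarith
  also have "\<dots> \<le> L2_set v {..<d} * (C * L2_set u {..<d})"
    by (intro mult_left_mono op_norm_bound H z) simp
  finally show "(\<Sum>i<d. \<Sum>j<d. u i * hessian V z j i * v j) \<le> C * L2_set u {..<d} * L2_set v {..<d}"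
    by (simp add: mult_ac)
qed (use C xy in auto)

text \<open>Each of the \<open>d\<close> columns is the image of a unit vector, hence has norm at
  most \<open>C\<close>.\<close>

lemma hessian_frobenius:
  assumes "op_norm d (hessian V z) \<le> C" "C \<ge> 0"
  shows "(\<Sum>l<d. \<Sum>l'<d. (hessian V z l' l)\<^sup>2) \<le> C\<^sup>2 * real d"
proof -
  have "(\<Sum>l'<d. (hessian V z l' l)\<^sup>2) \<le> C\<^sup>2" if l: "l < d" for l
  proof -
    have "L2_set (\<lambda>i. \<Sum>j<d. hessian V z i j * (if j = l then 1 else 0)) {..<d} \<le> C * L2_set (\<lambda>j. if j = l then 1 else 0) {..<d}"
      by (rule op_norm_bound[OF assms(1)])
    moreover have "L2_set (\<lambda>j. if j = l then 1 else 0) {..<d} = 1"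
      unfolding L2_set_def using l by (simp add: if_distrib[of "\<lambda>u. u\<^sup>2"] cong: if_cong)
    moreover have "(\<Sum>j<d. hessian V z i j * (if j = l then 1 else 0)) = hessian V z i l" for i
    proof -
      have "(\<Sum>j<d. hessian V z i j * (if j = l then 1 else 0)) = (\<Sum>j<d. if j = l then hessian V z i j else 0)"
        by (intro sum.cong) auto
      then show ?thesis using l by simp
    qed
    ultimately have "sqrt (\<Sum>l'<d. (hessian V z l' l)\<^sup>2) \<le> C" by (simp add: L2_set_def)
    then have "(sqrt (\<Sum>l'<d. (hessian V z l' l)\<^sup>2))\<^sup>2 \<le> C\<^sup>2" by (intro power_mono) (auto intro!: sum_nonneg)
    then show ?thesis by (simp add: sum_nonneg)
  qed
  then have "(\<Sum>l<d. \<Sum>l'<d. (hessian V z l' l)\<^sup>2) \<le> (\<Sum>l<d. C\<^sup>2)" by (intro sum_mono) auto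
  then show ?thesis by (simp add: mult.commute)
qed

text \<open>The descent lemma. Along the segment, the difference of the two sides has nonpositive
  derivative because the gradient is Lipschitz, so a first-order mean value theorem
  suffices.\<close>

lemma quadratic_upper_bound:
  assumes V: "twice_differentiable_Rd d V" and C: "C \<ge> 0"
    and H: "\<And>z. z \<in> Rd d \<Longrightarrow> op_norm d (hessian V z) \<le> C" and xy: "x \<in> Rd d" "y \<in> Rd d"
  shows "V y \<le> V x + (\<Sum>i<d. partial i V x * (y i - x i)) + C / 2 * (\<Sum>i<d. (y i - x i)\<^sup>2)"
proof -
  define v where "v i = y i - x i" for i
  define z where "z t = (\<lambda>i\<in>{..<d}. x i + t * v i)" for t
  let ?n = "\<Sum>i<d. (v i)\<^sup>2"
  have z: "z t \<in> Rd d" for t by (simp add: z_def)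
  have z01: "z 0 = x" "z 1 = y" using xy by (auto simp: z_def v_def PiE_def extensional_def)
  define \<psi> where "\<psi> t = V (z t) - t * (\<Sum>i<d. partial i V x * v i) - C / 2 * t\<^sup>2 * ?n" for t
  define \<psi>' where "\<psi>' t = (\<Sum>i<d. partial i V (z t) * v i) - (\<Sum>i<d. partial i V x * v i) - C * t * ?n" for t
  have d: "(\<psi> has_real_derivative \<psi>' t) (at t)" for t
  proof -
    have "((\<lambda>t. V (z t)) has_real_derivative (\<Sum>i<d. partial i V (z t) * v i)) (at t)"
    proof (rule has_grad_curve[OF _ z])
      show "has_grad {..<d} V (\<lambda>i. partial i V (z t)) (z t)"
        using V z by (intro has_grad_partial) (auto simp: twice_differentiable_Rd_def)
      show "((\<lambda>t. z t i) has_real_derivative v i) (at t)" if "i \<in> {..<d}" for i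
        using that unfolding z_def by (auto intro!: derivative_eq_intros)
    qed simp
    then show ?thesis unfolding \<psi>_def \<psi>'_def by (auto intro!: derivative_eq_intros simp: field_simps)
  qed
  have neg: "\<psi>' t \<le> 0" if t: "t > 0" for t
  proof -
    have "(\<Sum>i<d. partial i V (z t) * v i) - (\<Sum>i<d. partial i V x * v i) = (\<Sum>i<d. (partial i V (z t) - partial i V x) * v i)"
      by (simp add: sum_subtractf left_diff_distrib)
    also have "\<dots> \<le> L2_set (\<lambda>i. partial i V (z t) - partial i V x) {..<d} * L2_set v {..<d}"
      using L2_set_cauchy[of "\<lambda>i. partial i V (z t) - partial i V x" v "{..<d}"] by linarith
    also have "\<dots> \<le> C * L2_set (\<lambda>i. z t i - x i) {..<d} * L2_set v {..<d}"
      by (intro mult_right_mono hessian_lipschitz V C H xy z) auto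
    also have "L2_set (\<lambda>i. z t i - x i) {..<d} = L2_set (\<lambda>i. t * v i) {..<d}"
      by (intro L2_set_cong) (auto simp: z_def)
    also have "\<dots> = t * L2_set v {..<d}" by (rule L2_set_right_distrib[symmetric]) (use t in simp)
    also have "C * (t * L2_set v {..<d}) * L2_set v {..<d} = C * t * (L2_set v {..<d})\<^sup>2" by (simp add: power2_eq_square)
    also have "(L2_set v {..<d})\<^sup>2 = ?n" by (simp add: L2_set_def sum_nonneg)
    finally show ?thesis by (simp add: \<psi>'_def)
  qed
  obtain t where t: "t > 0" "\<psi> 1 - \<psi> 0 = (1 - 0) * \<psi>' t" using MVT2[of 0 1 \<psi> \<psi>'] d by auto
  then have "\<psi> 1 - \<psi> 0 \<le> 0" using neg[OF t(1)] by (simp only: t(2)) simp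
  then have "\<psi> 1 \<le> \<psi> 0" by (simp only: diff_le_0_iff_le)
  then show ?thesis by (simp add: \<psi>_def z01 v_def)
qed

text \<open>Jensen's inequality for a concave power. Young's inequality supplies the tangent line at
  the mean \<open>W\<close>, and summing the tangent bounds gives the claim.\<close>

lemma powr_average_le:
  fixes f :: "nat \<Rightarrow> real"
  assumes N: "N > 0" and f: "\<And>i. i < N \<Longrightarrow> f i > 0" and \<beta>: "0 \<le> \<beta>" "\<beta> \<le> 1"
  shows "1 / real N * (\<Sum>i<N. f i powr \<beta>) \<le> (1 / real N * (\<Sum>i<N. f i)) powr \<beta>"
proof -
  define W where "W = 1 / real N * (\<Sum>i<N. f i)"
  have W: "W > 0" unfolding W_def using N f by (intro mult_pos_pos sum_pos) auto
  have sumf: "(\<Sum>i<N. f i) = real N * W" using N by (simp add: W_def)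
  have "f i powr \<beta> \<le> W powr \<beta> * ((1 - \<beta>) + \<beta> * (f i / W))" if i: "i < N" for i
  proof -
    have "1 powr (1 - \<beta>) * (f i / W) powr \<beta> \<le> (1 - \<beta>) * 1 + \<beta> * (f i / W)"
      using \<beta> W f[OF i] by (intro Youngs_inequality_0) auto
    then have "W powr \<beta> * (f i / W) powr \<beta> \<le> W powr \<beta> * ((1 - \<beta>) + \<beta> * (f i / W))"
      by (intro mult_left_mono) auto
    moreover have "W powr \<beta> * (f i / W) powr \<beta> = f i powr \<beta>"
      using W f[OF i] by (simp add: powr_divide)
    ultimately show ?thesis by simp
  qed
  then have "(\<Sum>i<N. f i powr \<beta>) \<le> (\<Sum>i<N. W powr \<beta> * ((1 - \<beta>) + \<beta> * (f i / W)))" by (intro sum_mono) auto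
  also have "\<dots> = W powr \<beta> * (real N * (1 - \<beta>) + \<beta> * ((\<Sum>i<N. f i) / W))"
  proof -
    have "(\<Sum>i<N. \<beta> * (f i / W)) = \<beta> * ((\<Sum>i<N. f i) / W)" by (simp only: sum_distrib_left sum_divide_distrib)
    then show ?thesis by (simp add: sum_distrib_left[symmetric] sum.distrib)
  qed
  also have "\<dots> = real N * W powr \<beta>" using W by (simp add: sumf algebra_simps)
  finally have "1 / real N * (\<Sum>i<N. f i powr \<beta>) \<le> 1 / real N * (real N * W powr \<beta>)"
    by (rule mult_left_mono) simp
  also have "\<dots> = W powr \<beta>" using N by simp
  finally show ?thesis unfolding W_def .
qed

lemma average_sq_le:
  fixes f :: "nat \<Rightarrow> real"
  assumes "N > 0"
  shows "(1 / real N * (\<Sum>j<N. f j))\<^sup>2 \<le> 1 / real N * (\<Sum>j<N. (f j)\<^sup>2)"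
proof -
  have "(\<Sum>j<N. f j * 1)\<^sup>2 \<le> (\<Sum>j<N. (f j)\<^sup>2) * (\<Sum>j<N. 1\<^sup>2)" by (rule Cauchy_Schwarz_ineq_sum)
  then have "(\<Sum>j<N. f j)\<^sup>2 \<le> (\<Sum>j<N. (f j)\<^sup>2) * real N" by simp
  then have "(\<Sum>j<N. f j)\<^sup>2 / (real N)\<^sup>2 \<le> (\<Sum>j<N. (f j)\<^sup>2) * real N / (real N)\<^sup>2" by (intro divide_right_mono) auto
  then show ?thesis using assms by (simp add: power_divide power2_eq_square)
qed

section \<open>A differentiable cutoff\<close>

definition sq_pos :: "real \<Rightarrow> real" where "sq_pos u = (max 0 u)\<^sup>2"

lemma DERIV_sq_pos: "(sq_pos has_real_derivative 2 * max 0 u) (at u)"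
proof -
  consider "u < 0" | "u > 0" | "u = 0" by linarith
  then show ?thesis
  proof cases
    case 1
    have "((\<lambda>u. 0) has_real_derivative 2 * max 0 u) (at u)" using 1 by simp
    then show ?thesis
    proof (rule has_field_derivative_transform_within_open[of _ _ _ "{..<0}"])
      show "\<And>x. x \<in> {..<0} \<Longrightarrow> 0 = sq_pos x" by (simp add: sq_pos_def max_def)
    qed (use 1 in auto)
  next
    case 2
    have "((\<lambda>u. u\<^sup>2) has_real_derivative 2 * max 0 u) (at u)" using 2 by (auto intro!: derivative_eq_intros simp: max_def)
    then show ?thesis
    proof (rule has_field_derivative_transform_within_open[of _ _ _ "{0<..}"])
      show "\<And>x. x \<in> {0<..} \<Longrightarrow> x\<^sup>2 = sq_pos x" by (simp add: sq_pos_def max_def)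
    qed (use 2 in auto)
  next
    case 3
    have "((\<lambda>h. sq_pos h / h) \<longlongrightarrow> 0) (at 0)"
    proof (rule tendsto_0_le[of "\<lambda>h. h" _ _ 1])
      show "\<forall>\<^sub>F x in at 0. norm (sq_pos x / x) \<le> norm x * 1"
        by (intro always_eventually) (auto simp: sq_pos_def max_def power2_eq_square)
    qed simp
    then show ?thesis using 3 by (simp add: has_field_derivative_iff sq_pos_def)
  qed
qed

text \<open>A continuously differentiable cutoff, equal to 1 below \<open>U\<close> and to 0 above \<open>2 * U\<close>.\<close>

definition cutoff :: "real \<Rightarrow> real \<Rightarrow> real" where
  "cutoff U w = sq_pos (1 - sq_pos ((w - U) / U))"

definition cutoff' :: "real \<Rightarrow> real \<Rightarrow> real" where
  "cutoff' U w = - (4 / U) * (max 0 (1 - sq_pos ((w - U) / U)) * max 0 ((w - U) / U))"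

lemma DERIV_cutoff: "U > 0 \<Longrightarrow> (cutoff U has_real_derivative cutoff' U w) (at w)"
proof -
  assume U: "U > 0"
  have 1: "((\<lambda>w. (w - U) / U) has_real_derivative 1 / U) (at w)" using U by (auto intro!: derivative_eq_intros)
  have 2: "((\<lambda>w. sq_pos ((w - U) / U)) has_real_derivative 2 * max 0 ((w - U) / U) * (1 / U)) (at w)"
    by (rule DERIV_chain2[OF DERIV_sq_pos 1])
  have 3: "((\<lambda>w. 1 - sq_pos ((w - U) / U)) has_real_derivative 0 - 2 * max 0 ((w - U) / U) * (1 / U)) (at w)"
    by (rule DERIV_diff[OF DERIV_const 2])
  have 4: "((\<lambda>w. sq_pos (1 - sq_pos ((w - U) / U))) has_real_derivative
    2 * max 0 (1 - sq_pos ((w - U) / U)) * (0 - 2 * max 0 ((w - U) / U) * (1 / U))) (at w)"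
    by (rule DERIV_chain2[OF DERIV_sq_pos 3])
  moreover have "2 * max 0 (1 - sq_pos ((w - U) / U)) * (0 - 2 * max 0 ((w - U) / U) * (1 / U)) = cutoff' U w"
    by (simp add: cutoff'_def)
  ultimately show ?thesis unfolding cutoff_def[abs_def] by simp
qed

lemma cutoff_below: "U > 0 \<Longrightarrow> w \<le> U \<Longrightarrow> cutoff U w = 1 \<and> cutoff' U w = 0"
proof -
  assume "U > 0" "w \<le> U"
  then have "(w - U) / U \<le> 0" by (simp add: divide_le_0_iff)
  then have "max 0 ((w - U) / U) = 0" by simp
  then show ?thesis by (simp add: cutoff_def cutoff'_def sq_pos_def)
qed

lemma cutoff_above: "U > 0 \<Longrightarrow> w \<ge> 2 * U \<Longrightarrow> cutoff U w = 0 \<and> cutoff' U w = 0"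
proof -
  assume U: "U > 0" "w \<ge> 2 * U"
  then have "(w - U) / U \<ge> 1" by (simp add: pos_le_divide_eq)
  then have "1 - sq_pos ((w - U) / U) \<le> 0" unfolding sq_pos_def by (simp add: max_def)
  then show ?thesis by (simp add: cutoff_def cutoff'_def sq_pos_def[of "1 - _"])
qed

lemma cutoff_bounds:
  assumes "U > 0"
  shows "0 \<le> cutoff U w" "cutoff U w \<le> 1" "\<bar>cutoff' U w\<bar> \<le> 4 / U"
proof -
  define s where "s = max 0 ((w - U) / U)"
  have s: "s \<ge> 0" "sq_pos ((w - U) / U) = s\<^sup>2" by (auto simp: s_def sq_pos_def)
  show "0 \<le> cutoff U w" by (simp add: cutoff_def sq_pos_def)
  have m: "0 \<le> max 0 (1 - s\<^sup>2)" "max 0 (1 - s\<^sup>2) \<le> 1" by auto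
  then have "(max 0 (1 - s\<^sup>2))\<^sup>2 \<le> 1\<^sup>2" by (intro power_mono) auto
  then show "cutoff U w \<le> 1" by (simp add: cutoff_def s(2) sq_pos_def[of "1 - _"])
  have "max 0 (1 - s\<^sup>2) * s \<le> 1"
  proof (cases "s \<le> 1")
    case True then show ?thesis using m s by (intro mult_le_one) auto
  next
    case False then have "1 - s\<^sup>2 \<le> 0" by simp
    then show ?thesis by (simp add: max_def)
  qed
  moreover have "0 \<le> max 0 (1 - s\<^sup>2) * s" using m s by simp
  moreover have "\<bar>cutoff' U w\<bar> = 4 / U * (max 0 (1 - s\<^sup>2) * s)"
    using assms m s by (simp add: cutoff'_def s(2) s_def[symmetric] abs_mult)
  ultimately show "\<bar>cutoff' U w\<bar> \<le> 4 / U"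
    using assms mult_left_mono[of "max 0 (1 - s\<^sup>2) * s" 1 "4 / U"] by simp
qed

section \<open>One step of the dynamics\<close>

lemma sq_add_le: "(a + b)\<^sup>2 \<le> 2 * a\<^sup>2 + 2 * b\<^sup>2" for a b :: real
  using sum_squares_bound[of a b] by (simp add: power2_sum)

lemma sq_add3_le: "(a + b + c)\<^sup>2 \<le> 3 * (a\<^sup>2 + b\<^sup>2 + c\<^sup>2)" for a b c :: real
  using sum_squares_bound[of a b] sum_squares_bound[of a c] sum_squares_bound[of b c]
  by (simp add: power2_eq_square algebra_simps)

lemma sq_le_of_abs_le: "\<bar>a\<bar> \<le> b \<Longrightarrow> a\<^sup>2 \<le> b\<^sup>2" for a b :: real
  by (subst abs_le_square_iff[symmetric]) simp

text \<open>The suprema of the hypotheses enter only as pointwise bounds, so \<open>C\<close> may be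
  any nonnegative upper bound of the Hessian norms.\<close>

locale svgd_setting = kernel_rkhs d k H ip for d k H ip +
  fixes N :: nat and V :: "vec \<Rightarrow> real" and B A \<alpha> C c :: real
  assumes d1: "d \<ge> 1" and N1: "N \<ge> 1"
    and V_smooth: "twice_differentiable_Rd d V"
    and V_pos: "\<And>x. x \<in> Rd d \<Longrightarrow> V x > 0"
    and V_growth: "\<And>x. x \<in> Rd d \<Longrightarrow> L2_set (\<lambda>i. partial i V x) {..<d} \<le> A * V x powr \<alpha>"
    and hess: "\<And>z. z \<in> Rd d \<Longrightarrow> op_norm d (hessian V z) \<le> C"
    and params: "B > 0" "A > 0" "0 \<le> \<alpha>" "\<alpha> < 1/2" "C \<ge> 0"
    and k_bd: "\<And>x y. x \<in> Rd d \<Longrightarrow> y \<in> Rd d \<Longrightarrow> \<bar>k x y\<bar> \<le> B"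
    and k1_bd: "\<And>x y l. x \<in> Rd d \<Longrightarrow> y \<in> Rd d \<Longrightarrow> l < d \<Longrightarrow> \<bar>k1 l x y\<bar> \<le> B"
    and k2_bd: "\<And>x y l. x \<in> Rd d \<Longrightarrow> y \<in> Rd d \<Longrightarrow> l < d \<Longrightarrow> \<bar>k2 l x y\<bar> \<le> B"
    and k21_bd: "\<And>x y l l'. x \<in> Rd d \<Longrightarrow> y \<in> Rd d \<Longrightarrow> l < d \<Longrightarrow> l' < d \<Longrightarrow> \<bar>k21 l' l x y\<bar> \<le> B"
    and k22_bd: "\<And>x y l l'. x \<in> Rd d \<Longrightarrow> y \<in> Rd d \<Longrightarrow> l < d \<Longrightarrow> l' < d \<Longrightarrow> \<bar>k22 l' l x y\<bar> \<le> B"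
    and diag: "\<And>z. z \<in> Rd d \<Longrightarrow> (\<Sum>l<d. k2 l z z * partial l V z) + k z z * laplacian d V z
      - laplacian d (k z) z \<le> c * real d"
begin

abbreviation "gV l x \<equiv> partial l V x"
abbreviation "hV l' l x \<equiv> hessian V x l' l"

definition "conf X \<longleftrightarrow> (\<forall>i<N. X i \<in> Rd d)"

lemma confD: "conf X \<Longrightarrow> i < N \<Longrightarrow> X i \<in> Rd d"
  by (simp add: conf_def)

section \<open>The force, its Jacobian and their sizes\<close>

definition W :: "config \<Rightarrow> real" where
  "W X = 1 / real N * (\<Sum>i<N. V (X i))"

definition force :: "config \<Rightarrow> nat \<Rightarrow> nat \<Rightarrow> real" where
  "force X i l = 1 / real N * (\<Sum>j<N. k (X i) (X j) * gV l (X j) - k2 l (X i) (X j))"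

text \<open>The derivative of the force on particle \<open>i\<close> is split by the argument of the
  kernel that moves. \<open>Dself\<close> moves the particle acted upon; \<open>Dcross\<close> moves
  a source, including \<open>i\<close> as its own source. The trace of \<open>Dself\<close> is part
  of the squared discrepancy, and that of \<open>Dcross\<close> is the diagonal term bounded by
  \<open>c * real d\<close>.\<close>

definition Dself :: "config \<Rightarrow> nat \<Rightarrow> nat \<Rightarrow> nat \<Rightarrow> real" where
  "Dself X i l l' = 1 / real N * (\<Sum>j<N. k1 l' (X i) (X j) * gV l (X j) - k21 l' l (X i) (X j))"

definition Dcross :: "config \<Rightarrow> nat \<Rightarrow> nat \<Rightarrow> nat \<Rightarrow> nat \<Rightarrow> real" where
  "Dcross X i l i' l' = 1 / real N * (k2 l' (X i) (X i') * gV l (X i') + k (X i) (X i') * hV l' l (X i')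
     - k22 l' l (X i) (X i'))"

definition Dforce :: "config \<Rightarrow> nat \<Rightarrow> nat \<Rightarrow> nat \<Rightarrow> nat \<Rightarrow> real" where
  "Dforce X i l i' l' = (if i' = i then Dself X i l l' else 0) + Dcross X i l i' l'"

definition grad_sq :: "config \<Rightarrow> real" where
  "grad_sq X = 1 / real N * (\<Sum>j<N. \<Sum>l<d. (gV l (X j))\<^sup>2)"

lemma Npos: "real N > 0" and dpos: "real d \<ge> 1"
  using N1 d1 by simp_all

lemma W_pos: "conf X \<Longrightarrow> W X > 0"
  unfolding W_def using N1 by (intro mult_pos_pos sum_pos) (auto intro!: V_pos confD simp: lessThan_empty_iff)

lemma grad_sq_nonneg: "0 \<le> grad_sq X"
  unfolding grad_sq_def by (intro mult_nonneg_nonneg sum_nonneg) auto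

text \<open>As 2\<alpha> < 1, the power 2\<alpha> is concave and the mean of the powers is at most
  the power of the mean potential.\<close>

lemma grad_sq_le: "conf X \<Longrightarrow> grad_sq X \<le> A\<^sup>2 * W X powr (2 * \<alpha>)"
proof -
  assume X: "conf X"
  have "(\<Sum>l<d. (gV l (X j))\<^sup>2) \<le> A\<^sup>2 * V (X j) powr (2 * \<alpha>)" if j: "j < N" for j
  proof -
    have "(L2_set (\<lambda>l. gV l (X j)) {..<d})\<^sup>2 \<le> (A * V (X j) powr \<alpha>)\<^sup>2"
      by (intro power_mono V_growth confD[OF X j]) simp
    moreover have "(L2_set (\<lambda>l. gV l (X j)) {..<d})\<^sup>2 = (\<Sum>l<d. (gV l (X j))\<^sup>2)"
      by (simp add: L2_set_def sum_nonneg)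
    moreover have "(A * V (X j) powr \<alpha>)\<^sup>2 = A\<^sup>2 * V (X j) powr (2 * \<alpha>)"
      by (simp add: power_mult_distrib power2_eq_square powr_add[symmetric])
    ultimately show ?thesis by simp
  qed
  then have "grad_sq X \<le> 1 / real N * (\<Sum>j<N. A\<^sup>2 * V (X j) powr (2 * \<alpha>))"
    unfolding grad_sq_def by (intro mult_left_mono sum_mono) auto
  also have "\<dots> = A\<^sup>2 * (1 / real N * (\<Sum>j<N. V (X j) powr (2 * \<alpha>)))" by (simp add: sum_distrib_left)
  also have "\<dots> \<le> A\<^sup>2 * (W X powr (2 * \<alpha>))"
    unfolding W_def using N1 params by (intro mult_left_mono powr_average_le) (auto intro!: V_pos confD[OF X])
  finally show ?thesis .
qed

lemma force_sq_le:
  assumes X: "conf X"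
  shows "(\<Sum>i<N. \<Sum>l<d. (force X i l)\<^sup>2) \<le> 2 * real N * B\<^sup>2 * (grad_sq X + real d)"
proof -
  have "(force X i l)\<^sup>2 \<le> 1 / real N * (\<Sum>j<N. 2 * B\<^sup>2 * ((gV l (X j))\<^sup>2 + 1))" if i: "i < N" and l: "l < d" for i l
  proof -
    have "(force X i l)\<^sup>2 \<le> 1 / real N * (\<Sum>j<N. (k (X i) (X j) * gV l (X j) - k2 l (X i) (X j))\<^sup>2)"
      unfolding force_def using N1 by (intro average_sq_le) simp
    also have "\<dots> \<le> 1 / real N * (\<Sum>j<N. 2 * B\<^sup>2 * ((gV l (X j))\<^sup>2 + 1))"
    proof (intro mult_left_mono sum_mono)
      fix j assume "j \<in> {..<N}"
      then have Xi: "X i \<in> Rd d" "X j \<in> Rd d" using confD[OF X] i by auto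
      have "(k (X i) (X j) * gV l (X j) - k2 l (X i) (X j))\<^sup>2 \<le> 2 * (k (X i) (X j) * gV l (X j))\<^sup>2 + 2 * (k2 l (X i) (X j))\<^sup>2"
        using sq_add_le[of "k (X i) (X j) * gV l (X j)" "- k2 l (X i) (X j)"] by simp
      also have "\<dots> \<le> 2 * (B\<^sup>2 * (gV l (X j))\<^sup>2) + 2 * B\<^sup>2"
        unfolding power_mult_distrib
        by (intro add_mono mult_left_mono mult_right_mono sq_le_of_abs_le k_bd k2_bd Xi l) auto
      finally show "(k (X i) (X j) * gV l (X j) - k2 l (X i) (X j))\<^sup>2 \<le> 2 * B\<^sup>2 * ((gV l (X j))\<^sup>2 + 1)"
        by (simp add: algebra_simps)
    qed simp
    finally show ?thesis .
  qed
  then have "(\<Sum>i<N. \<Sum>l<d. (force X i l)\<^sup>2) \<le> (\<Sum>i<N. \<Sum>l<d. 1 / real N * (\<Sum>j<N. 2 * B\<^sup>2 * ((gV l (X j))\<^sup>2 + 1)))"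
    by (intro sum_mono) auto
  also have "\<dots> = real N * (\<Sum>l<d. 1 / real N * (\<Sum>j<N. 2 * B\<^sup>2 * ((gV l (X j))\<^sup>2 + 1)))" by simp
  also have "(\<Sum>l<d. 1 / real N * (\<Sum>j<N. 2 * B\<^sup>2 * ((gV l (X j))\<^sup>2 + 1))) = 2 * B\<^sup>2 * (1 / real N * (\<Sum>l<d. \<Sum>j<N. (gV l (X j))\<^sup>2 + 1))"
    unfolding sum_distrib_left by (intro sum.cong refl) simp
  also have "(\<Sum>l<d. \<Sum>j<N. (gV l (X j))\<^sup>2 + 1) = (\<Sum>j<N. \<Sum>l<d. (gV l (X j))\<^sup>2 + 1)" by (rule sum.swap)
  also have "\<dots> = real N * (grad_sq X + real d)" using Npos by (simp add: sum.distrib grad_sq_def algebra_simps)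
  finally show ?thesis using Npos by simp
qed

lemma Dself_sq_le:
  assumes X: "conf X"
  shows "(\<Sum>i<N. \<Sum>l<d. \<Sum>l'<d. (Dself X i l l')\<^sup>2) \<le> 2 * real N * B\<^sup>2 * real d * (grad_sq X + real d)"
proof -
  have "(Dself X i l l')\<^sup>2 \<le> 1 / real N * (\<Sum>j<N. 2 * B\<^sup>2 * ((gV l (X j))\<^sup>2 + 1))"
    if i: "i < N" and l: "l < d" and l': "l' < d" for i l l'
  proof -
    have "(Dself X i l l')\<^sup>2 \<le> 1 / real N * (\<Sum>j<N. (k1 l' (X i) (X j) * gV l (X j) - k21 l' l (X i) (X j))\<^sup>2)"
      unfolding Dself_def using N1 by (intro average_sq_le) simp
    also have "\<dots> \<le> 1 / real N * (\<Sum>j<N. 2 * B\<^sup>2 * ((gV l (X j))\<^sup>2 + 1))"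
    proof (intro mult_left_mono sum_mono)
      fix j assume "j \<in> {..<N}"
      then have Xi: "X i \<in> Rd d" "X j \<in> Rd d" using confD[OF X] i by auto
      have "(k1 l' (X i) (X j) * gV l (X j) - k21 l' l (X i) (X j))\<^sup>2 \<le> 2 * (k1 l' (X i) (X j) * gV l (X j))\<^sup>2 + 2 * (k21 l' l (X i) (X j))\<^sup>2"
        using sq_add_le[of "k1 l' (X i) (X j) * gV l (X j)" "- k21 l' l (X i) (X j)"] by simp
      also have "\<dots> \<le> 2 * (B\<^sup>2 * (gV l (X j))\<^sup>2) + 2 * B\<^sup>2"
        unfolding power_mult_distrib
        by (intro add_mono mult_left_mono mult_right_mono sq_le_of_abs_le k1_bd k21_bd Xi l l') auto
      finally show "(k1 l' (X i) (X j) * gV l (X j) - k21 l' l (X i) (X j))\<^sup>2 \<le> 2 * B\<^sup>2 * ((gV l (X j))\<^sup>2 + 1)"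
        by (simp add: algebra_simps)
    qed simp
    finally show ?thesis .
  qed
  then have "(\<Sum>i<N. \<Sum>l<d. \<Sum>l'<d. (Dself X i l l')\<^sup>2) \<le> (\<Sum>i<N. \<Sum>l<d. \<Sum>l'<d. 1 / real N * (\<Sum>j<N. 2 * B\<^sup>2 * ((gV l (X j))\<^sup>2 + 1)))"
    by (intro sum_mono) auto
  also have "\<dots> = real N * (real d * (\<Sum>l<d. 1 / real N * (\<Sum>j<N. 2 * B\<^sup>2 * ((gV l (X j))\<^sup>2 + 1))))"
    by (simp add: sum_distrib_left)
  also have "(\<Sum>l<d. 1 / real N * (\<Sum>j<N. 2 * B\<^sup>2 * ((gV l (X j))\<^sup>2 + 1))) = 2 * B\<^sup>2 * (1 / real N * (\<Sum>l<d. \<Sum>j<N. (gV l (X j))\<^sup>2 + 1))"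
    unfolding sum_distrib_left by (intro sum.cong refl) simp
  also have "(\<Sum>l<d. \<Sum>j<N. (gV l (X j))\<^sup>2 + 1) = (\<Sum>j<N. \<Sum>l<d. (gV l (X j))\<^sup>2 + 1)" by (rule sum.swap)
  also have "\<dots> = real N * (grad_sq X + real d)" using Npos by (simp add: sum.distrib grad_sq_def algebra_simps)
  finally show ?thesis using Npos by (simp add: mult_ac)
qed

text \<open>There are N^2 blocks, each with a factor 1/N^2 in its square, so the total carries no
  factor N. The Hessian contributes C^2 d per source by its Frobenius bound.\<close>

lemma Dcross_sq_le:
  assumes X: "conf X"
  shows "(\<Sum>i<N. \<Sum>l<d. \<Sum>i'<N. \<Sum>l'<d. (Dcross X i l i' l')\<^sup>2) \<le> 3 * B\<^sup>2 * real d * (grad_sq X + C\<^sup>2 + real d)"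
proof -
  have "(Dcross X i l i' l')\<^sup>2 \<le> (1 / real N)\<^sup>2 * (3 * B\<^sup>2) * ((gV l (X i'))\<^sup>2 + (hV l' l (X i'))\<^sup>2 + 1)"
    if i: "i < N" and l: "l < d" and i': "i' < N" and l': "l' < d" for i l i' l'
  proof -
    have Xi: "X i \<in> Rd d" "X i' \<in> Rd d" using confD[OF X] i i' by auto
    have "(k2 l' (X i) (X i') * gV l (X i') + k (X i) (X i') * hV l' l (X i') - k22 l' l (X i) (X i'))\<^sup>2
      \<le> 3 * ((k2 l' (X i) (X i') * gV l (X i'))\<^sup>2 + (k (X i) (X i') * hV l' l (X i'))\<^sup>2 + (k22 l' l (X i) (X i'))\<^sup>2)"
      using sq_add3_le[of "k2 l' (X i) (X i') * gV l (X i')" "k (X i) (X i') * hV l' l (X i')" "- k22 l' l (X i) (X i')"] by simp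
    also have "\<dots> \<le> 3 * (B\<^sup>2 * (gV l (X i'))\<^sup>2 + B\<^sup>2 * (hV l' l (X i'))\<^sup>2 + B\<^sup>2)"
      unfolding power_mult_distrib
      by (intro mult_left_mono add_mono mult_right_mono sq_le_of_abs_le k_bd k2_bd k22_bd Xi l l') auto
    also have "\<dots> = (3 * B\<^sup>2) * ((gV l (X i'))\<^sup>2 + (hV l' l (X i'))\<^sup>2 + 1)" by (simp add: algebra_simps)
    finally show ?thesis unfolding Dcross_def power_mult_distrib mult.assoc by (intro mult_left_mono) auto
  qed
  then have "(\<Sum>i<N. \<Sum>l<d. \<Sum>i'<N. \<Sum>l'<d. (Dcross X i l i' l')\<^sup>2)
    \<le> (\<Sum>i<N. \<Sum>l<d. \<Sum>i'<N. \<Sum>l'<d. (1 / real N)\<^sup>2 * (3 * B\<^sup>2) * ((gV l (X i'))\<^sup>2 + (hV l' l (X i'))\<^sup>2 + 1))"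
    by (intro sum_mono) auto
  also have "\<dots> = (\<Sum>i<N. (1 / real N)\<^sup>2 * (3 * B\<^sup>2) * (\<Sum>l<d. \<Sum>i'<N. \<Sum>l'<d. (gV l (X i'))\<^sup>2 + (hV l' l (X i'))\<^sup>2 + 1))"
    unfolding sum_distrib_left ..
  also have "\<dots> = real N * ((1 / real N)\<^sup>2 * (3 * B\<^sup>2) * (\<Sum>l<d. \<Sum>i'<N. \<Sum>l'<d. (gV l (X i'))\<^sup>2 + (hV l' l (X i'))\<^sup>2 + 1))"
    by simp
  also have "\<dots> \<le> real N * ((1 / real N)\<^sup>2 * (3 * B\<^sup>2) * (real N * real d * (grad_sq X + C\<^sup>2 + real d)))"
  proof (intro mult_left_mono)
    have "(\<Sum>l<d. \<Sum>i'<N. \<Sum>l'<d. (gV l (X i'))\<^sup>2 + (hV l' l (X i'))\<^sup>2 + 1)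
      = (\<Sum>i'<N. \<Sum>l<d. \<Sum>l'<d. (gV l (X i'))\<^sup>2 + (hV l' l (X i'))\<^sup>2 + 1)" by (rule sum.swap)
    also have "\<dots> \<le> (\<Sum>i'<N. real d * (\<Sum>l<d. (gV l (X i'))\<^sup>2) + C\<^sup>2 * real d + real d * real d)"
    proof (rule sum_mono)
      fix i' assume "i' \<in> {..<N}"
      then have "(\<Sum>l<d. \<Sum>l'<d. (hV l' l (X i'))\<^sup>2) \<le> C\<^sup>2 * real d"
        using confD[OF X] by (intro hessian_frobenius hess params) auto
      then show "(\<Sum>l<d. \<Sum>l'<d. (gV l (X i'))\<^sup>2 + (hV l' l (X i'))\<^sup>2 + 1)
        \<le> real d * (\<Sum>l<d. (gV l (X i'))\<^sup>2) + C\<^sup>2 * real d + real d * real d"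
        by (simp add: sum.distrib sum_distrib_left)
    qed
    also have "\<dots> = real d * (\<Sum>i'<N. \<Sum>l<d. (gV l (X i'))\<^sup>2) + real N * (C\<^sup>2 * real d) + real N * (real d * real d)"
      by (simp add: sum.distrib sum_distrib_left)
    also have "(\<Sum>i'<N. \<Sum>l<d. (gV l (X i'))\<^sup>2) = real N * grad_sq X" using Npos by (simp add: grad_sq_def)
    finally show "(\<Sum>l<d. \<Sum>i'<N. \<Sum>l'<d. (gV l (X i'))\<^sup>2 + (hV l' l (X i'))\<^sup>2 + 1) \<le> real N * real d * (grad_sq X + C\<^sup>2 + real d)"
      by (simp add: algebra_simps)
  qed auto
  also have "\<dots> = 3 * B\<^sup>2 * real d * (grad_sq X + C\<^sup>2 + real d)" using Npos by (simp add: power2_eq_square)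
  finally show ?thesis .
qed

definition "size_bd X = grad_sq X + (C\<^sup>2 + 1) * real d"

lemma Dforce_sq_le:
  assumes X: "conf X"
  shows "(\<Sum>i<N. \<Sum>l<d. \<Sum>i'<N. \<Sum>l'<d. (Dforce X i l i' l')\<^sup>2) \<le> 10 * real N * B\<^sup>2 * real d * size_bd X"
proof -
  have "(\<Sum>i<N. \<Sum>l<d. \<Sum>i'<N. \<Sum>l'<d. (Dforce X i l i' l')\<^sup>2)
    \<le> (\<Sum>i<N. \<Sum>l<d. \<Sum>i'<N. \<Sum>l'<d. 2 * (if i' = i then (Dself X i l l')\<^sup>2 else 0) + 2 * (Dcross X i l i' l')\<^sup>2)"
  proof (intro sum_mono)
    fix i l i' l'
    show "(Dforce X i l i' l')\<^sup>2 \<le> 2 * (if i' = i then (Dself X i l l')\<^sup>2 else 0) + 2 * (Dcross X i l i' l')\<^sup>2"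
      using sq_add_le[of "Dself X i l l'" "Dcross X i l i' l'"] by (cases "i' = i") (simp_all add: Dforce_def)
  qed
  also have "\<dots> = 2 * (\<Sum>i<N. \<Sum>l<d. \<Sum>l'<d. (Dself X i l l')\<^sup>2) + 2 * (\<Sum>i<N. \<Sum>l<d. \<Sum>i'<N. \<Sum>l'<d. (Dcross X i l i' l')\<^sup>2)"
  proof -
    have "(\<Sum>i'<N. \<Sum>l'<d. if i' = i then (Dself X i l l')\<^sup>2 else 0) = (\<Sum>l'<d. (Dself X i l l')\<^sup>2)" if "i < N" for i l
    proof -
      have "(\<Sum>i'<N. \<Sum>l'<d. if i' = i then (Dself X i l l')\<^sup>2 else 0) = (\<Sum>i'<N. if i' = i then (\<Sum>l'<d. (Dself X i l l')\<^sup>2) else 0)"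
        by (intro sum.cong) auto
      then show ?thesis using that by simp
    qed
    then show ?thesis by (simp add: sum.distrib sum_distrib_left[symmetric])
  qed
  also have "\<dots> \<le> 2 * (2 * real N * B\<^sup>2 * real d * (grad_sq X + real d)) + 2 * (3 * B\<^sup>2 * real d * (grad_sq X + C\<^sup>2 + real d))"
    by (intro add_mono mult_left_mono Dself_sq_le Dcross_sq_le X) auto
  also have "\<dots> = (B\<^sup>2 * real d) * (4 * real N * (grad_sq X + real d) + 6 * (grad_sq X + C\<^sup>2 + real d))"
    by (simp add: algebra_simps)
  \<comment> \<open>The self part contributes 4N and the cross part 6; the latter is enlarged to 6N,
    which gives the constant 10.\<close>
  also have "\<dots> \<le> (B\<^sup>2 * real d) * (4 * real N * size_bd X + 6 * real N * size_bd X)"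
  proof (rule mult_left_mono[OF add_mono])
    have C2: "C\<^sup>2 \<le> C\<^sup>2 * real d" using mult_left_mono[OF dpos, of "C\<^sup>2"] by simp
    then have s: "grad_sq X + C\<^sup>2 + real d \<le> size_bd X" by (simp add: size_bd_def algebra_simps)
    have "grad_sq X + real d \<le> size_bd X" using s zero_le_power2[of C] by linarith
    then show "4 * real N * (grad_sq X + real d) \<le> 4 * real N * size_bd X"
      by (rule mult_left_mono) simp
    have "0 \<le> size_bd X" using grad_sq_nonneg[of X] by (simp add: size_bd_def)
    then have "size_bd X \<le> real N * size_bd X" using mult_right_mono[of 1 "real N" "size_bd X"] N1 by simp
    then show "6 * (grad_sq X + C\<^sup>2 + real d) \<le> 6 * real N * size_bd X" using s by simp
  qed auto
  finally show ?thesis by (simp add: algebra_simps)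
qed

lemma force_sq_le': "conf X \<Longrightarrow> (\<Sum>i<N. \<Sum>l<d. (force X i l)\<^sup>2) \<le> 2 * real N * B\<^sup>2 * size_bd X"
proof -
  assume X: "conf X"
  have "grad_sq X + real d \<le> size_bd X" by (simp add: size_bd_def algebra_simps)
  then have "2 * real N * B\<^sup>2 * (grad_sq X + real d) \<le> 2 * real N * B\<^sup>2 * size_bd X"
    by (intro mult_left_mono) auto
  then show ?thesis using force_sq_le[OF X] by linarith
qed

text \<open>The region W \<le> 2U contains every configuration at which the cutoff is nonzero. The
  factor 2^(2\<alpha>) \<le> 2 explains 2A^2.\<close>

lemma size_bd_le:
  assumes X: "conf X" and W: "W X \<le> 2 * U" and U: "U \<ge> 1"
  shows "size_bd X \<le> (2 * A\<^sup>2 + C\<^sup>2 + 1) * (U powr (2*\<alpha>) + real d)"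
proof -
  have "W X powr (2*\<alpha>) \<le> (2 * U) powr (2*\<alpha>)"
    using W W_pos[OF X] params by (intro powr_mono2) auto
  also have "\<dots> = 2 powr (2*\<alpha>) * U powr (2*\<alpha>)" using U by (simp add: powr_mult)
  also have "\<dots> \<le> 2 * U powr (2*\<alpha>)"
    using params powr_mono[of "2*\<alpha>" 1 2] by (intro mult_right_mono) auto
  finally have "A\<^sup>2 * W X powr (2*\<alpha>) \<le> A\<^sup>2 * (2 * U powr (2*\<alpha>))" by (intro mult_left_mono) auto
  then have g: "grad_sq X \<le> A\<^sup>2 * (2 * U powr (2*\<alpha>))" using grad_sq_le[OF X] by linarith
  have "(2 * A\<^sup>2 + C\<^sup>2 + 1) * (U powr (2*\<alpha>) + real d)
    = A\<^sup>2 * (2 * U powr (2*\<alpha>)) + 2 * A\<^sup>2 * real d + (C\<^sup>2 + 1) * U powr (2*\<alpha>) + (C\<^sup>2 + 1) * real d"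
    by (simp add: algebra_simps)
  moreover have "0 \<le> (C\<^sup>2 + 1) * U powr (2*\<alpha>)" "0 \<le> 2 * A\<^sup>2 * real d" by auto
  ultimately show ?thesis unfolding size_bd_def using g by linarith
qed

section \<open>The cut-off field as a small perturbation\<close>

text \<open>The displacement of one step, switched off at high mean potential so that a bound
  uniform over all configurations holds. \<open>fieldM\<close> is its Jacobian by the product and
  chain rules.\<close>

definition "fieldg \<eta> U p x = (case p of (i, l) \<Rightarrow>
  - \<eta> * (cutoff U (W (unflatten N d x)) * force (unflatten N d x) i l))"

definition "fieldM \<eta> U x p q = (case p of (i, l) \<Rightarrow> case q of (i', l') \<Rightarrow>
  - \<eta> * (cutoff' U (W (unflatten N d x)) * (1 / real N * gV l' (unflatten N d x i')) * force (unflatten N d x) i l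
    + cutoff U (W (unflatten N d x)) * Dforce (unflatten N d x) i l i' l'))"

lemma conf_unflatten: "conf (unflatten N d x)"
  by (simp add: conf_def unflatten_in)

lemma V_grad: "z \<in> Rd d \<Longrightarrow> has_grad {..<d} V (\<lambda>i. gV i z) z"
  using V_smooth by (intro has_grad_partial) (auto simp: twice_differentiable_Rd_def)

lemma gV_grad: "z \<in> Rd d \<Longrightarrow> l < d \<Longrightarrow> has_grad {..<d} (partial l V) (\<lambda>i. hV i l z) z"
  unfolding hessian_def using V_smooth by (intro has_grad_partial) (auto simp: twice_differentiable_Rd_def)

text \<open>Each pair term is differentiated as a function on R^(2d) through \<open>joint\<close>.
  When the source is the particle itself, both kernel arguments contribute to the same
  derivative.\<close>

lemma force_grad:
  assumes x: "x \<in> flat_index N d \<rightarrow>\<^sub>E UNIV" and i: "i < N" and l: "l < d"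
  shows "has_grad (flat_index N d) (\<lambda>y. force (unflatten N d y) i l)
    (\<lambda>(i', l'). Dforce (unflatten N d x) i l i' l') x"
proof -
  let ?I = "flat_index N d" and ?X = "unflatten N d x" and ?f = "partial (d + l) (joint d k)"
  let ?z = "\<lambda>y j. cat d (unflatten N d y i) (unflatten N d y j)"
  let ?t = "\<lambda>y j. joint d k (?z y j) * gV l (unflatten N d y j) + (- 1) * ?f (?z y j)"
  let ?g = "\<lambda>j p. ((case p of (i', l') \<Rightarrow> (if i' = i then partial l' (joint d k) (?z x j) else 0)
        + (if i' = j then partial (d + l') (joint d k) (?z x j) else 0)) * gV l (?X j)
      + joint d k (?z x j) * (case p of (i', l') \<Rightarrow> if i' = j then hV l' l (?X j) else 0))
      + (- 1) * (case p of (i', l') \<Rightarrow> (if i' = i then partial l' ?f (?z x j) else 0)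
        + (if i' = j then partial (d + l') ?f (?z x j) else 0))"
  have Xi: "unflatten N d y j \<in> Rd d" if "j < N" for y j using that by (rule unflatten_in)
  have "has_grad ?I (\<lambda>y. ?t y j) (\<lambda>p. ?g j p) x" if j: "j < N" for j
    by (intro has_grad_add has_grad_mult has_grad_cmult finite_flat_index x
        has_grad_particle_pair[OF i j x joint_grad[OF cat_in]] has_grad_particle_pair[OF i j x joint2_grad[OF cat_in l]]
        has_grad_particle[OF j x gV_grad[OF Xi[OF j] l]])
  note pair = this
  have "has_grad ?I (\<lambda>y. 1 / real N * (\<Sum>j<N. ?t y j)) (\<lambda>p. 1 / real N * (\<Sum>j<N. ?g j p)) x"
    by (rule has_grad_cmult[OF finite_flat_index x has_grad_sum[OF finite_flat_index x _ pair]]) auto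
  then show ?thesis
  proof (rule has_grad_cong[OF _ _ _ x])
    fix y
    show "1 / real N * (\<Sum>j<N. ?t y j) = force (unflatten N d y) i l"
      unfolding force_def using i l Xi by (intro arg_cong2[where f="(*)"] sum.cong refl) (simp add: joint_cat k2_cat)
  next
    fix p assume p: "p \<in> ?I"
    obtain i' l' where [simp]: "p = (i', l')" by (cases p)
    let ?a = "\<lambda>j. k1 l' (?X i) (?X j) * gV l (?X j) - k21 l' l (?X i) (?X j)"
    let ?b = "\<lambda>j. k2 l' (?X i) (?X j) * gV l (?X j) + k (?X i) (?X j) * hV l' l (?X j) - k22 l' l (?X i) (?X j)"
    have il: "i' < N" "l' < d" using p by (auto simp: flat_index_def)
    have "(\<Sum>j<N. ?g j (i', l')) = (\<Sum>j<N. (if i' = i then ?a j else 0) + (if j = i' then ?b j else 0))"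
    proof (rule sum.cong[OF refl])
      fix j assume "j \<in> {..<N}"
      then have j: "j < N" by simp
      note e = joint_cat[OF Xi[OF i] Xi[OF j]] k1_cat[OF Xi[OF i] Xi[OF j] il(2)] k2_cat[OF Xi[OF i] Xi[OF j] il(2)]
        k21_cat[OF Xi[OF i] Xi[OF j] l il(2)] k22_cat[OF Xi[OF i] Xi[OF j] l il(2)]
      show "?g j (i', l') = (if i' = i then ?a j else 0) + (if j = i' then ?b j else 0)"
        unfolding prod.case e by (cases "i' = i"; cases "j = i'") (simp_all add: algebra_simps)
    qed
    also have "\<dots> = (if i' = i then (\<Sum>j<N. ?a j) else 0) + ?b i'"
      using il by (simp add: sum.distrib)
    finally have s: "(\<Sum>j<N. ?g j (i', l')) = (if i' = i then (\<Sum>j<N. ?a j) else 0) + ?b i'" .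
    show "1 / real N * (\<Sum>j<N. ?g j p) = (case p of (i', l') \<Rightarrow> Dforce ?X i l i' l')"
      unfolding \<open>p = (i', l')\<close> prod.case s[unfolded prod.case] Dforce_def Dself_def Dcross_def
      by (cases "i' = i") (simp_all only: if_True if_False distrib_left add_0_left simp_thms mult_zero_right)
  qed
qed

lemma W_grad:
  assumes x: "x \<in> flat_index N d \<rightarrow>\<^sub>E UNIV"
  shows "has_grad (flat_index N d) (\<lambda>y. W (unflatten N d y)) (\<lambda>(i', l'). 1 / real N * gV l' (unflatten N d x i')) x"
proof -
  let ?X = "unflatten N d x"
  have "has_grad (flat_index N d) (\<lambda>y. 1 / real N * (\<Sum>i<N. V (unflatten N d y i)))
    (\<lambda>p. 1 / real N * (\<Sum>i<N. case p of (i', l') \<Rightarrow> if i' = i then gV l' (?X i) else 0)) x"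
    by (intro has_grad_cmult has_grad_sum finite_flat_index x has_grad_particle V_grad unflatten_in) auto
  then show ?thesis
  proof (rule has_grad_cong[OF _ _ _ x])
    fix p assume "p \<in> flat_index N d"
    moreover obtain i' l' where [simp]: "p = (i', l')" by (cases p)
    ultimately have "i' < N" by (simp add: flat_index_def)
    moreover have "(\<Sum>i<N. if i' = i then gV l' (?X i) else 0) = (\<Sum>i<N. if i = i' then gV l' (?X i') else 0)"
      by (intro sum.cong) auto
    ultimately show "1 / real N * (\<Sum>i<N. case p of (i', l') \<Rightarrow> if i' = i then gV l' (?X i) else 0)
      = (case p of (i', l') \<Rightarrow> 1 / real N * gV l' (?X i'))" by simp
  qed (simp add: W_def)
qed

text \<open>The constant 20 is twice the 10 of \<open>Dforce_sq_le\<close>, 128 is 4 times the 32 of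
  the cutoff term in \<open>fieldM_sq_le\<close>, and the last factor is that of
  \<open>size_bd_le\<close>.\<close>

definition "\<kappa> = B\<^sup>2 * (20 + 128 * A\<^sup>2) * (2 * A\<^sup>2 + C\<^sup>2 + 1)"

lemma fieldM_sq_le:
  assumes U: "U \<ge> 1"
  shows "(\<Sum>p\<in>flat_index N d. \<Sum>q\<in>flat_index N d. (fieldM \<eta> U x p q)\<^sup>2) \<le> \<eta>\<^sup>2 * (real N * (real d * (U powr (2*\<alpha>) + real d))) * \<kappa>"
proof -
  let ?X = "unflatten N d x" let ?w = "W ?X" let ?R = "U powr (2*\<alpha>) + real d" let ?Q = "2 * A\<^sup>2 + C\<^sup>2 + 1"
  have X: "conf ?X" by (rule conf_unflatten)
  have R: "?R \<ge> 0" by simp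
  have Q: "?Q \<ge> 0" by simp
  have U0: "U > 0" using U by simp
  show ?thesis
  proof (cases "?w < 2 * U")
    case False
    then have "cutoff U ?w = 0 \<and> cutoff' U ?w = 0" using U by (intro cutoff_above) auto
    then have "fieldM \<eta> U x p q = 0" for p q by (simp add: fieldM_def split: prod.split)
    then show ?thesis using R by (simp add: \<kappa>_def)
  next
    case True
    have sb: "size_bd ?X \<le> ?Q * ?R" using True U by (intro size_bd_le X) auto
    have sb0: "0 \<le> size_bd ?X" using grad_sq_nonneg by (simp add: size_bd_def)
    let ?t = "cutoff U ?w" and ?t' = "cutoff' U ?w"
    have "(\<Sum>p\<in>flat_index N d. \<Sum>q\<in>flat_index N d. (fieldM \<eta> U x p q)\<^sup>2)
      = (\<Sum>i<N. \<Sum>l<d. \<Sum>i'<N. \<Sum>l'<d. (fieldM \<eta> U x (i, l) (i', l'))\<^sup>2)"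
      by (simp add: sum_flat_index)
    also have "\<dots> \<le> (\<Sum>i<N. \<Sum>l<d. \<Sum>i'<N. \<Sum>l'<d. 2 * \<eta>\<^sup>2 * (?t'\<^sup>2 * (1 / real N)\<^sup>2) * ((gV l' (?X i'))\<^sup>2 * (force ?X i l)\<^sup>2)
       + 2 * \<eta>\<^sup>2 * (Dforce ?X i l i' l')\<^sup>2)"
    proof (intro sum_mono)
      fix i l i' l'
      have "(fieldM \<eta> U x (i, l) (i', l'))\<^sup>2 = \<eta>\<^sup>2 * (?t' * (1 / real N * gV l' (?X i')) * force ?X i l + ?t * Dforce ?X i l i' l')\<^sup>2"
        by (simp add: fieldM_def power_mult_distrib)
      also have "\<dots> \<le> \<eta>\<^sup>2 * (2 * (?t' * (1 / real N * gV l' (?X i')) * force ?X i l)\<^sup>2 + 2 * (?t * Dforce ?X i l i' l')\<^sup>2)"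
        by (intro mult_left_mono sq_add_le) auto
      also have "\<dots> = 2 * \<eta>\<^sup>2 * (?t'\<^sup>2 * (1 / real N)\<^sup>2) * ((gV l' (?X i'))\<^sup>2 * (force ?X i l)\<^sup>2) + 2 * \<eta>\<^sup>2 * (?t\<^sup>2 * (Dforce ?X i l i' l')\<^sup>2)"
        by (simp add: power_mult_distrib power_divide algebra_simps)
      also have "?t\<^sup>2 * (Dforce ?X i l i' l')\<^sup>2 \<le> 1 * (Dforce ?X i l i' l')\<^sup>2"
        using cutoff_bounds[OF U0, of ?w] by (intro mult_right_mono) (auto simp: power_le_one)
      finally show "(fieldM \<eta> U x (i, l) (i', l'))\<^sup>2 \<le> 2 * \<eta>\<^sup>2 * (?t'\<^sup>2 * (1 / real N)\<^sup>2) * ((gV l' (?X i'))\<^sup>2 * (force ?X i l)\<^sup>2)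
       + 2 * \<eta>\<^sup>2 * (Dforce ?X i l i' l')\<^sup>2" by (simp add: mult_left_mono)
    qed
    also have "\<dots> = 2 * \<eta>\<^sup>2 * (?t'\<^sup>2 * (1 / real N)\<^sup>2) * (\<Sum>i<N. \<Sum>l<d. \<Sum>i'<N. \<Sum>l'<d. (gV l' (?X i'))\<^sup>2 * (force ?X i l)\<^sup>2)
      + 2 * \<eta>\<^sup>2 * (\<Sum>i<N. \<Sum>l<d. \<Sum>i'<N. \<Sum>l'<d. (Dforce ?X i l i' l')\<^sup>2)"
      unfolding sum.distrib sum_distrib_left ..
    also have "(\<Sum>i<N. \<Sum>l<d. \<Sum>i'<N. \<Sum>l'<d. (gV l' (?X i'))\<^sup>2 * (force ?X i l)\<^sup>2) = (real N * grad_sq ?X) * (\<Sum>i<N. \<Sum>l<d. (force ?X i l)\<^sup>2)"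
      unfolding sum_distrib_left sum_distrib_right[symmetric] using Npos by (simp add: grad_sq_def)
    also have "2 * \<eta>\<^sup>2 * (?t'\<^sup>2 * (1 / real N)\<^sup>2) * ((real N * grad_sq ?X) * (\<Sum>i<N. \<Sum>l<d. (force ?X i l)\<^sup>2))
      \<le> 2 * \<eta>\<^sup>2 * (?t'\<^sup>2 * (1 / real N)\<^sup>2) * ((real N * grad_sq ?X) * (2 * real N * B\<^sup>2 * size_bd ?X))"
      using grad_sq_nonneg by (intro mult_left_mono force_sq_le' X) auto
    also have "\<dots> = 4 * \<eta>\<^sup>2 * B\<^sup>2 * (?t'\<^sup>2 * grad_sq ?X) * size_bd ?X"
      using Npos by (simp add: power2_eq_square)
    \<comment> \<open>The squared slope of the cutoff is at most 16/U^2 and the mean squared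
      gradient at most 2 A^2 U, again by 2\<alpha> \<le> 1; the product 32 A^2 / U stays
      bounded.\<close>
    also have "?t'\<^sup>2 * grad_sq ?X \<le> 32 * A\<^sup>2"
    proof -
      have w: "?w powr (2*\<alpha>) \<le> 2 * U"
      proof -
        have "?w powr (2*\<alpha>) \<le> (2 * U) powr (2*\<alpha>)" using True W_pos[OF X] params by (intro powr_mono2) auto
        also have "\<dots> \<le> (2 * U) powr 1" using U params by (intro powr_mono) auto
        finally show ?thesis using U by simp
      qed
      have "grad_sq ?X \<le> A\<^sup>2 * (2 * U)" using grad_sq_le[OF X] mult_left_mono[OF w, of "A\<^sup>2"] by simp
      moreover have "?t'\<^sup>2 \<le> (4 / U)\<^sup>2" using cutoff_bounds(3)[OF U0] by (rule sq_le_of_abs_le)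
      ultimately have "?t'\<^sup>2 * grad_sq ?X \<le> (4 / U)\<^sup>2 * (A\<^sup>2 * (2 * U))"
        using grad_sq_nonneg by (intro mult_mono) auto
      also have "\<dots> = 32 * A\<^sup>2 / U" using U0 by (simp add: power2_eq_square)
      also have "\<dots> \<le> 32 * A\<^sup>2" using U mult_left_mono[of 1 U "32 * A\<^sup>2"] by (simp add: divide_le_eq)
      finally show ?thesis .
    qed
    also have "2 * \<eta>\<^sup>2 * (\<Sum>i<N. \<Sum>l<d. \<Sum>i'<N. \<Sum>l'<d. (Dforce ?X i l i' l')\<^sup>2) \<le> 2 * \<eta>\<^sup>2 * (10 * real N * B\<^sup>2 * real d * size_bd ?X)"
      by (intro mult_left_mono Dforce_sq_le X) auto
    finally have "(\<Sum>p\<in>flat_index N d. \<Sum>q\<in>flat_index N d. (fieldM \<eta> U x p q)\<^sup>2)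
      \<le> 4 * \<eta>\<^sup>2 * B\<^sup>2 * (32 * A\<^sup>2) * size_bd ?X + 2 * \<eta>\<^sup>2 * (10 * real N * B\<^sup>2 * real d * size_bd ?X)"
      using sb0 by (simp add: mult_left_mono mult_right_mono)
    also have "\<dots> = \<eta>\<^sup>2 * B\<^sup>2 * size_bd ?X * (128 * A\<^sup>2 + 20 * (real N * real d))" by (simp add: algebra_simps)
    also have "\<dots> \<le> \<eta>\<^sup>2 * B\<^sup>2 * (?Q * ?R) * (128 * A\<^sup>2 * (real N * real d) + 20 * (real N * real d))"
    proof (rule mult_mono[OF mult_left_mono[OF sb]])
      have "1 \<le> real N * real d" using N1 dpos mult_mono[of 1 "real N" 1 "real d"] by simp
      then show "128 * A\<^sup>2 + 20 * (real N * real d) \<le> 128 * A\<^sup>2 * (real N * real d) + 20 * (real N * real d)"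
        using mult_left_mono[of 1 "real N * real d" "128 * A\<^sup>2"] by simp
    qed (use R Q in \<open>auto intro!: mult_nonneg_nonneg\<close>)
    also have "\<dots> = \<eta>\<^sup>2 * (real N * (real d * ?R)) * \<kappa>" by (simp add: \<kappa>_def algebra_simps)
    finally show ?thesis .
  qed
qed

lemma perturbation_field:
  assumes U: "U \<ge> 1" and small: "\<eta>\<^sup>2 * (real N * (real d * (U powr (2*\<alpha>) + real d))) * \<kappa> \<le> 1/36"
  shows "perturbation (flat_index N d) (fieldg \<eta> U) (fieldM \<eta> U)"
proof
  fix x :: "nat \<times> nat \<Rightarrow> real" and p assume x: "x \<in> flat_index N d \<rightarrow>\<^sub>E UNIV" and p: "p \<in> flat_index N d"
  obtain i l where [simp]: "p = (i, l)" by (cases p)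
  have il: "i < N" "l < d" using p by (auto simp: flat_index_def)
  let ?X = "unflatten N d x"
  have U0: "U > 0" using U by simp
  have "has_grad (flat_index N d) (\<lambda>y. (- \<eta>) * (cutoff U (W (unflatten N d y)) * force (unflatten N d y) i l))
    (\<lambda>q. (- \<eta>) * ((cutoff' U (W ?X) * (case q of (i', l') \<Rightarrow> 1 / real N * gV l' (?X i'))) * force ?X i l
      + cutoff U (W ?X) * (case q of (i', l') \<Rightarrow> Dforce ?X i l i' l'))) x"
    by (rule has_grad_cmult[OF finite_flat_index x has_grad_mult[OF finite_flat_index x
        has_grad_compose_real[OF finite_flat_index x W_grad[OF x] DERIV_cutoff[OF U0]] force_grad[OF x il]]])
  then show "has_grad (flat_index N d) (fieldg \<eta> U p) (fieldM \<eta> U x p) x"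
    by (rule has_grad_cong[OF _ _ _ x]) (auto simp: fieldg_def fieldM_def split: prod.split)
next
  fix x :: "nat \<times> nat \<Rightarrow> real" assume "x \<in> flat_index N d \<rightarrow>\<^sub>E UNIV"
  show "(\<Sum>i\<in>flat_index N d. \<Sum>j\<in>flat_index N d. (fieldM \<eta> U x i j)\<^sup>2) \<le> 1/36"
    using fieldM_sq_le[OF U] small by (rule order_trans)
qed simp

section \<open>Trace identity and growth of the potential\<close>

definition "ksd_sq X = (ksd d V H ip (measure_pmf (empirical N X)))\<^sup>2"

text \<open>Of the four terms of the Stein kernel, those containing the gradient at the first point
  assemble to the inner product of gradient and force, the other two to the trace of
  \<open>Dself\<close>. The identity is exact, so errors enter only through \<open>Dcross\<close>
  and second-order terms.\<close>

lemma ksd_sq_eq: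
  assumes X: "conf X"
  shows "real N * ksd_sq X = (\<Sum>i<N. \<Sum>l<d. gV l (X i) * force X i l) - (\<Sum>i<N. \<Sum>l<d. Dself X i l l)"
proof -
  have "real N * ksd_sq X = 1 / real N * (\<Sum>i<N. \<Sum>j<N. \<Sum>l<d. stein V (X i) (X j) l)"
    unfolding ksd_sq_def using N1 confD[OF X] by (subst ksd_empirical) (auto simp: power2_eq_square)
  also have "\<dots> = 1 / real N * (\<Sum>i<N. \<Sum>l<d. \<Sum>j<N. gV l (X i) * (k (X i) (X j) * gV l (X j) - k2 l (X i) (X j))
    - (k1 l (X i) (X j) * gV l (X j) - k21 l l (X i) (X j)))"
    by (subst sum.swap) (simp add: algebra_simps)
  also have "\<dots> = (\<Sum>i<N. \<Sum>l<d. gV l (X i) * force X i l - Dself X i l l)"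
    unfolding sum_distrib_left[of "1 / real N"] force_def Dself_def sum_subtractf sum_distrib_left
    by (simp add: sum_subtractf sum_distrib_left right_diff_distrib mult_ac)
  finally show ?thesis by (simp add: sum_subtractf)
qed

text \<open>Only self-interactions occur on the diagonal: N terms of weight 1/N, each bounded by the
  hypothesis on the diagonal of the kernel. Hence the bound does not grow with N.\<close>

lemma Dcross_trace_le:
  assumes X: "conf X"
  shows "(\<Sum>i<N. \<Sum>l<d. Dcross X i l i l) \<le> c * real d"
proof -
  have lap: "laplacian d (k z) z = (\<Sum>l<d. k22 l l z z)" for z
    by (simp add: laplacian_def k22_def k2_def[abs_def])
  have "(\<Sum>i<N. \<Sum>l<d. Dcross X i l i l) = (\<Sum>i<N. 1 / real N * ((\<Sum>l<d. k2 l (X i) (X i) * gV l (X i))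
    + k (X i) (X i) * laplacian d V (X i) - laplacian d (k (X i)) (X i)))"
    unfolding Dcross_def lap unfolding laplacian_def hessian_def sum_distrib_left[symmetric] sum_subtractf sum.distrib ..
  also have "\<dots> \<le> (\<Sum>i<N. 1 / real N * (c * real d))"
    by (intro sum_mono mult_left_mono diag confD[OF X]) auto
  also have "\<dots> = c * real d" using Npos by simp
  finally show ?thesis .
qed

lemma step_apply:
  assumes "i < N" "l < d"
  shows "svgd_step d N V k \<eta> X i l = X i l - \<eta> * force X i l"
  using assms by (simp add: svgd_step_def force_def k2_def)

lemma step_conf: "conf (svgd_step d N V k \<eta> X)"
  by (auto simp: svgd_step_def conf_def)

lemma step_potential:
  assumes X: "conf X"
  shows "(\<Sum>i<N. V (svgd_step d N V k \<eta> X i)) \<le> (\<Sum>i<N. V (X i)) - \<eta> * (\<Sum>i<N. \<Sum>l<d. gV l (X i) * force X i l)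
    + C / 2 * \<eta>\<^sup>2 * (\<Sum>i<N. \<Sum>l<d. (force X i l)\<^sup>2)"
proof -
  let ?Y = "svgd_step d N V k \<eta> X"
  have "V (?Y i) \<le> V (X i) + - \<eta> * (\<Sum>l<d. gV l (X i) * force X i l) + C / 2 * \<eta>\<^sup>2 * (\<Sum>l<d. (force X i l)\<^sup>2)" if i: "i < N" for i
  proof -
    have "V (?Y i) \<le> V (X i) + (\<Sum>l<d. gV l (X i) * (?Y i l - X i l)) + C / 2 * (\<Sum>l<d. (?Y i l - X i l)\<^sup>2)"
      by (intro quadratic_upper_bound V_smooth params hess confD[OF X i] confD[OF step_conf i])
    also have "(\<Sum>l<d. gV l (X i) * (?Y i l - X i l)) = - \<eta> * (\<Sum>l<d. gV l (X i) * force X i l)"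
      using i by (simp add: step_apply sum_distrib_left mult.left_commute sum_negf)
    also have "(\<Sum>l<d. (?Y i l - X i l)\<^sup>2) = \<eta>\<^sup>2 * (\<Sum>l<d. (force X i l)\<^sup>2)"
      using i by (simp add: step_apply sum_distrib_left power_mult_distrib)
    finally show ?thesis by simp
  qed
  then have "(\<Sum>i<N. V (?Y i)) \<le> (\<Sum>i<N. V (X i) + - \<eta> * (\<Sum>l<d. gV l (X i) * force X i l) + C / 2 * \<eta>\<^sup>2 * (\<Sum>l<d. (force X i l)\<^sup>2))"
    by (intro sum_mono) auto
  also have "\<dots> = (\<Sum>i<N. V (X i)) + - \<eta> * (\<Sum>i<N. \<Sum>l<d. gV l (X i) * force X i l) + C / 2 * \<eta>\<^sup>2 * (\<Sum>i<N. \<Sum>l<d. (force X i l)\<^sup>2)"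
    unfolding sum.distrib sum_distrib_left ..
  finally show ?thesis by simp
qed

text \<open>Positive definiteness is defined over sets of points, but particles may coincide. The
  form is the squared RKHS norm of a combination of sections, for which coincidences do not
  matter.\<close>

lemma kernel_psd:
  assumes X: "conf X"
  shows "0 \<le> (\<Sum>i<N. \<Sum>j<N. a i * k (X i) (X j) * a j)"
proof -
  obtain \<xi> where \<xi>: "\<xi> \<in> H" "\<And>\<phi>. \<phi> \<in> H \<Longrightarrow> ip \<phi> \<xi> = (\<Sum>j<N. a j * ip \<phi> (sect (X j)))"
    using sum_representer[of N "\<lambda>j. sect (X j)" a] sections_mem confD[OF X] by auto
  have ev: "ip \<phi> \<xi> = (\<Sum>j<N. a j * \<phi> (X j))" if "\<phi> \<in> H" for \<phi>
    unfolding \<xi>(2)[OF that] using that confD[OF X] by (intro sum.cong) (auto simp: ip_sect)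
  have "\<xi> (X i) = (\<Sum>j<N. a j * k (X i) (X j))" if i: "i < N" for i
  proof -
    have "\<xi> (X i) = ip (sect (X i)) \<xi>"
      using ip_sect[OF \<xi>(1) confD[OF X i]] ip_sym[OF \<xi>(1) sections_mem[OF confD[OF X i]]] by simp
    also have "\<dots> = (\<Sum>j<N. a j * sect (X i) (X j))" by (rule ev[OF sections_mem[OF confD[OF X i]]])
    also have "\<dots> = (\<Sum>j<N. a j * k (X i) (X j))" using confD[OF X] by (intro sum.cong) auto
    finally show ?thesis .
  qed
  then have "ip \<xi> \<xi> = (\<Sum>i<N. \<Sum>j<N. a i * k (X i) (X j) * a j)"
    unfolding ev[OF \<xi>(1)] by (intro sum.cong refl) (simp add: sum_distrib_left mult_ac)
  then show ?thesis using ip_nonneg[OF \<xi>(1)] by simp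
qed

text \<open>The kernel part of the drift is a nonnegative quadratic form, so at first order the
  potential can rise only through the derivative of the kernel. There sqrt(d) comes from comparing
  the l1 and l2 norms of the gradient.\<close>

lemma drift_lower:
  assumes X: "conf X"
  shows "- (\<Sum>i<N. \<Sum>l<d. gV l (X i) * force X i l) \<le> real N * (B * sqrt (real d) * A * W X powr \<alpha>)"
proof -
  have "(\<Sum>i<N. \<Sum>l<d. gV l (X i) * force X i l)
    = (\<Sum>i<N. \<Sum>l<d. 1 / real N * (\<Sum>j<N. gV l (X i) * k (X i) (X j) * gV l (X j) - gV l (X i) * k2 l (X i) (X j)))"
    unfolding force_def by (intro sum.cong refl) (simp add: sum_distrib_left right_diff_distrib mult_ac)
  also have "\<dots> = 1 / real N * (\<Sum>i<N. \<Sum>l<d. \<Sum>j<N. gV l (X i) * k (X i) (X j) * gV l (X j))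
    - 1 / real N * (\<Sum>i<N. \<Sum>l<d. \<Sum>j<N. gV l (X i) * k2 l (X i) (X j))"
    unfolding sum_distrib_left[symmetric] sum_subtractf right_diff_distrib ..
  also have "(\<Sum>i<N. \<Sum>l<d. \<Sum>j<N. gV l (X i) * k (X i) (X j) * gV l (X j)) = (\<Sum>l<d. \<Sum>i<N. \<Sum>j<N. gV l (X i) * k (X i) (X j) * gV l (X j))"
    by (rule sum.swap)
  finally have eq: "(\<Sum>i<N. \<Sum>l<d. gV l (X i) * force X i l) = 1 / real N * (\<Sum>l<d. \<Sum>i<N. \<Sum>j<N. gV l (X i) * k (X i) (X j) * gV l (X j))
    - 1 / real N * (\<Sum>i<N. \<Sum>l<d. \<Sum>j<N. gV l (X i) * k2 l (X i) (X j))" .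
  have "0 \<le> 1 / real N * (\<Sum>l<d. \<Sum>i<N. \<Sum>j<N. gV l (X i) * k (X i) (X j) * gV l (X j))"
    by (intro mult_nonneg_nonneg sum_nonneg kernel_psd X) auto
  then have "- (\<Sum>i<N. \<Sum>l<d. gV l (X i) * force X i l) \<le> 1 / real N * (\<Sum>i<N. \<Sum>l<d. \<Sum>j<N. gV l (X i) * k2 l (X i) (X j))"
    unfolding eq by simp
  also have "\<dots> \<le> 1 / real N * (\<Sum>i<N. real N * (B * sqrt (real d) * (A * V (X i) powr \<alpha>)))"
  proof (intro mult_left_mono sum_mono)
    fix i assume "i \<in> {..<N}"
    then have i: "i < N" by simp
    have "(\<Sum>l<d. \<Sum>j<N. gV l (X i) * k2 l (X i) (X j)) \<le> (\<Sum>l<d. \<Sum>j<N. \<bar>gV l (X i)\<bar> * B)"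
    proof (intro sum_mono)
      fix l j assume "l \<in> {..<d}" "j \<in> {..<N}"
      then have "\<bar>k2 l (X i) (X j)\<bar> \<le> B" using confD[OF X] i by (intro k2_bd) auto
      then have "\<bar>gV l (X i)\<bar> * \<bar>k2 l (X i) (X j)\<bar> \<le> \<bar>gV l (X i)\<bar> * B" by (rule mult_left_mono) simp
      then show "gV l (X i) * k2 l (X i) (X j) \<le> \<bar>gV l (X i)\<bar> * B"
        using abs_ge_self[of "gV l (X i) * k2 l (X i) (X j)"] by (simp add: abs_mult)
    qed
    also have "\<dots> = real N * (B * (\<Sum>l<d. \<bar>gV l (X i)\<bar> * \<bar>1\<bar>))" by (simp add: sum_distrib_left mult_ac)
    also have "\<dots> \<le> real N * (B * (L2_set (\<lambda>l. gV l (X i)) {..<d} * L2_set (\<lambda>l. 1) {..<d}))"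
      using params by (intro mult_left_mono L2_set_mult_ineq) auto
    also have "L2_set (\<lambda>l. 1::real) {..<d} = sqrt (real d)" by (simp add: L2_set_def)
    also have "real N * (B * (L2_set (\<lambda>l. gV l (X i)) {..<d} * sqrt (real d))) \<le> real N * (B * ((A * V (X i) powr \<alpha>) * sqrt (real d)))"
      using params by (intro mult_left_mono mult_right_mono V_growth confD[OF X i]) auto
    finally show "(\<Sum>l<d. \<Sum>j<N. gV l (X i) * k2 l (X i) (X j)) \<le> real N * (B * sqrt (real d) * (A * V (X i) powr \<alpha>))"
      by (simp add: mult_ac)
  qed simp
  also have "\<dots> = real N * (B * sqrt (real d) * A * (1 / real N * (\<Sum>i<N. V (X i) powr \<alpha>)))"
    by (simp add: sum_distrib_left mult_ac)
  also have "\<dots> \<le> real N * (B * sqrt (real d) * A * W X powr \<alpha>)"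
    unfolding W_def using N1 params by (intro mult_left_mono powr_average_le) (auto intro!: V_pos confD[OF X])
  finally show ?thesis .
qed

lemma W_step_le:
  assumes X: "conf X" and \<eta>: "\<eta> \<ge> 0"
  shows "W (svgd_step d N V k \<eta> X) \<le> W X + \<eta> * (B * sqrt (real d) * A * W X powr \<alpha>)
    + C * \<eta>\<^sup>2 * B\<^sup>2 * (A\<^sup>2 * W X powr (2*\<alpha>) + real d)"
proof -
  have "(\<Sum>i<N. V (svgd_step d N V k \<eta> X i)) \<le> (\<Sum>i<N. V (X i)) + \<eta> * (- (\<Sum>i<N. \<Sum>l<d. gV l (X i) * force X i l))
    + C / 2 * \<eta>\<^sup>2 * (\<Sum>i<N. \<Sum>l<d. (force X i l)\<^sup>2)"
    using step_potential[OF X] by simp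
  also have "\<dots> \<le> (\<Sum>i<N. V (X i)) + \<eta> * (real N * (B * sqrt (real d) * A * W X powr \<alpha>))
    + C / 2 * \<eta>\<^sup>2 * (2 * real N * B\<^sup>2 * (grad_sq X + real d))"
    using \<eta> params by (intro add_mono mult_left_mono drift_lower force_sq_le X) auto
  also have "\<dots> \<le> (\<Sum>i<N. V (X i)) + \<eta> * (real N * (B * sqrt (real d) * A * W X powr \<alpha>))
    + C / 2 * \<eta>\<^sup>2 * (2 * real N * B\<^sup>2 * (A\<^sup>2 * W X powr (2*\<alpha>) + real d))"
    using \<eta> params by (intro add_mono mult_left_mono grad_sq_le X) auto
  also have "\<dots> = real N * (W X + \<eta> * (B * sqrt (real d) * A * W X powr \<alpha>) + C * \<eta>\<^sup>2 * B\<^sup>2 * (A\<^sup>2 * W X powr (2*\<alpha>) + real d))"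
    using Npos by (simp add: W_def algebra_simps)
  finally show ?thesis using Npos unfolding W_def[of "svgd_step d N V k \<eta> X"] by (simp add: pos_divide_le_eq mult.commute)
qed

text \<open>The term with \<open>\<kappa>\<close> pays for the quadratic correction in the
  log-Jacobian, the other for the second-order term of the descent lemma.\<close>

definition "\<kappa>2 = 2 * \<kappa> + C * B\<^sup>2 * (2 * A\<^sup>2 + C\<^sup>2 + 1)"

text \<open>The first-order part of the log-Jacobian and of the increment of the potential combine to
  the squared discrepancy, up to the diagonal terms of the divergence.\<close>

lemma log_jacobian_lower:
  assumes U: "U \<ge> 1" and W: "W (unflatten N d x) \<le> U" and \<eta>: "\<eta> \<ge> 0"
  shows "\<eta> * real N * ksd_sq (unflatten N d x) - \<eta> * c * real d - \<eta>\<^sup>2 * (real N * (real d * (U powr (2*\<alpha>) + real d))) * \<kappa>2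
    + (\<Sum>i<N. V (svgd_step d N V k \<eta> (unflatten N d x) i)) - (\<Sum>i<N. V (unflatten N d x i))
    \<le> (\<Sum>p\<in>flat_index N d. fieldM \<eta> U x p p) - 2 * (\<Sum>p\<in>flat_index N d. \<Sum>q\<in>flat_index N d. (fieldM \<eta> U x p q)\<^sup>2)"
proof -
  let ?X = "unflatten N d x" let ?R = "U powr (2*\<alpha>) + real d" let ?Q = "2 * A\<^sup>2 + C\<^sup>2 + 1"
  have X: "conf ?X" by (rule conf_unflatten)
  have cut: "cutoff U (W ?X) = 1 \<and> cutoff' U (W ?X) = 0" using U W by (intro cutoff_below) auto
  have tr: "(\<Sum>p\<in>flat_index N d. fieldM \<eta> U x p p) = - \<eta> * (\<Sum>i<N. \<Sum>l<d. Dself ?X i l l) - \<eta> * (\<Sum>i<N. \<Sum>l<d. Dcross ?X i l i l)"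
    unfolding sum_flat_index by (simp add: fieldM_def cut Dforce_def sum.distrib sum_distrib_left sum_negf algebra_simps sum_subtractf)
  have "\<eta> * (\<Sum>i<N. \<Sum>l<d. Dcross ?X i l i l) \<le> \<eta> * (c * real d)"
    by (intro mult_left_mono Dcross_trace_le X \<eta>)
  moreover have "\<eta> * real N * ksd_sq ?X = \<eta> * (\<Sum>i<N. \<Sum>l<d. gV l (?X i) * force ?X i l) - \<eta> * (\<Sum>i<N. \<Sum>l<d. Dself ?X i l l)"
    using ksd_sq_eq[OF X] by (simp add: mult.assoc right_diff_distrib)
  moreover note step_potential[OF X, of \<eta>]
  moreover have "C / 2 * \<eta>\<^sup>2 * (\<Sum>i<N. \<Sum>l<d. (force ?X i l)\<^sup>2) \<le> \<eta>\<^sup>2 * (real N * (real d * ?R)) * (C * B\<^sup>2 * ?Q)"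
  proof -
    have R: "?R \<ge> 0" by simp
    have "C / 2 * \<eta>\<^sup>2 * (\<Sum>i<N. \<Sum>l<d. (force ?X i l)\<^sup>2) \<le> C / 2 * \<eta>\<^sup>2 * (2 * real N * B\<^sup>2 * size_bd ?X)"
      using params by (intro mult_left_mono force_sq_le' X) auto
    also have "\<dots> \<le> C / 2 * \<eta>\<^sup>2 * (2 * real N * B\<^sup>2 * (?Q * ?R))"
      using params U W W_pos[OF X] by (intro mult_left_mono size_bd_le X) auto
    also have "\<dots> = \<eta>\<^sup>2 * (real N * (1 * ?R)) * (C * B\<^sup>2 * ?Q)" by simp
    also have "\<dots> \<le> \<eta>\<^sup>2 * (real N * (real d * ?R)) * (C * B\<^sup>2 * ?Q)"
      using params dpos R by (intro mult_right_mono mult_left_mono) auto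
    finally show ?thesis .
  qed
  moreover have "2 * (\<Sum>p\<in>flat_index N d. \<Sum>q\<in>flat_index N d. (fieldM \<eta> U x p q)\<^sup>2) \<le> \<eta>\<^sup>2 * (real N * (real d * ?R)) * (2 * \<kappa>)"
    using fieldM_sq_le[OF U, of \<eta> x] by simp
  ultimately show ?thesis unfolding tr \<kappa>2_def by (simp add: distrib_left mult.assoc)
qed

end

section \<open>Measurability\<close>

lemma sigma_finite_leb: "sigma_finite_measure (leb d)"
proof -
  interpret product_sigma_finite "\<lambda>_::nat. lborel :: real measure" by standard
  show ?thesis unfolding leb_def by (rule sigma_finite) simp
qed

lemma sigma_finite_lebN: "sigma_finite_measure (lebN N d)"
proof -
  interpret product_sigma_finite "\<lambda>_::nat. leb d"
    by (simp add: product_sigma_finite_def sigma_finite_leb)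
  show ?thesis unfolding lebN_def by (rule sigma_finite) simp
qed

lemma sets_leb: "sets (leb d) = sets (PiM {..<d} (\<lambda>_. borel))"
  unfolding leb_def by (intro sets_PiM_cong) auto

lemma measurable_leb: "borel_measurable (leb d) = borel_measurable (PiM {..<d} (\<lambda>_. borel))"
  by (intro measurable_cong_sets sets_leb) simp

lemma measurable_differentiable:
  assumes "differentiable_Rd d f"
  shows "f \<in> borel_measurable (leb d)"
  unfolding measurable_leb
  by (rule borel_measurable_cont) (simp, rule has_grad_cont[OF _ _ has_grad_partial[OF assms]], auto)

lemma measurable_partial:
  assumes "differentiable_Rd d f" "l < d"
  shows "partial l f \<in> borel_measurable (leb d)"
  unfolding measurable_leb
proof (rule borel_measurable_coord_deriv)
  show "f \<in> borel_measurable (PiM {..<d} (\<lambda>_. borel))"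
    using measurable_differentiable[OF assms(1)] unfolding measurable_leb .
  show "((\<lambda>t. f (x(l := t))) has_real_derivative partial l f x) (at (x l))" if "x \<in> Rd d" for x
    using has_grad_coord[OF _ that has_grad_partial[OF assms(1) that], of l] assms(2) by simp
qed (use assms in simp)

lemma measurable_particle: "i < N \<Longrightarrow> (\<lambda>X. X i) \<in> measurable (lebN N d) (leb d)"
  unfolding lebN_def by (rule measurable_component_singleton) simp

lemma measurable_coord: "i < N \<Longrightarrow> l < d \<Longrightarrow> (\<lambda>X. X i l) \<in> borel_measurable (lebN N d)"
proof -
  assume i: "i < N" and l: "l < d"
  have "(\<lambda>x. x l) \<in> measurable (leb d) lborel"
    unfolding leb_def by (rule measurable_component_singleton) (use l in simp)
  from measurable_compose[OF measurable_particle[OF i] this] show ?thesis by simp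
qed

lemma measurable_into_lebN:
  assumes "\<And>i l. i < N \<Longrightarrow> l < d \<Longrightarrow> (\<lambda>x. f x i l) \<in> borel_measurable M"
  shows "(\<lambda>x. \<lambda>i\<in>{..<N}. \<lambda>l\<in>{..<d}. f x i l) \<in> measurable M (lebN N d)"
  unfolding lebN_def leb_def by (intro measurable_restrict) (use assms in simp)

lemma measurable_cat:
  assumes i: "i < N" and j: "j < N"
  shows "(\<lambda>X. cat d (X i) (X j)) \<in> measurable (lebN N d) (leb (2*d))"
  unfolding leb_def cat_def
proof (rule measurable_restrict)
  fix a assume a: "a \<in> {..<2*d}"
  have "(\<lambda>X. if a < d then X i a else X j (a - d)) \<in> borel_measurable (lebN N d)"
    using a i j measurable_coord[of i N a d] measurable_coord[of j N "a - d" d] by (cases "a < d") auto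
  then show "(\<lambda>X. if a < d then X i a else X j (a - d)) \<in> measurable (lebN N d) lborel" by simp
qed

section \<open>Flattening configurations\<close>

definition flatten :: "nat \<Rightarrow> nat \<Rightarrow> config \<Rightarrow> nat \<times> nat \<Rightarrow> real" where
  "flatten N d X = (\<lambda>(i, l)\<in>flat_index N d. X i l)"

lemma measurable_flatten: "flatten N d \<in> measurable (lebN N d) (PiM (flat_index N d) (\<lambda>_. lborel))"
  unfolding flatten_def
  by (rule measurable_restrict) (auto simp: flat_index_def intro: measurable_coord)

lemma measurable_unflatten: "unflatten N d \<in> measurable (PiM (flat_index N d) (\<lambda>_. lborel)) (lebN N d)"
  unfolding unflatten_def[abs_def]
proof (rule measurable_into_lebN)
  fix i l assume "i < N" "l < d"
  then have "(\<lambda>x. x (i, l)) \<in> measurable (PiM (flat_index N d) (\<lambda>_. lborel)) lborel"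
    by (intro measurable_component_singleton) (simp add: flat_index_def)
  then show "(\<lambda>x. x (i, l)) \<in> borel_measurable (PiM (flat_index N d) (\<lambda>_. lborel))" by simp
qed

lemma unflatten_flatten: "X \<in> space (lebN N d) \<Longrightarrow> unflatten N d (flatten N d X) = X"
proof -
  assume "X \<in> space (lebN N d)"
  then have X: "X \<in> {..<N} \<rightarrow>\<^sub>E Rd d" by (simp add: space_lebN)
  show ?thesis
  proof (rule ext)
    fix i
    show "unflatten N d (flatten N d X) i = X i"
    proof (cases "i < N")
      case True
      then have Xi: "X i \<in> Rd d" using X by auto
      show ?thesis
        by (rule coords_eqI[OF unflatten_in[OF True] Xi]) (use True in \<open>simp add: unflatten_def flatten_def flat_index_def\<close>)
    next
      case False
      then show ?thesis using X by (simp add: unflatten_def PiE_def extensional_def)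
    qed
  qed
qed

text \<open>Boxes determine a product measure, and under \<open>flatten\<close> the preimage of a
  flat box is an iterated box.\<close>

lemma PiM_flat_index: "PiM (flat_index N d) (\<lambda>_. lborel) = distr (lebN N d) (PiM (flat_index N d) (\<lambda>_. lborel)) (flatten N d)"
proof -
  interpret L: product_sigma_finite "\<lambda>_::nat \<times> nat. lborel :: real measure" by standard
  interpret L1: product_sigma_finite "\<lambda>_::nat. lborel :: real measure" by standard
  interpret LN: product_sigma_finite "\<lambda>_::nat. leb d"
    by (simp add: product_sigma_finite_def sigma_finite_leb)
  show ?thesis
  proof (rule L.PiM_eqI[symmetric])
    fix S :: "nat \<times> nat \<Rightarrow> real set" assume S: "\<And>p. p \<in> flat_index N d \<Longrightarrow> S p \<in> sets lborel"
    have S': "S (i, l) \<in> sets lborel" if "i < N" "l < d" for i l using that by (intro S) (simp add: flat_index_def)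
    have box: "PiE {..<d} (\<lambda>l. S (i, l)) \<in> sets (leb d)" if "i < N" for i
      unfolding leb_def by (rule sets_PiM_I_finite) (use that S' in auto)
    have "flatten N d -` PiE (flat_index N d) S \<inter> space (lebN N d) = PiE {..<N} (\<lambda>i. PiE {..<d} (\<lambda>l. S (i, l)))"
    proof -
      have "flatten N d X \<in> PiE (flat_index N d) S \<longleftrightarrow> (\<forall>i<N. \<forall>l<d. X i l \<in> S (i, l))" for X
        by (auto simp: flatten_def flat_index_def PiE_iff)
      then show ?thesis by (auto simp: space_lebN PiE_iff)
    qed
    then have "emeasure (distr (lebN N d) (PiM (flat_index N d) (\<lambda>_. lborel)) (flatten N d)) (PiE (flat_index N d) S)
      = emeasure (lebN N d) (PiE {..<N} (\<lambda>i. PiE {..<d} (\<lambda>l. S (i, l))))"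
      by (subst emeasure_distr[OF measurable_flatten]) (auto intro!: sets_PiM_I_finite S)
    also have "\<dots> = (\<Prod>i<N. emeasure (leb d) (PiE {..<d} (\<lambda>l. S (i, l))))"
      unfolding lebN_def by (rule LN.emeasure_PiM) (use box in auto)
    also have "\<dots> = (\<Prod>i<N. \<Prod>l<d. emeasure lborel (S (i, l)))"
      unfolding leb_def by (intro prod.cong refl L1.emeasure_PiM) (use S' in auto)
    also have "\<dots> = (\<Prod>p\<in>flat_index N d. emeasure lborel (S p))"
      unfolding flat_index_def by (simp add: prod.cartesian_product)
    finally show "emeasure (distr (lebN N d) (PiM (flat_index N d) (\<lambda>_. lborel)) (flatten N d)) (PiE (flat_index N d) S)
      = (\<Prod>p\<in>flat_index N d. emeasure lborel (S p))" .
  qed simp_all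
qed

lemma nn_integral_flat:
  assumes F: "F \<in> borel_measurable (lebN N d)"
  shows "(\<integral>\<^sup>+X. F X \<partial>lebN N d) = (\<integral>\<^sup>+x. F (unflatten N d x) \<partial>PiM (flat_index N d) (\<lambda>_. lborel))"
proof -
  have "(\<integral>\<^sup>+x. F (unflatten N d x) \<partial>PiM (flat_index N d) (\<lambda>_. lborel))
    = (\<integral>\<^sup>+x. F (unflatten N d x) \<partial>distr (lebN N d) (PiM (flat_index N d) (\<lambda>_. lborel)) (flatten N d))"
    using PiM_flat_index by simp
  also have "\<dots> = (\<integral>\<^sup>+X. F (unflatten N d (flatten N d X)) \<partial>lebN N d)"
    using measurable_compose[OF measurable_unflatten F] by (intro nn_integral_distr[OF measurable_flatten]) simp
  also have "\<dots> = (\<integral>\<^sup>+X. F X \<partial>lebN N d)"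
    by (intro nn_integral_cong) (simp add: unflatten_flatten)
  finally show ?thesis by simp
qed

section \<open>Relative entropy\<close>

lemma target_prod_eq: "target_prod d N V X = exp (- (\<Sum>i<N. V (X i))) / (\<integral>z. exp (- V z) \<partial>leb d) ^ N"
  unfolding target_prod_def target_def by (simp add: prod_dividef exp_sum[symmetric] sum_negf[symmetric])

text \<open>The entropy density is defined by a Radon-Nikodym derivative, determined almost
  everywhere. Uniqueness identifies it with ln (p/q), and both integrability and the bound then pass
  to the base measure.\<close>

lemma KL_le_integral:
  fixes p q :: "'a \<Rightarrow> real"
  assumes M: "sigma_finite_measure M"
    and p: "p \<in> borel_measurable M" "\<And>x. x \<in> space M \<Longrightarrow> 0 \<le> p x"
    and q: "q \<in> borel_measurable M" "\<And>x. x \<in> space M \<Longrightarrow> 0 < q x"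
    and KL: "KL_le M p q K"
  shows "integrable M (\<lambda>x. p x * ln (p x / q x))" "(\<integral>x. p x * ln (p x / q x) \<partial>M) \<le> K"
proof -
  interpret sigma_finite_measure M by (rule M)
  note [measurable] = p(1) q(1)
  have pAE: "AE x in M. 0 \<le> p x" by (rule AE_I2[OF p(2)])
  have qAE: "AE x in M. 0 \<le> q x" by (rule AE_I2[OF less_imp_le[OF q(2)]])
  have ac: "AE x in M. q x = 0 \<longrightarrow> p x = 0"
  proof (rule AE_I2)
    fix x assume "x \<in> space M"
    from q(2)[OF this] show "q x = 0 \<longrightarrow> p x = 0" by simp
  qed
  have lg: "log (exp 1) x = ln x" for x :: real by (simp add: log_def)
  interpret Mq: sigma_finite_measure "density M q"
    using qAE by (subst sigma_finite_iff_density_finite) auto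
  have dd: "density M p = density (density M q) (\<lambda>x. p x / q x)"
    using qAE pAE ac by (subst density_density_divide) simp_all
  have "density (density M q) (RN_deriv (density M q) (density (density M q) (\<lambda>x. p x / q x))) = density (density M q) (\<lambda>x. p x / q x)"
    by (intro density_RN_deriv_density) auto
  then have "AE x in density M q. RN_deriv (density M q) (density M p) x = p x / q x"
    unfolding dd by (intro Mq.density_unique) auto
  then have "AE x in M. 0 < q x \<longrightarrow> RN_deriv (density M q) (density M p) x = ennreal (p x / q x)"
    by (subst (asm) AE_density) simp_all
  then have ed: "AE x in M. entropy_density (exp 1) (density M q) (density M p) x = ln (p x / q x)"
    using AE_space
  proof eventually_elim
    case (elim x)
    have "0 \<le> p x / q x" using p(2) q(2) elim by (simp add: less_imp_le)
    then show ?case using elim q(2) by (simp add: entropy_density_def lg)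
  qed
  have edm: "entropy_density (exp 1) (density M q) (density M p) \<in> borel_measurable M"
    using measurable_entropy_density[of "exp 1" "density M q" "density M p"] by simp
  have "integrable M (\<lambda>x. p x *\<^sub>R entropy_density (exp 1) (density M q) (density M p) x)"
    using KL edm pAE by (simp add: KL_le_def integrable_density)
  moreover have "AE x in M. p x *\<^sub>R entropy_density (exp 1) (density M q) (density M p) x = p x * ln (p x / q x)"
    using ed by eventually_elim simp
  ultimately show "integrable M (\<lambda>x. p x * ln (p x / q x))"
    using edm by (subst (asm) integrable_cong_AE) auto
  have "KL_divergence (exp 1) (density M q) (density M p) = (\<integral>x. p x * log (exp 1) (p x / q x) \<partial>M)"
    using qAE pAE ac by (intro KL_density_density) auto
  then show "(\<integral>x. p x * ln (p x / q x) \<partial>M) \<le> K" using KL by (simp add: KL_le_def lg)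
qed

text \<open>Pointwise form of Gibbs' variational principle.\<close>

lemma gibbs_pointwise:
  fixes p q e :: real
  assumes "p \<ge> 0" "q > 0"
  shows "p * e \<le> p * ln (p / q) + q * exp e - p"
proof (cases "p = 0")
  case False
  then have p: "p > 0" using assms by simp
  have pos: "q * exp e / p > 0" using p assms by simp
  have "ln (q * exp e / p) = e - ln (p / q)"
    using p assms by (simp add: ln_div ln_mult)
  then have "p * (e - ln (p / q)) \<le> p * (q * exp e / p - 1)"
    using ln_le_minus_one[OF pos] p by (intro mult_left_mono) auto
  also have "\<dots> = q * exp e - p" using p by (simp add: field_simps)
  finally show ?thesis by (simp add: algebra_simps)
qed (use assms in simp)

context svgd_setting
begin

lemma conf_space: "X \<in> space (lebN N d) \<Longrightarrow> conf X"
  by (auto simp: space_lebN conf_def)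

lemma measurable_V_particle: "i < N \<Longrightarrow> (\<lambda>X. V (X i)) \<in> borel_measurable (lebN N d)"
  by (rule measurable_compose[OF measurable_particle measurable_differentiable])
     (use V_smooth in \<open>auto simp: twice_differentiable_Rd_def\<close>)

lemma measurable_gV_particle: "i < N \<Longrightarrow> l < d \<Longrightarrow> (\<lambda>X. gV l (X i)) \<in> borel_measurable (lebN N d)"
  by (rule measurable_compose[OF measurable_particle measurable_partial])
     (use V_smooth in \<open>auto simp: twice_differentiable_Rd_def\<close>)

text \<open>Functions of two particles are measurable as functions on R^(2d) composed with the
  measurable map \<open>cat\<close>.\<close>

lemma measurable_pair:
  assumes f: "f \<in> borel_measurable (leb (2*d))" and ij: "i < N" "j < N"
    and F: "\<And>x y. x \<in> Rd d \<Longrightarrow> y \<in> Rd d \<Longrightarrow> f (cat d x y) = F x y"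
  shows "(\<lambda>X. F (X i) (X j)) \<in> borel_measurable (lebN N d)"
proof -
  have "(\<lambda>X. f (cat d (X i) (X j))) \<in> borel_measurable (lebN N d)"
    by (rule measurable_compose[OF measurable_cat[OF ij] f])
  moreover have "f (cat d (X i) (X j)) = F (X i) (X j)" if "X \<in> space (lebN N d)" for X
    by (intro F confD[OF conf_space[OF that]] ij)
  ultimately show ?thesis by (simp cong: measurable_cong)
qed

lemma joint_diff: "differentiable_Rd (2*d) (joint d k)"
  and joint2_diff: "l < d \<Longrightarrow> differentiable_Rd (2*d) (partial (d + l) (joint d k))"
  using smooth by (simp_all add: twice_differentiable_Rd_def)

lemma measurable_kernel_pair:
  assumes ij: "i < N" "j < N"
  shows "(\<lambda>X. k (X i) (X j)) \<in> borel_measurable (lebN N d)"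
    and "l < d \<Longrightarrow> (\<lambda>X. k1 l (X i) (X j)) \<in> borel_measurable (lebN N d)"
    and "l < d \<Longrightarrow> (\<lambda>X. k2 l (X i) (X j)) \<in> borel_measurable (lebN N d)"
    and "l < d \<Longrightarrow> l' < d \<Longrightarrow> (\<lambda>X. k21 l' l (X i) (X j)) \<in> borel_measurable (lebN N d)"
proof -
  show "(\<lambda>X. k (X i) (X j)) \<in> borel_measurable (lebN N d)"
    by (rule measurable_pair[OF measurable_differentiable[OF joint_diff] ij joint_cat])
  show "(\<lambda>X. k1 l (X i) (X j)) \<in> borel_measurable (lebN N d)" if "l < d"
    by (rule measurable_pair[OF measurable_partial[OF joint_diff] ij k1_cat]) (use that in auto)
  show "(\<lambda>X. k2 l (X i) (X j)) \<in> borel_measurable (lebN N d)" if "l < d"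
    by (rule measurable_pair[OF measurable_partial[OF joint_diff] ij k2_cat]) (use that in auto)
  show "(\<lambda>X. k21 l' l (X i) (X j)) \<in> borel_measurable (lebN N d)" if "l < d" "l' < d"
    by (rule measurable_pair[OF measurable_partial[OF joint2_diff] ij k21_cat]) (use that in auto)
qed

lemma measurable_force:
  assumes "i < N" "l < d"
  shows "(\<lambda>X. force X i l) \<in> borel_measurable (lebN N d)"
  unfolding force_def
  by (intro borel_measurable_times borel_measurable_sum borel_measurable_diff borel_measurable_const
      measurable_kernel_pair measurable_gV_particle) (use assms in auto)

lemma measurable_W: "W \<in> borel_measurable (lebN N d)"
  unfolding W_def[abs_def]
  by (intro borel_measurable_times borel_measurable_sum borel_measurable_const measurable_V_particle) auto

lemma measurable_potential: "(\<lambda>X. \<Sum>i<N. V (X i)) \<in> borel_measurable (lebN N d)"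
  by (intro borel_measurable_sum measurable_V_particle) auto

lemma step_eq: "svgd_step d N V k \<eta> X = (\<lambda>i\<in>{..<N}. \<lambda>l\<in>{..<d}. X i l - \<eta> * force X i l)"
  by (simp add: svgd_step_def force_def k2_def)

lemma measurable_step: "svgd_step d N V k \<eta> \<in> measurable (lebN N d) (lebN N d)"
proof -
  have "(\<lambda>X. \<lambda>i\<in>{..<N}. \<lambda>l\<in>{..<d}. X i l - \<eta> * force X i l) \<in> measurable (lebN N d) (lebN N d)"
    by (intro measurable_into_lebN borel_measurable_diff borel_measurable_times borel_measurable_const
        measurable_coord measurable_force)
  then show ?thesis unfolding step_eq[symmetric] .
qed

lemma measurable_ksd_sq: "ksd_sq \<in> borel_measurable (lebN N d)"
proof -
  have "(\<lambda>X. 1 / (real N)\<^sup>2 * (\<Sum>i<N. \<Sum>j<N. \<Sum>l<d. stein V (X i) (X j) l)) \<in> borel_measurable (lebN N d)"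
    by (intro borel_measurable_times borel_measurable_sum borel_measurable_diff borel_measurable_add borel_measurable_const
      measurable_kernel_pair measurable_gV_particle) auto
  moreover have "ksd_sq X = 1 / (real N)\<^sup>2 * (\<Sum>i<N. \<Sum>j<N. \<Sum>l<d. stein V (X i) (X j) l)" if "X \<in> space (lebN N d)" for X
    unfolding ksd_sq_def using N1 confD[OF conf_space[OF that]] by (intro ksd_empirical) auto
  ultimately show ?thesis by (simp cong: measurable_cong)
qed

section \<open>Exponential moments along trajectories\<close>

definition loss :: "real \<Rightarrow> real \<Rightarrow> real" where
  "loss \<eta> U = \<eta> * c * real d + \<eta>\<^sup>2 * (real N * (real d * (U powr (2*\<alpha>) + real d))) * \<kappa>2"

text \<open>A guaranteed increase, in one step, of the log density of the pulled back target over
  that of the target, valid while the mean potential is at most \<open>U\<close>.\<close>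

definition gain :: "real \<Rightarrow> real \<Rightarrow> config \<Rightarrow> real" where
  "gain \<eta> U X = \<eta> * real N * ksd_sq X - loss \<eta> U"

abbreviation "potential X \<equiv> (\<Sum>i<N. V (X i))"

text \<open>The indicator confines the estimate to the region where the cut-off map is a true SVGD
  step, while the change of variables uses the globally defined map. The arbitrary \<open>h\<close>
  is what makes the estimate iterable.\<close>

lemma one_step:
  assumes U: "U \<ge> 1" and \<eta>: "\<eta> \<ge> 0"
    and small: "\<eta>\<^sup>2 * (real N * (real d * (U powr (2*\<alpha>) + real d))) * \<kappa> \<le> 1/36"
    and h: "h \<in> borel_measurable (lebN N d)"
  shows "(\<integral>\<^sup>+X. ennreal (exp (- potential X)) * (ennreal (exp (gain \<eta> U X)) * indicator {X. W X \<le> U} X * h (svgd_step d N V k \<eta> X)) \<partial>lebN N d)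
    \<le> (\<integral>\<^sup>+X. ennreal (exp (- potential X)) * h X \<partial>lebN N d)"
proof -
  interpret P: perturbation "flat_index N d" "fieldg \<eta> U" "fieldM \<eta> U"
    by (rule perturbation_field[OF U small])
  let ?I = "flat_index N d"
  note [measurable] = h measurable_W measurable_potential measurable_ksd_sq measurable_step
  define F where "F X = ennreal (exp (- potential X)) * (ennreal (exp (gain \<eta> U X)) * indicator {X. W X \<le> U} X * h (svgd_step d N V k \<eta> X))" for X
  define \<phi> where "\<phi> X = ennreal (exp (- potential X)) * h X" for X
  have Fm: "F \<in> borel_measurable (lebN N d)" unfolding F_def gain_def by measurable
  have \<phi>m: "\<phi> \<in> borel_measurable (lebN N d)" unfolding \<phi>_def by measurable
  have \<phi>u: "(\<lambda>x. \<phi> (unflatten N d x)) \<in> borel_measurable (PiM ?I (\<lambda>_. borel))"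
    using measurable_compose[OF measurable_unflatten \<phi>m] unfolding P.measurable_lborel_PiM .
  have "(\<integral>\<^sup>+X. F X \<partial>lebN N d) = (\<integral>\<^sup>+x. F (unflatten N d x) \<partial>PiM ?I (\<lambda>_. lborel))"
    by (rule nn_integral_flat[OF Fm])
  also have "\<dots> \<le> (\<integral>\<^sup>+x. \<phi> (unflatten N d (P.shift ?I x)) * ennreal (P.jac ?I x) \<partial>PiM ?I (\<lambda>_. lborel))"
  proof (rule nn_integral_mono)
    fix x
    let ?X = "unflatten N d x"
    show "F ?X \<le> \<phi> (unflatten N d (P.shift ?I x)) * ennreal (P.jac ?I x)"
    proof (cases "W ?X \<le> U")
      case False
      then show ?thesis by (simp add: F_def)
    next
      case True
      have "cutoff U (W ?X) = 1" using cutoff_below[of U "W ?X"] U True by simp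
      then have "P.shift ?I x (i, l) = ?X i l - \<eta> * force ?X i l" if "i < N" "l < d" for i l
        unfolding P.shift_def using that by (simp add: fieldg_def flat_index_def) (simp add: unflatten_def)
      then have "unflatten N d (P.shift ?I x) = (\<lambda>i\<in>{..<N}. \<lambda>l\<in>{..<d}. ?X i l - \<eta> * force ?X i l)"
        unfolding unflatten_def[of _ _ "P.shift ?I x"] by (intro restrict_ext) simp
      then have sh: "unflatten N d (P.shift ?I x) = svgd_step d N V k \<eta> ?X"
        by (simp only: step_eq)
      let ?Y = "svgd_step d N V k \<eta> ?X"
      have "- potential ?X + gain \<eta> U ?X \<le> - potential ?Y + ((\<Sum>p\<in>?I. fieldM \<eta> U x p p) - 2 * (\<Sum>p\<in>?I. \<Sum>q\<in>?I. (fieldM \<eta> U x p q)\<^sup>2))"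
        using log_jacobian_lower[OF U True \<eta>] by (simp add: gain_def loss_def)
      then have "exp (- potential ?X) * exp (gain \<eta> U ?X) \<le> exp (- potential ?Y) * P.jac ?I x"
        unfolding P.jac_def exp_add[symmetric] by simp
      then have "ennreal (exp (- potential ?X)) * ennreal (exp (gain \<eta> U ?X)) \<le> ennreal (exp (- potential ?Y)) * ennreal (P.jac ?I x)"
        by (simp add: ennreal_mult[symmetric] ennreal_leI P.jac_def)
      then have "ennreal (exp (- potential ?X)) * ennreal (exp (gain \<eta> U ?X)) * h ?Y \<le> ennreal (exp (- potential ?Y)) * ennreal (P.jac ?I x) * h ?Y"
        by (rule mult_right_mono) simp
      then show ?thesis using True by (simp add: F_def \<phi>_def sh mult_ac)
    qed
  qed
  also have "\<dots> \<le> (\<integral>\<^sup>+x. \<phi> (unflatten N d x) \<partial>PiM ?I (\<lambda>_. lborel))"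
    by (rule P.nn_integral_shift_le[OF order_refl \<phi>u])
  also have "\<dots> = (\<integral>\<^sup>+X. \<phi> X \<partial>lebN N d)" by (rule nn_integral_flat[OF \<phi>m, symmetric])
  finally show ?thesis unfolding F_def \<phi>_def .
qed

text \<open>The accumulated exponential gain, set to 0 once the trajectory exceeds level
  \<open>U\<close>. Thanks to this killing, \<open>weight_integral\<close> holds from every starting
  configuration; confinement is used only to evaluate the weight.\<close>

primrec weight :: "real \<Rightarrow> real \<Rightarrow> nat \<Rightarrow> config \<Rightarrow> ennreal" where
  "weight \<eta> U 0 X = 1"
| "weight \<eta> U (Suc n) X = ennreal (exp (gain \<eta> U X)) * indicator {X. W X \<le> U} X * weight \<eta> U n (svgd_step d N V k \<eta> X)"

lemma measurable_weight: "weight \<eta> U n \<in> borel_measurable (lebN N d)"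
proof (induction n)
  case 0
  have "weight \<eta> U 0 = (\<lambda>_. 1)" by (rule ext) simp
  then show ?case by simp
next
  case (Suc n)
  note [measurable] = Suc measurable_W measurable_ksd_sq measurable_step
  have "weight \<eta> U (Suc n) = (\<lambda>X. ennreal (exp (gain \<eta> U X)) * indicator {X. W X \<le> U} X * weight \<eta> U n (svgd_step d N V k \<eta> X))"
    by (rule ext) simp
  then show ?case unfolding gain_def by simp
qed

lemma weight_integral:
  assumes U: "U \<ge> 1" and \<eta>: "\<eta> \<ge> 0"
    and small: "\<eta>\<^sup>2 * (real N * (real d * (U powr (2*\<alpha>) + real d))) * \<kappa> \<le> 1/36"
  shows "(\<integral>\<^sup>+X. ennreal (exp (- potential X)) * weight \<eta> U n X \<partial>lebN N d) \<le> (\<integral>\<^sup>+X. ennreal (exp (- potential X)) \<partial>lebN N d)"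
proof (induction n)
  case (Suc n)
  show ?case using one_step[OF assms measurable_weight[of \<eta> U n]] Suc by (simp add: order_trans)
qed simp

lemma svgd_Suc: "svgd d N V k \<eta> X (Suc n) = svgd d N V k \<eta> (svgd_step d N V k \<eta> X) n"
  by (simp only: svgd_def funpow_Suc_right comp_apply)

lemma weight_eq:
  assumes "\<And>m. m < n \<Longrightarrow> W (svgd d N V k \<eta> X m) \<le> U"
  shows "weight \<eta> U n X = ennreal (exp (\<Sum>m<n. gain \<eta> U (svgd d N V k \<eta> X m)))"
  using assms
proof (induction n arbitrary: X)
  case (Suc n)
  have "W (svgd d N V k \<eta> (svgd_step d N V k \<eta> X) m) \<le> U" if "m < n" for m
    using Suc.prems[of "Suc m"] that by (simp only: svgd_Suc)
  from Suc.IH[OF this]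
  have "weight \<eta> U n (svgd_step d N V k \<eta> X) = ennreal (exp (\<Sum>m<n. gain \<eta> U (svgd d N V k \<eta> X (Suc m))))"
    by (simp only: svgd_Suc)
  moreover have "W X \<le> U" using Suc.prems[of 0] by (simp add: svgd_def)
  ultimately show ?case
    by (simp del: sum.lessThan_Suc add: sum.lessThan_Suc_shift exp_add ennreal_mult svgd_def[of _ _ _ _ _ _ 0])
qed simp

lemma measurable_svgd: "(\<lambda>X. svgd d N V k \<eta> X n) \<in> measurable (lebN N d) (lebN N d)"
proof (induction n)
  case (Suc n)
  show ?case unfolding svgd_Suc by (rule measurable_compose[OF measurable_step Suc])
qed (simp add: svgd_def)

lemma avg_ksd_sq_eq: "avg_ksd_sq d N V k H ip \<eta> T X = 1 / real T * (\<Sum>n<T. ksd_sq (svgd d N V k \<eta> X n))"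
  by (simp add: avg_ksd_sq_def ksd_sq_def)

lemma measurable_avg: "avg_ksd_sq d N V k H ip \<eta> T \<in> borel_measurable (lebN N d)"
  unfolding avg_ksd_sq_eq[abs_def]
  by (intro borel_measurable_times borel_measurable_sum borel_measurable_const measurable_compose[OF measurable_svgd measurable_ksd_sq])

lemma avg_nonneg: "0 \<le> avg_ksd_sq d N V k H ip \<eta> T X"
  unfolding avg_ksd_sq_def by (intro mult_nonneg_nonneg sum_nonneg) auto

lemma sublevel_eq: "sublevel d N V K = {X \<in> space (lebN N d). W X \<le> K}"
  by (simp add: sublevel_def W_def)

lemma sublevel_sets: "sublevel d N V K \<in> sets (lebN N d)"
  unfolding sublevel_eq using measurable_W by measurable

section \<open>From exponential moments to the mean\<close>

lemma partition_function:
  assumes int: "integrable (leb d) (\<lambda>x. exp (- V x))"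
  shows "(\<integral>x. exp (- V x) \<partial>leb d) > 0"
    "(\<integral>\<^sup>+X. ennreal (exp (- potential X)) \<partial>lebN N d) = ennreal ((\<integral>x. exp (- V x) \<partial>leb d) ^ N)"
proof -
  interpret LN: product_sigma_finite "\<lambda>_::nat. leb d"
    by (simp add: product_sigma_finite_def sigma_finite_leb)
  interpret L1: product_sigma_finite "\<lambda>_::nat. lborel :: real measure" by standard
  let ?Z = "\<integral>x. exp (- V x) \<partial>leb d"
  have Z0: "0 \<le> ?Z" by simp
  have "?Z \<noteq> 0"
  proof
    \<comment> \<open>A positive function with zero integral would make the whole space null, yet
      the unit cube has measure 1.\<close>
    assume "?Z = 0"
    then have "AE x in leb d. exp (- V x) = 0"
      using integral_nonneg_eq_0_iff_AE[OF int] by simp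
    then have "AE x in leb d. False" by simp
    then have "emeasure (leb d) {x \<in> space (leb d). True} = 0" by (intro emeasure_eq_0_AE) simp
    then have "emeasure (leb d) (space (leb d)) = 0" by simp
    moreover have "emeasure (leb d) (PiE {..<d} (\<lambda>_. {0..1})) = (\<Prod>i<d. emeasure lborel {0..1::real})"
      unfolding leb_def by (rule L1.emeasure_PiM) auto
    moreover have "emeasure (leb d) (PiE {..<d} (\<lambda>_. {0..1})) \<le> emeasure (leb d) (space (leb d))"
      by (rule emeasure_space)
    ultimately show False by simp
  qed
  from le_neq_trans[OF Z0 not_sym[OF this]] show "?Z > 0" .
  have Vm: "(\<lambda>x. ennreal (exp (- V x))) \<in> borel_measurable (leb d)"
    using borel_measurable_integrable[OF int] by simp
  have "(\<integral>\<^sup>+X. ennreal (exp (- potential X)) \<partial>lebN N d) = (\<integral>\<^sup>+X. (\<Prod>i<N. ennreal (exp (- V (X i)))) \<partial>lebN N d)"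
    by (simp add: prod_ennreal exp_sum[symmetric] sum_negf[symmetric])
  also have "\<dots> = (\<Prod>i<N. \<integral>\<^sup>+x. ennreal (exp (- V x)) \<partial>leb d)"
    unfolding lebN_def by (rule LN.product_nn_integral_prod) (use Vm in auto)
  also have "\<dots> = (\<Prod>i<N. ennreal ?Z)"
    using nn_integral_eq_integral[OF int] by simp
  finally show "(\<integral>\<^sup>+X. ennreal (exp (- potential X)) \<partial>lebN N d) = ennreal (?Z ^ N)"
    by (simp add: ennreal_power)
qed

text \<open>Gibbs' inequality is used with exponent log \<open>w\<close> on the sublevel set, where
  \<open>w\<close> is exactly the exponential of the accumulated gain, and with exponent 0 outside.
  The exponential moment under the target is at most 1.\<close>

theorem averaged_discrepancy_bound:
  assumes \<eta>: "\<eta> > 0" and T: "T \<ge> 1" and U: "U \<ge> 1"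
    and small: "\<eta>\<^sup>2 * (real N * (real d * (U powr (2*\<alpha>) + real d))) * \<kappa> \<le> 1/36"
    and stay: "\<forall>X\<in>sublevel d N V K. \<forall>n<T. W (svgd d N V k \<eta> X n) \<le> U"
    and p: "prob_density (lebN N d) p"
    and int: "integrable (leb d) (\<lambda>x. exp (- V x))" and c0: "c \<ge> 0"
    and KL: "KL_le (lebN N d) p (target_prod d N V) L"
  shows "integrable (lebN N d) (\<lambda>X. p X * indicator (sublevel d N V K) X * avg_ksd_sq d N V k H ip \<eta> T X)"
    "(\<integral>X. p X * indicator (sublevel d N V K) X * avg_ksd_sq d N V k H ip \<eta> T X \<partial>lebN N d)
      \<le> (L + 1 + real T * loss \<eta> U) / (\<eta> * real N * real T)"
proof -
  let ?M = "lebN N d" and ?S = "sublevel d N V K" and ?Q = "avg_ksd_sq d N V k H ip \<eta> T"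
  define Z where "Z = (\<integral>x. exp (- V x) \<partial>leb d) ^ N"
  define q where "q = target_prod d N V"
  have Z: "Z > 0" using partition_function(1)[OF int] by (simp add: Z_def)
  have qeq: "q X = exp (- potential X) / Z" for X unfolding q_def Z_def by (rule target_prod_eq)
  have qpos: "q X > 0" for X using Z by (simp add: qeq)
  note [measurable] = measurable_potential measurable_avg sublevel_sets measurable_weight
  have qm[measurable]: "q \<in> borel_measurable ?M" unfolding qeq[abs_def] by measurable
  have pm[measurable]: "p \<in> borel_measurable ?M" and p0: "\<And>X. X \<in> space ?M \<Longrightarrow> 0 \<le> p X"
    and pint: "integrable ?M p" and p1: "(\<integral>X. p X \<partial>?M) = 1"
    using p by (auto simp: prob_density_def)
  note KL' = KL_le_integral[OF sigma_finite_lebN pm p0 qm qpos KL[folded q_def]]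
  define w where "w X = enn2real (weight \<eta> U T X)" for X
  have [measurable]: "w \<in> borel_measurable ?M" unfolding w_def by measurable
  have \<eta>0: "\<eta> \<ge> 0" using \<eta> by simp
  have nnq: "(\<integral>\<^sup>+X. ennreal (q X) * g X \<partial>?M) = (\<integral>\<^sup>+X. ennreal (exp (- potential X)) * g X \<partial>?M) / ennreal Z"
    if [measurable]: "g \<in> borel_measurable ?M" for g
  proof -
    have "(\<integral>\<^sup>+X. ennreal (q X) * g X \<partial>?M) = (\<integral>\<^sup>+X. (ennreal (exp (- potential X)) * g X) / ennreal Z \<partial>?M)"
      using Z by (intro nn_integral_cong) (simp add: qeq divide_ennreal[symmetric] ennreal_divide_times ennreal_times_divide)
    also have "\<dots> = (\<integral>\<^sup>+X. ennreal (exp (- potential X)) * g X \<partial>?M) / ennreal Z"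
      by (rule nn_integral_divide) measurable
    finally show ?thesis .
  qed
  have q1: "(\<integral>\<^sup>+X. ennreal (q X) \<partial>?M) = 1"
    using nnq[of "\<lambda>_. 1"] partition_function(2)[OF int, folded Z_def] Z by (simp add: divide_ennreal)
  have qw: "(\<integral>\<^sup>+X. ennreal (q X) * weight \<eta> U T X \<partial>?M) \<le> 1"
  proof -
    have "(\<integral>\<^sup>+X. ennreal (q X) * weight \<eta> U T X \<partial>?M) \<le> (\<integral>\<^sup>+X. ennreal (q X) * 1 \<partial>?M)"
      unfolding nnq[OF measurable_weight] nnq[OF borel_measurable_const]
      using weight_integral[OF U \<eta>0 small, of T] by (intro divide_right_mono_ennreal) simp
    then show ?thesis using q1 by simp
  qed
  have sumgain: "(\<Sum>m<T. gain \<eta> U (svgd d N V k \<eta> X m)) = \<eta> * real N * real T * ?Q X - real T * loss \<eta> U" for X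
    using T unfolding gain_def sum_subtractf avg_ksd_sq_eq by (simp add: sum_distrib_left mult.assoc)
  have wS: "weight \<eta> U T X = ennreal (exp (\<eta> * real N * real T * ?Q X - real T * loss \<eta> U))" if "X \<in> ?S" for X
    unfolding sumgain[symmetric] using stay that by (intro weight_eq) blast
  have le: "(\<integral>\<^sup>+X. ennreal (q X * w X * indicator ?S X) \<partial>?M) \<le> 1"
  proof -
    have "(\<integral>\<^sup>+X. ennreal (q X * w X * indicator ?S X) \<partial>?M) \<le> (\<integral>\<^sup>+X. ennreal (q X) * weight \<eta> U T X \<partial>?M)"
    proof (rule nn_integral_mono)
      fix X
      show "ennreal (q X * w X * indicator ?S X) \<le> ennreal (q X) * weight \<eta> U T X"
      proof (cases "X \<in> ?S")
        case True
        then show ?thesis using qpos[of X] by (simp add: w_def wS ennreal_mult less_imp_le)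
      qed simp
    qed
    then show ?thesis using qw by (rule order_trans)
  qed
  have qwint: "integrable ?M (\<lambda>X. q X * w X * indicator ?S X)"
  proof (rule integrableI_nonneg)
    show "AE X in ?M. 0 \<le> q X * w X * indicator ?S X"
      by (intro AE_I2 mult_nonneg_nonneg less_imp_le[OF qpos]) (auto simp: w_def)
    show "(\<integral>\<^sup>+X. ennreal (q X * w X * indicator ?S X) \<partial>?M) < \<infinity>"
      using le by (simp add: le_less_trans[OF _ ennreal_one_less_top])
  qed measurable
  have qw1: "(\<integral>X. q X * w X * indicator ?S X \<partial>?M) \<le> 1"
  proof -
    have "ennreal (\<integral>X. q X * w X * indicator ?S X \<partial>?M) \<le> ennreal 1"
      using nn_integral_eq_integral[OF qwint] le qpos by (simp add: w_def less_imp_le)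
    then show ?thesis by (simp add: ennreal_le_iff)
  qed
  have qint: "integrable ?M q"
  proof (rule integrableI_nonneg)
    show "AE X in ?M. 0 \<le> q X" by (intro AE_I2 less_imp_le[OF qpos])
    show "(\<integral>\<^sup>+X. ennreal (q X) \<partial>?M) < \<infinity>" using q1 by simp
  qed measurable
  have qi1: "(\<integral>X. q X \<partial>?M) = 1"
    using nn_integral_eq_integral[OF qint] q1 qpos by (simp add: less_imp_le ennreal_eq_1)
  define R2 where "R2 X = p X * indicator ?S X" for X
  \<comment> \<open>An integrable majorant valid on and off the sublevel set. Adding all of
    \<open>q\<close>, rather than its part outside, costs at most 1; the two masses from
    \<open>q w\<close> and \<open>q\<close> minus the mass of \<open>p\<close> give the
    \<open>+ 1\<close> of the bound.\<close>
  define R where "R X = p X * ln (p X / q X) + q X * w X * indicator ?S X + q X + (real T * loss \<eta> U * R2 X - p X)" for X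
  have R2int: "integrable ?M R2" unfolding R2_def
    by (rule integrable_real_mult_indicator[OF sublevel_sets pint])
  have Rint: "integrable ?M R"
    unfolding R_def using KL'(1) qwint qint pint R2int
    by (intro Bochner_Integration.integrable_add Bochner_Integration.integrable_diff integrable_mult_right)
  have point: "\<eta> * real N * real T * (p X * indicator ?S X * ?Q X) \<le> R X" if X: "X \<in> space ?M" for X
  proof (cases "X \<in> ?S")
    case True
    define e where "e = \<eta> * real N * real T * ?Q X - real T * loss \<eta> U"
    have "p X * e \<le> p X * ln (p X / q X) + q X * exp e - p X"
      by (rule gibbs_pointwise[OF p0[OF X] qpos])
    moreover have "w X = exp e" using wS[OF True] by (simp add: w_def e_def)
    ultimately have "p X * e + real T * loss \<eta> U * p X \<le> R X" using True qpos[of X] by (simp add: R_def R2_def)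
    moreover have "p X * e + real T * loss \<eta> U * p X = \<eta> * real N * real T * (p X * indicator ?S X * ?Q X)"
      using True by (simp add: e_def algebra_simps)
    ultimately show ?thesis by simp
  next
    case False
    then show ?thesis using gibbs_pointwise[OF p0[OF X] qpos[of X], of 0] by (simp add: R_def R2_def)
  qed
  have npos: "\<eta> * real N * real T > 0" using \<eta> N1 T by simp
  have int2: "integrable ?M (\<lambda>X. \<eta> * real N * real T * (p X * indicator ?S X * ?Q X))"
  proof (rule Bochner_Integration.integrable_bound[OF Rint])
    show "AE X in ?M. norm (\<eta> * real N * real T * (p X * indicator ?S X * ?Q X)) \<le> norm (R X)"
    proof (rule AE_I2)
      fix X assume X: "X \<in> space ?M"
      have "0 \<le> \<eta> * real N * real T * (p X * indicator ?S X * ?Q X)"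
        using \<eta>0 p0[OF X] avg_nonneg[of \<eta> T X] by (intro mult_nonneg_nonneg) auto
      then show "norm (\<eta> * real N * real T * (p X * indicator ?S X * ?Q X)) \<le> norm (R X)"
        using point[OF X] by simp
    qed
  qed measurable
  have "integrable ?M (\<lambda>X. 1 / (\<eta> * real N * real T) * (\<eta> * real N * real T * (p X * indicator ?S X * ?Q X)))"
    by (rule integrable_mult_right[OF int2])
  moreover have "1 / (\<eta> * real N * real T) * (\<eta> * real N * real T * u) = u" for u :: real
    using npos by (metis less_irrefl nonzero_mult_div_cancel_left times_divide_eq_left mult_1)
  ultimately show main: "integrable ?M (\<lambda>X. p X * indicator ?S X * ?Q X)" by (simp only:)
  have "\<eta> * real N * real T * (\<integral>X. p X * indicator ?S X * ?Q X \<partial>?M) = (\<integral>X. \<eta> * real N * real T * (p X * indicator ?S X * ?Q X) \<partial>?M)"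
    by simp
  also have "\<dots> \<le> (\<integral>X. R X \<partial>?M)" by (rule integral_mono[OF int2 Rint point])
  also have "\<dots> = (\<integral>X. p X * ln (p X / q X) \<partial>?M) + (\<integral>X. q X * w X * indicator ?S X \<partial>?M) + (\<integral>X. q X \<partial>?M)
    + (real T * loss \<eta> U * (\<integral>X. R2 X \<partial>?M) - (\<integral>X. p X \<partial>?M))"
  proof -
    note I1 = KL'(1) and I4 = integrable_mult_right[OF R2int, of "real T * loss \<eta> U"]
    note I12 = Bochner_Integration.integrable_add[OF I1 qwint]
    note I123 = Bochner_Integration.integrable_add[OF I12 qint]
    note I45 = Bochner_Integration.integrable_diff[OF I4 pint]
    have "(\<integral>X. R X \<partial>?M) = (\<integral>X. p X * ln (p X / q X) + q X * w X * indicator ?S X + q X \<partial>?M)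
        + (\<integral>X. real T * loss \<eta> U * R2 X - p X \<partial>?M)"
      unfolding R_def by (rule Bochner_Integration.integral_add[OF I123 I45])
    also have "(\<integral>X. p X * ln (p X / q X) + q X * w X * indicator ?S X + q X \<partial>?M)
        = (\<integral>X. p X * ln (p X / q X) + q X * w X * indicator ?S X \<partial>?M) + (\<integral>X. q X \<partial>?M)"
      by (rule Bochner_Integration.integral_add[OF I12 qint])
    also have "(\<integral>X. p X * ln (p X / q X) + q X * w X * indicator ?S X \<partial>?M)
        = (\<integral>X. p X * ln (p X / q X) \<partial>?M) + (\<integral>X. q X * w X * indicator ?S X \<partial>?M)"
      by (rule Bochner_Integration.integral_add[OF I1 qwint])
    also have "(\<integral>X. real T * loss \<eta> U * R2 X - p X \<partial>?M) = (\<integral>X. real T * loss \<eta> U * R2 X \<partial>?M) - (\<integral>X. p X \<partial>?M)"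
      by (rule Bochner_Integration.integral_diff[OF I4 pint])
    finally show ?thesis by simp
  qed
  also have "\<dots> \<le> L + 1 + 1 + (real T * loss \<eta> U * 1 - 1)"
  proof -
    have "(\<integral>X. R2 X \<partial>?M) \<le> (\<integral>X. p X \<partial>?M)"
      by (rule integral_mono[OF R2int pint]) (use p0 in \<open>auto simp: R2_def indicator_def\<close>)
    moreover have "0 \<le> real T * loss \<eta> U"
      using c0 \<eta>0 params by (simp add: loss_def \<kappa>2_def \<kappa>_def)
    ultimately have "real T * loss \<eta> U * (\<integral>X. R2 X \<partial>?M) \<le> real T * loss \<eta> U * 1"
      using p1 by (intro mult_left_mono) auto
    then show ?thesis using KL'(2) qw1 qi1 p1 by linarith
  qed
  finally have "\<eta> * real N * real T * (\<integral>X. p X * indicator ?S X * ?Q X \<partial>?M) \<le> L + 1 + real T * loss \<eta> U" by simp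
  then show "(\<integral>X. p X * indicator ?S X * ?Q X \<partial>?M) \<le> (L + 1 + real T * loss \<eta> U) / (\<eta> * real N * real T)"
    using npos by (simp add: pos_le_divide_eq mult.commute)
qed

end

section \<open>Step size and rate\<close>

lemma powr_sum_le:
  fixes x y \<alpha> :: real
  assumes "x \<ge> 0" "y \<ge> 0" "0 \<le> \<alpha>" "\<alpha> \<le> 1"
  shows "(x + y) powr \<alpha> \<le> 2 * x powr \<alpha> + 2 * y powr \<alpha>"
proof -
  have two: "2 powr \<alpha> \<le> 2" using assms powr_mono[of \<alpha> 1 2] by simp
  have "(x + y) powr \<alpha> \<le> (2 * max x y) powr \<alpha>" using assms by (intro powr_mono2) auto
  also have "\<dots> = 2 powr \<alpha> * max x y powr \<alpha>" using assms by (simp add: powr_mult)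
  also have "\<dots> \<le> 2 * max x y powr \<alpha>" using two by (intro mult_right_mono) auto
  also have "\<dots> \<le> 2 * x powr \<alpha> + 2 * y powr \<alpha>" by (simp add: max_def)
  finally show ?thesis .
qed

text \<open>Facts 5 and 6 control the second-order error and the smallness required by the change of
  variables. Facts 7 to 9 confine the trajectory, and fact 10 bounds the total time from below.
  Since T has exponent q + 1 against -q for the step size, that time is a N / D up to
  rounding.\<close>

lemma step_size_facts:
  fixes \<alpha> a K D \<eta> U :: real and N d T :: nat
  assumes \<alpha>: "0 \<le> \<alpha>" "\<alpha> < 1/2" and d: "d \<ge> 1" and N: "N \<ge> 1" and K: "K > 0" and a: "0 < a" "a \<le> 1"
    and D_def: "D = real d powr ((1 + \<alpha>) / (2 * (1 - \<alpha>))) + sqrt (real d) * K powr \<alpha> + real d"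
    and \<eta>_def: "\<eta> = a / D * real N powr (- ((1 + \<alpha>) / (1 - 2 * \<alpha>)))"
    and T_def: "T = nat \<lfloor>real N powr ((2 - \<alpha>) / (1 - 2 * \<alpha>))\<rfloor>"
    and U_def: "U = 2 * K + real N powr (1 / (1 - \<alpha>))"
  shows "D \<ge> 1" "\<eta> > 0" "T \<ge> 1" "U \<ge> 1"
    "real N * (\<eta> * (real d * (U powr (2*\<alpha>) + real d))) \<le> 37 * a * D"
    "\<eta>\<^sup>2 * (real N * (real d * (U powr (2*\<alpha>) + real d))) \<le> 37 * a"
    "\<eta> * U powr \<alpha> \<le> 6" "\<eta> * real d \<le> 1"
    "\<eta> * real T * (sqrt (real d) * U powr \<alpha>) \<le> a * U"
    "\<eta> * real T \<ge> a * real N / (2 * D)"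
proof -
  define q where "q = (1 + \<alpha>) / (1 - 2 * \<alpha>)"
  define E where "E = real N powr (- q)"
  define n1 where "n1 = real N powr (\<alpha> / (1 - \<alpha>))"
  define n2 where "n2 = real N powr (1 / (1 - \<alpha>))"
  define u where "u = U powr \<alpha>"
  have N1: "real N \<ge> 1" and d1: "real d \<ge> 1" using N d by simp_all
  have sd: "sqrt (real d) \<ge> 1" "sqrt (real d) \<le> real d"
    using d1 real_sqrt_le_mono[of 1 "real d"] real_le_lsqrt[of "real d" "real d"] by (auto simp: self_le_power)
  have Dd: "real d \<le> D" and DK: "sqrt (real d) * K powr \<alpha> \<le> D" using d1 by (simp_all add: D_def)
  show D1: "D \<ge> 1" using Dd d1 by linarith
  have D0: "D > 0" using D1 by simp
  have E0: "E > 0" using N1 by (simp add: E_def)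
  have \<eta>E: "\<eta> = a / D * E" by (simp add: \<eta>_def E_def q_def)
  show \<eta>0: "\<eta> > 0" unfolding \<eta>E using a D0 E0 by simp
  have n1: "n1 \<ge> 1" unfolding n1_def using N1 \<alpha> by (intro ge_one_powr_ge_zero) auto
  have n2: "n2 \<ge> 1" unfolding n2_def using N1 \<alpha> by (intro ge_one_powr_ge_zero) auto
  show U1: "U \<ge> 1" using n2 K by (simp add: U_def n2_def[symmetric])
  have u1: "u \<ge> 1" unfolding u_def using U1 \<alpha> by (intro ge_one_powr_ge_zero) auto
  have q: "q = 1 + 3 * \<alpha> / (1 - 2 * \<alpha>)" using \<alpha> by (simp add: q_def field_simps)
  \<comment> \<open>Hence q \<ge> 1 + 2\<alpha>/(1-\<alpha>): the step size decays fast enough to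
    absorb N n1^2, where \<open>n1\<close> is the order of U^\<alpha> apart from the contribution of
    K.\<close>
  have "2 * \<alpha> / (1 - \<alpha>) \<le> 3 * \<alpha> / (1 - 2 * \<alpha>)" using \<alpha> by (intro frac_le) auto
  then have expo: "1 + 2 * (\<alpha> / (1 - \<alpha>)) - q \<le> 0" by (simp add: q)
  have "E * (real N * n1\<^sup>2) = real N powr (1 + 2 * (\<alpha> / (1 - \<alpha>)) - q)"
  proof -
    have "n1\<^sup>2 = real N powr (2 * (\<alpha> / (1 - \<alpha>)))" by (simp add: n1_def power2_eq_square powr_add[symmetric])
    moreover have "real N = real N powr 1" using N1 by simp
    ultimately have "E * (real N * n1\<^sup>2) = real N powr (- q) * (real N powr 1 * real N powr (2 * (\<alpha> / (1 - \<alpha>))))"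
      by (simp add: E_def)
    also have "\<dots> = real N powr (1 + 2 * (\<alpha> / (1 - \<alpha>)) - q)" by (simp only: powr_add[symmetric]) (simp add: algebra_simps)
    finally show ?thesis .
  qed
  also have "\<dots> \<le> real N powr 0" using expo N1 by (intro powr_mono) auto
  finally have key: "E * (real N * n1\<^sup>2) \<le> 1" using N1 by simp
  have Dn: "D \<le> D * n1" using mult_left_mono[OF n1, of D] D0 by linarith
  have n1sq: "n1 \<le> n1\<^sup>2" using n1 by (simp add: self_le_power)
  have En1: "E * n1 \<le> 1"
  proof -
    have "n1 \<le> 1 * n1\<^sup>2" using n1sq by simp
    also have "\<dots> \<le> real N * n1\<^sup>2" using N1 by (intro mult_right_mono) auto
    finally have "E * n1 \<le> E * (real N * n1\<^sup>2)" using E0 by (intro mult_left_mono) auto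
    then show ?thesis using key by linarith
  qed
  have E1: "E \<le> 1" using En1 mult_left_mono[OF n1, of E] E0 by linarith
  have \<eta>a: "\<eta> \<le> a / D" unfolding \<eta>E using a D0 E1 mult_left_mono[OF E1, of "a / D"] by simp
  have n2\<alpha>: "n2 powr \<alpha> = n1" by (simp add: n2_def n1_def powr_powr)
  have "u \<le> 2 * (2 * K) powr \<alpha> + 2 * n2 powr \<alpha>"
    unfolding u_def U_def n2_def[symmetric] using K n2 \<alpha> by (intro powr_sum_le) auto
  also have "(2 * K) powr \<alpha> = 2 powr \<alpha> * K powr \<alpha>" using K by (simp add: powr_mult)
  also have "2 powr \<alpha> * K powr \<alpha> \<le> 2 * K powr \<alpha>"
    using \<alpha> powr_mono[of \<alpha> 1 2] by (intro mult_right_mono) auto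
  finally have u: "u \<le> 4 * K powr \<alpha> + 2 * n1" by (simp add: n2\<alpha>)
  \<comment> \<open>The constant 6 is 4 + 2, from the bound on \<open>u\<close>, since both sqrt(d)
    K^\<alpha> and sqrt(d) are at most D. Its square plus 1 is the 37 below.\<close>
  have s: "sqrt (real d) * u \<le> 6 * (D * n1)"
  proof -
    have "sqrt (real d) * u \<le> sqrt (real d) * (4 * K powr \<alpha> + 2 * n1)" using u by (intro mult_left_mono) auto
    also have "\<dots> = 4 * (sqrt (real d) * K powr \<alpha>) + 2 * (sqrt (real d) * n1)" by (simp add: algebra_simps)
    also have "\<dots> \<le> 4 * (D * n1) + 2 * (D * n1)"
    proof (intro add_mono mult_left_mono)
      show "sqrt (real d) * K powr \<alpha> \<le> D * n1" by (rule order_trans[OF DK Dn])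
      show "sqrt (real d) * n1 \<le> D * n1" using sd Dd n1 by (intro mult_right_mono) auto
    qed auto
    finally show ?thesis by simp
  qed
  have uu: "U powr (2*\<alpha>) = u\<^sup>2" by (simp add: u_def power2_eq_square powr_add[symmetric])
  have X: "real d * (U powr (2*\<alpha>) + real d) \<le> 37 * (D\<^sup>2 * n1\<^sup>2)"
  proof -
    have "real d * (U powr (2*\<alpha>) + real d) = (sqrt (real d) * u)\<^sup>2 + (real d)\<^sup>2"
      unfolding uu by (simp add: power_mult_distrib power2_eq_square distrib_left)
    also have "\<dots> \<le> (6 * (D * n1))\<^sup>2 + (D * n1)\<^sup>2"
    proof (intro add_mono power_mono s)
      show "real d \<le> D * n1" by (rule order_trans[OF Dd Dn])
    qed (use u1 in auto)
    also have "\<dots> = 37 * (D\<^sup>2 * n1\<^sup>2)" by (simp add: power_mult_distrib)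
    finally show ?thesis .
  qed
  show 2: "real N * (\<eta> * (real d * (U powr (2*\<alpha>) + real d))) \<le> 37 * a * D"
  proof -
    have "real N * (\<eta> * (real d * (U powr (2*\<alpha>) + real d))) \<le> real N * (\<eta> * (37 * (D\<^sup>2 * n1\<^sup>2)))"
      using X \<eta>0 by (intro mult_left_mono) auto
    also have "\<dots> = 37 * a * D * (E * (real N * n1\<^sup>2))" unfolding \<eta>E using D0 by (simp add: power2_eq_square)
    also have "\<dots> \<le> 37 * a * D * 1" using key a D0 by (intro mult_left_mono) auto
    finally show ?thesis by simp
  qed
  show "\<eta>\<^sup>2 * (real N * (real d * (U powr (2*\<alpha>) + real d))) \<le> 37 * a"
  proof -
    have "\<eta>\<^sup>2 * (real N * (real d * (U powr (2*\<alpha>) + real d))) = \<eta> * (real N * (\<eta> * (real d * (U powr (2*\<alpha>) + real d))))"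
      by (simp add: power2_eq_square mult_ac)
    also have "\<dots> \<le> (a / D) * (37 * a * D)" using \<eta>0 by (intro mult_mono \<eta>a 2) (use a D0 in auto)
    also have "\<dots> = 37 * a * a" using D0 by simp
    also have "\<dots> \<le> 37 * a * 1" using a by (intro mult_left_mono) auto
    finally show ?thesis by simp
  qed
  have "\<eta> * (sqrt (real d) * u) \<le> \<eta> * (6 * (D * n1))" using s \<eta>0 by (intro mult_left_mono) auto
  also have "\<dots> = 6 * (a * (E * n1))" unfolding \<eta>E using D0 by simp
  also have "\<dots> \<le> 6 * (1 * 1)" using a En1 E0 n1 by (intro mult_left_mono mult_mono) auto
  finally have "\<eta> * (sqrt (real d) * u) \<le> 6" by simp
  moreover have "\<eta> * u \<le> \<eta> * (sqrt (real d) * u)" using sd u1 \<eta>0 mult_right_mono[of 1 "sqrt (real d)" u] by (intro mult_left_mono) auto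
  ultimately show "\<eta> * U powr \<alpha> \<le> 6" by (simp add: u_def)
  have "\<eta> * real d \<le> (a / D) * D" using \<eta>0 a D0 by (intro mult_mono \<eta>a Dd) auto
  then show "\<eta> * real d \<le> 1" using a D0 by simp
  define y where "y = real N powr ((2 - \<alpha>) / (1 - 2 * \<alpha>))"
  have y1: "y \<ge> 1" unfolding y_def using N1 \<alpha> by (intro ge_one_powr_ge_zero) auto
  have fl: "\<lfloor>y\<rfloor> \<ge> 1" using y1 by simp
  have Tr: "real T = real_of_int \<lfloor>y\<rfloor>" using fl by (simp add: T_def y_def)
  show "T \<ge> 1" using fl Tr by linarith
  \<comment> \<open>Since y \<ge> 1, rounding down loses at most half.\<close>
  have Ty: "real T \<le> y" "real T \<ge> y / 2" unfolding Tr using y1 fl by linarith+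
  have r: "(2 - \<alpha>) / (1 - 2 * \<alpha>) = q + 1" using \<alpha> by (simp add: q_def field_simps)
  have Ey: "E * y = real N"
  proof -
    have "E * y = real N powr (- q + (q + 1))" unfolding E_def y_def r by (rule powr_add[symmetric])
    then show ?thesis using N1 by simp
  qed
  have \<eta>y: "\<eta> * y = a * real N / D" unfolding \<eta>E using Ey by (simp add: mult.assoc)
  have "\<eta> * (y / 2) \<le> \<eta> * real T" using Ty \<eta>0 by (intro mult_left_mono) auto
  then show "\<eta> * real T \<ge> a * real N / (2 * D)" using \<eta>y D0 by (simp add: field_simps)
  \<comment> \<open>This inequality fixes U: it says U^(1-\<alpha>) \<ge> N, so growth at rate
    U^\<alpha> over time of order N stays of order U.\<close>
  have NU: "real N * u \<le> U"
  proof -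
    have "real N = (real N powr (1 / (1 - \<alpha>))) powr (1 - \<alpha>)" using N1 \<alpha> by (simp add: powr_powr)
    also have "\<dots> \<le> U powr (1 - \<alpha>)" using \<alpha> K by (intro powr_mono2) (auto simp: U_def)
    finally have "real N * u \<le> U powr (1 - \<alpha>) * u" using u1 by (intro mult_right_mono) auto
    also have "\<dots> = U powr (1 - \<alpha> + \<alpha>)" unfolding u_def by (rule powr_add[symmetric])
    also have "\<dots> = U" using U1 by simp
    finally show ?thesis .
  qed
  have "\<eta> * real T * (sqrt (real d) * u) \<le> (a * real N / D) * (D * u)"
  proof (intro mult_mono)
    show "\<eta> * real T \<le> a * real N / D" unfolding \<eta>y[symmetric] using Ty \<eta>0 by (intro mult_left_mono) auto
    show "sqrt (real d) \<le> D" using sd Dd by linarith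
  qed (use a D0 u1 in auto)
  also have "\<dots> = a * (real N * u)" using D0 by simp
  also have "\<dots> \<le> a * U" using NU a by (intro mult_left_mono) auto
  finally show "\<eta> * real T * (sqrt (real d) * U powr \<alpha>) \<le> a * U" by (simp add: u_def)
qed

section \<open>Confinement of trajectories and the rate\<close>

context svgd_setting
begin

text \<open>The growth constant of the mean potential: \<open>B * A\<close> from the drift, the rest
  from the second-order term, with 6 from the bound on \<eta> U^\<alpha>.\<close>

definition "C1 = B * A + C * B\<^sup>2 * (6 * A\<^sup>2 + 1)"

lemma svgd_step_last: "svgd d N V k \<eta> X (Suc n) = svgd_step d N V k \<eta> (svgd d N V k \<eta> X n)"
  by (simp add: svgd_def)

lemma svgd_conf: "X \<in> space (lebN N d) \<Longrightarrow> conf (svgd d N V k \<eta> X n)"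
  by (cases n) (simp_all add: svgd_step_last step_conf, simp add: svgd_def conf_space)

text \<open>A bootstrap: as long as the potential is below \<open>U\<close>, its growth rate may be
  evaluated at \<open>U\<close>, and the resulting linear bound stays below \<open>U\<close> up to
  time \<open>T\<close>.\<close>

lemma trajectory_bound:
  assumes \<eta>: "\<eta> \<ge> 0" and U: "U \<ge> 1" and \<eta>U: "\<eta> * U powr \<alpha> \<le> 6" and \<eta>d: "\<eta> * real d \<le> 1"
    and KU: "K + C1 * (\<eta> * real T * (sqrt (real d) * U powr \<alpha>)) \<le> U"
    and X: "X \<in> sublevel d N V K" and n: "n \<le> T"
  shows "W (svgd d N V k \<eta> X n) \<le> U"
proof -
  define u where "u = U powr \<alpha>"
  define s where "s = sqrt (real d) * u"
  have u1: "u \<ge> 1" unfolding u_def using U params by (intro ge_one_powr_ge_zero) auto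
  have sd: "sqrt (real d) \<ge> 1" using dpos real_sqrt_le_mono[of 1 "real d"] by simp
  have us: "u \<le> s" using mult_right_mono[OF sd, of u] u1 by (simp add: s_def)
  then have s1: "1 \<le> s" using u1 by linarith
  have C1: "C1 \<ge> 0" unfolding C1_def using params by simp
  have Xs: "X \<in> space (lebN N d)" "W X \<le> K" using X by (simp_all add: sublevel_eq)
  have below: "K + C1 * (\<eta> * real m * s) \<le> U" if "m \<le> T" for m
  proof -
    have "C1 * (\<eta> * real m * s) \<le> C1 * (\<eta> * real T * s)"
      using that C1 \<eta> s1 by (intro mult_left_mono mult_right_mono) auto
    then show ?thesis using KU by (simp add: s_def u_def)
  qed
  have "W (svgd d N V k \<eta> X n) \<le> K + C1 * (\<eta> * real n * s)"
    using n
  proof (induction n)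
    case 0
    then show ?case using Xs by (simp add: svgd_def)
  next
    case (Suc n)
    let ?Y = "svgd d N V k \<eta> X n"
    have IH: "W ?Y \<le> K + C1 * (\<eta> * real n * s)" using Suc by simp
    have Y: "conf ?Y" by (rule svgd_conf[OF Xs(1)])
    have WU: "W ?Y \<le> U" using IH below[of n] Suc.prems by simp
    have w1: "W ?Y powr \<alpha> \<le> u" unfolding u_def using WU W_pos[OF Y] params by (intro powr_mono2) auto
    have "W ?Y powr (2*\<alpha>) \<le> U powr (2*\<alpha>)" using WU W_pos[OF Y] params by (intro powr_mono2) auto
    then have w2: "W ?Y powr (2*\<alpha>) \<le> u * u" by (simp add: u_def powr_add[symmetric])
    have "W (svgd d N V k \<eta> X (Suc n)) \<le> W ?Y + \<eta> * (B * sqrt (real d) * A * W ?Y powr \<alpha>)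
      + C * \<eta>\<^sup>2 * B\<^sup>2 * (A\<^sup>2 * W ?Y powr (2*\<alpha>) + real d)"
      unfolding svgd_step_last by (rule W_step_le[OF Y \<eta>])
    also have "\<dots> \<le> W ?Y + \<eta> * (B * sqrt (real d) * A * u) + C * \<eta>\<^sup>2 * B\<^sup>2 * (A\<^sup>2 * (u * u) + real d)"
      using w1 w2 \<eta> params by (intro add_mono mult_left_mono order_refl) auto
    also have "C * \<eta>\<^sup>2 * B\<^sup>2 * (A\<^sup>2 * (u * u) + real d) = (C * B\<^sup>2 * \<eta>) * (A\<^sup>2 * ((\<eta> * u) * u) + \<eta> * real d)"
      by (simp add: power2_eq_square algebra_simps)
    \<comment> \<open>One factor \<eta> u \<le> 6, or \<eta> d \<le> 1, is spent here, so the
      second-order term is dominated by a first-order one.\<close>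
    also have "\<dots> \<le> (C * B\<^sup>2 * \<eta>) * (A\<^sup>2 * (6 * s) + s)"
    proof (intro mult_left_mono add_mono)
      show "(\<eta> * u) * u \<le> 6 * s" using \<eta>U us u1 \<eta> by (intro mult_mono) (auto simp: u_def)
      show "\<eta> * real d \<le> s" using \<eta>d s1 by linarith
    qed (use params \<eta> in auto)
    also have "W ?Y + \<eta> * (B * sqrt (real d) * A * u) + (C * B\<^sup>2 * \<eta>) * (A\<^sup>2 * (6 * s) + s) = W ?Y + C1 * (\<eta> * s)"
      by (simp add: C1_def s_def algebra_simps)
    also have "\<dots> \<le> K + C1 * (\<eta> * real (Suc n) * s)" using IH by (simp add: algebra_simps)
    finally show ?case by simp
  qed
  then show ?thesis using below[OF n] by linarith
qed

text \<open>The entropy over N times the total time gives the first constant. The diagonal loss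
  gives \<open>c\<close>, and the second-order loss is of order D/N. The additive 1 is absorbed by 1
  \<le> N d.\<close>

lemma loss_bound:
  assumes \<eta>: "\<eta> > 0" and D1: "D \<ge> 1" and c: "c > 0" and a: "a > 0" and L: "L \<ge> 0"
    and U: "real N * (\<eta> * (real d * (U powr (2*\<alpha>) + real d))) \<le> 37 * a * D"
    and T: "T \<ge> 1" "\<eta> * real T \<ge> a * real N / (2 * D)"
  shows "(L * real N * real d + 1 + real T * loss \<eta> U) / (\<eta> * real N * real T)
    \<le> (2 * (L + 1) / a + c + 37 * a * \<kappa>2) * real d * D / real N"
proof -
  have k2: "\<kappa>2 \<ge> 0" using params by (simp add: \<kappa>2_def \<kappa>_def)
  have T0: "real T > 0" using T by simp
  have dD: "real d \<le> real d * D" "D \<le> real d * D"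
    using mult_left_mono[OF D1, of "real d"] mult_right_mono[OF dpos, of D] D1 by auto
  have Nd: "1 \<le> real N * real d" using N1 dpos mult_mono[of 1 "real N" 1 "real d"] by simp
  have "(L * real N * real d + 1 + real T * loss \<eta> U) / (\<eta> * real N * real T)
    = (L * real N * real d + 1) / (\<eta> * real T * real N) + loss \<eta> U / (\<eta> * real N)"
    using T0 \<eta> Npos by (simp add: add_divide_distrib mult_ac)
  also have "(L * real N * real d + 1) / (\<eta> * real T * real N) \<le> ((L + 1) * real N * real d) / (a * real N / (2 * D) * real N)"
  proof (rule frac_le)
    show "L * real N * real d + 1 \<le> (L + 1) * real N * real d" using Nd by (simp add: algebra_simps)
    show "a * real N / (2 * D) * real N \<le> \<eta> * real T * real N" using T Npos by (intro mult_right_mono) auto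
  qed (use L a D1 Npos in auto)
  also have "\<dots> = 2 * (L + 1) / a * (real d * D / real N)" using a D1 Npos by (simp add: field_simps)
  also have "loss \<eta> U / (\<eta> * real N) = (c * real d + \<kappa>2 * (real N * (\<eta> * (real d * (U powr (2*\<alpha>) + real d))))) / real N"
    using \<eta> Npos by (simp add: loss_def power2_eq_square add_divide_distrib mult_ac)
  also have "\<dots> \<le> (c * (real d * D) + \<kappa>2 * (37 * a * (real d * D))) / real N"
  proof (intro divide_right_mono add_mono mult_left_mono)
    show "real N * (\<eta> * (real d * (U powr (2*\<alpha>) + real d))) \<le> 37 * a * (real d * D)"
      by (rule order_trans[OF U mult_left_mono[OF dD(2)]]) (use a in simp)
  qed (use dD c k2 in auto)
  also have "2 * (L + 1) / a * (real d * D / real N) + (c * (real d * D) + \<kappa>2 * (37 * a * (real d * D))) / real N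
    = (2 * (L + 1) / a + c + 37 * a * \<kappa>2) * real d * D / real N"
    using Npos by (simp add: add_divide_distrib algebra_simps)
  finally show ?thesis by simp
qed

end

section \<open>Restriction to the sublevel set and choice of constants\<close>

text \<open>Renormalising by a mass of at least 1/2 costs a factor 2. For the tail, Markov's
  inequality is applied to the unnormalised density on \<open>S\<close>, and the complement is added
  with its full mass.\<close>

lemma restricted_mean_and_tail:
  fixes p Q :: "'a \<Rightarrow> real"
  assumes p: "prob_density M p" and Q: "Q \<in> borel_measurable M" "\<And>x. 0 \<le> Q x" and S: "S \<in> sets M"
    and mass: "(LINT z:S|M. p z) \<ge> 1/2"
    and int: "integrable M (\<lambda>x. p x * indicator S x * Q x)"
    and bd: "(\<integral>x. p x * indicator S x * Q x \<partial>M) \<le> b / 2" and b: "b > 0"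
  shows "integrable (density M (restricted_density M p S)) Q"
    "(\<integral>x. Q x \<partial>density M (restricted_density M p S)) \<le> b"
    "\<epsilon> > 0 \<Longrightarrow> measure (density M p) {x \<in> space (density M p). Q x > b / \<epsilon>} \<le> \<epsilon> + (LINT z:(space M - S)|M. p z)"
proof -
  have pm: "p \<in> borel_measurable M" and p0: "\<And>x. x \<in> space M \<Longrightarrow> 0 \<le> p x" and pint: "integrable M p"
    using p by (auto simp: prob_density_def)
  note [measurable] = pm Q(1) S
  define m where "m = (LINT z:S|M. p z)"
  have m: "m \<ge> 1/2" using mass by (simp add: m_def)
  have rd: "restricted_density M p S x = p x * indicator S x / m" for x
    by (simp add: restricted_density_def m_def)
  have rdm: "restricted_density M p S \<in> borel_measurable M" unfolding rd[abs_def] by measurable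
  have rd0: "AE x in M. 0 \<le> restricted_density M p S x" unfolding rd using p0 m by (intro AE_I2) auto
  have eq: "restricted_density M p S x *\<^sub>R Q x = 1 / m * (p x * indicator S x * Q x)" for x
    by (simp add: rd)
  show "integrable (density M (restricted_density M p S)) Q"
    unfolding integrable_density[OF Q(1) rdm rd0] eq by (rule integrable_mult_right[OF int])
  have "(\<integral>x. Q x \<partial>density M (restricted_density M p S)) = 1 / m * (\<integral>x. p x * indicator S x * Q x \<partial>M)"
    unfolding integral_density[OF Q(1) rdm rd0] eq by simp
  also have "\<dots> \<le> 1 / m * (b / 2)" using bd m by (intro mult_left_mono) auto
  also have "\<dots> \<le> 2 * (b / 2)" using m b by (intro mult_right_mono) (auto simp: divide_le_eq)
  finally show "(\<integral>x. Q x \<partial>density M (restricted_density M p S)) \<le> b" by simp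
  assume e: "\<epsilon> > 0"
  define A where "A = {x \<in> space M. Q x > b / \<epsilon>}"
  have A[measurable]: "A \<in> sets M" unfolding A_def by measurable
  have S': "space M - S \<in> sets M" by simp
  have pAE: "AE x in M. 0 \<le> p x" by (rule AE_I2[OF p0])
  have "measure (density M p) A = (\<integral>x. indicator A x \<partial>density M p)"
    using sets.sets_into_space[OF A] by (simp add: Int_absorb2)
  also have "\<dots> = (\<integral>x. p x * indicator A x \<partial>M)" by (subst integral_density[OF _ pm pAE]) simp_all
  also have "\<dots> \<le> (\<integral>x. \<epsilon> / b * (p x * indicator S x * Q x) + p x * indicator (space M - S) x \<partial>M)"
  proof (rule integral_mono)
    show "integrable M (\<lambda>x. p x * indicator A x)" by (rule integrable_real_mult_indicator[OF A pint])
    show "integrable M (\<lambda>x. \<epsilon> / b * (p x * indicator S x * Q x) + p x * indicator (space M - S) x)"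
      by (rule Bochner_Integration.integrable_add[OF integrable_mult_right[OF int] integrable_real_mult_indicator[OF S' pint]])
    fix x assume x: "x \<in> space M"
    show "p x * indicator A x \<le> \<epsilon> / b * (p x * indicator S x * Q x) + p x * indicator (space M - S) x"
    proof (cases "x \<in> S")
      case True
      show ?thesis
      proof (cases "x \<in> A")
        case inA: True
        then have "b < \<epsilon> * Q x" using e by (simp add: A_def pos_divide_less_eq mult.commute)
        then have "1 \<le> \<epsilon> / b * Q x" using b by (simp add: pos_le_divide_eq)
        from mult_left_mono[OF this p0[OF x]] show ?thesis using True inA by (simp add: mult_ac)
      next
        case False
        then show ?thesis using True e b p0[OF x] Q(2)[of x] by simp
      qed
    next
      case False
      then show ?thesis using x p0[OF x] by (simp add: indicator_def)
    qed
  qed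
  also have "\<dots> = \<epsilon> / b * (\<integral>x. p x * indicator S x * Q x \<partial>M) + (\<integral>x. p x * indicator (space M - S) x \<partial>M)"
    unfolding Bochner_Integration.integral_add[OF integrable_mult_right[OF int] integrable_real_mult_indicator[OF S' pint]] by simp
  also have "\<dots> \<le> \<epsilon> / b * b + (\<integral>x. p x * indicator (space M - S) x \<partial>M)"
    using bd b e by (intro add_right_mono mult_left_mono) auto
  also have "(\<integral>x. p x * indicator (space M - S) x \<partial>M) = (LINT z:(space M - S)|M. p z)"
    by (simp add: set_lebesgue_integral_def mult.commute)
  finally show "measure (density M p) {x \<in> space (density M p). Q x > b / \<epsilon>} \<le> \<epsilon> + (LINT z:(space M - S)|M. p z)"
    using b by (simp add: A_def)
qed

lemma svgd_rate:
  fixes B A \<alpha> C C' c C\<^sub>K\<^sub>L a K D \<eta> :: real and d N T :: nat and V :: "vec \<Rightarrow> real" and k :: "vec \<Rightarrow> vec \<Rightarrow> real"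
  assumes D_def: "D = real d powr ((1 + \<alpha>) / (2 * (1 - \<alpha>))) + sqrt (real d) * K powr \<alpha> + real d"
    and \<eta>_def: "\<eta> = a / D * real N powr (- ((1 + \<alpha>) / (1 - 2 * \<alpha>)))"
    and T_def: "T = nat \<lfloor>real N powr ((2 - \<alpha>) / (1 - 2 * \<alpha>))\<rfloor>"
    and params: "B > 0" "A > 0" "0 \<le> \<alpha>" "\<alpha> < 1/2" "c > 0" "C\<^sub>K\<^sub>L > 0" "C \<ge> 0" "C' \<le> C"
    and a: "0 < a" "a \<le> 1" "a * (B * A + C * B\<^sup>2 * (6 * A\<^sup>2 + 1)) \<le> 1/2"
      "37 * a * (B\<^sup>2 * (20 + 128 * A\<^sup>2) * (2 * A\<^sup>2 + C\<^sup>2 + 1)) \<le> 1/36"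
    and b: "b = 2 * (2 * (C\<^sub>K\<^sub>L + 1) / a + c + 37 * a * (2 * (B\<^sup>2 * (20 + 128 * A\<^sup>2) * (2 * A\<^sup>2 + C\<^sup>2 + 1))
      + C * B\<^sup>2 * (2 * A\<^sup>2 + C\<^sup>2 + 1)))"
    and d: "d \<ge> 1" and N: "N \<ge> 1"
    and V: "twice_differentiable_Rd d V" and int: "integrable (leb d) (\<lambda>x. exp (- V x))"
    and k: "symmetric_pd_kernel d k" "twice_differentiable_Rd (2 * d) (joint d k)" and rk: "rkhs d k H ip"
    and p: "prob_density (lebN N d) p0"
    and kB: "\<forall>z\<in>Rd (2 * d). \<bar>joint d k z\<bar> \<le> B \<and>
        (\<forall>i<2 * d. \<bar>partial i (joint d k) z\<bar> \<le> B) \<and>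
        (\<forall>i<2 * d. \<forall>j<2 * d. \<bar>partial i (partial j (joint d k)) z\<bar> \<le> B)"
    and Vb: "bdd_below (V ` Rd d)" "(INF z\<in>Rd d. V z) > 0"
    and growth: "\<forall>x\<in>Rd d. L2_set (\<lambda>i. partial i V x) {..<d} \<le> A * V x powr \<alpha>"
    and hess: "bdd_above ((\<lambda>z. op_norm d (hessian V z)) ` Rd d)" "(SUP z\<in>Rd d. op_norm d (hessian V z)) = C'"
    and diag: "bdd_above ((\<lambda>z. (\<Sum>i<d. partial i (k z) z * partial i V z)
        + k z z * laplacian d V z - laplacian d (k z) z) ` Rd d)"
      "(SUP z\<in>Rd d. (\<Sum>i<d. partial i (k z) z * partial i V z)
        + k z z * laplacian d V z - laplacian d (k z) z) = c * real d"
    and KL: "KL_le (lebN N d) p0 (target_prod d N V) (C\<^sub>K\<^sub>L * real N * real d)"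
    and K: "K > 0" and mass: "(LINT z:sublevel d N V K|lebN N d. p0 z) \<ge> 1 / 2"
  shows "integrable (density (lebN N d) (restricted_density (lebN N d) p0 (sublevel d N V K))) (avg_ksd_sq d N V k H ip \<eta> T)"
    "(\<integral>x. avg_ksd_sq d N V k H ip \<eta> T x \<partial>density (lebN N d) (restricted_density (lebN N d) p0 (sublevel d N V K)))
       \<le> b * real d * D / real N"
    "\<epsilon> > 0 \<Longrightarrow> measure (density (lebN N d) p0) {x \<in> space (density (lebN N d) p0). avg_ksd_sq d N V k H ip \<eta> T x > b * real d * D / (real N * \<epsilon>)}
       \<le> \<epsilon> + (LINT z:(space (lebN N d) - sublevel d N V K)|lebN N d. p0 z)"
proof -
  have sk: "smooth_kernel d k"
    by (rule smooth_kernel.intro) (use k in \<open>simp_all add: symmetric_pd_kernel_def\<close>)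
  then interpret smooth_kernel d k .
  have kr: "kernel_rkhs d k H ip" by (rule kernel_rkhs.intro[OF sk rk])
  have bd: "\<bar>joint d k (cat d x y)\<bar> \<le> B" "i < 2*d \<Longrightarrow> \<bar>partial i (joint d k) (cat d x y)\<bar> \<le> B"
    "i < 2*d \<Longrightarrow> j < 2*d \<Longrightarrow> \<bar>partial i (partial j (joint d k)) (cat d x y)\<bar> \<le> B" for x y i j
    using kB cat_in[of d x y] by blast+
  have setting: "svgd_setting d k H ip N V B A \<alpha> C c"
  proof (intro svgd_setting.intro[OF kr] svgd_setting_axioms.intro)
    fix x y z assume x: "x \<in> Rd d" and y: "y \<in> Rd d"
    show "0 < V x" using cINF_lower[OF Vb(1) x] Vb(2) by linarith
    show "L2_set (\<lambda>i. partial i V x) {..<d} \<le> A * V x powr \<alpha>" using growth x by blast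
    show "op_norm d (hessian V x) \<le> C" using cSUP_upper[OF x hess(1)] hess(2) params by linarith
    show "\<bar>k x y\<bar> \<le> B" using bd(1)[of x y] by (simp only: joint_cat[OF x y])
    show "(\<Sum>l<d. k2 l x x * partial l V x) + k x x * laplacian d V x - laplacian d (k x) x \<le> c * real d"
      using cSUP_upper[OF x diag(1)] unfolding diag(2) k2_def .
    fix l assume l: "l < d"
    then have l2: "l < 2 * d" "d + l < 2 * d" by auto
    show "\<bar>k1 l x y\<bar> \<le> B" using bd(2)[OF l2(1), of x y] by (simp only: k1_cat[OF x y l])
    show "\<bar>k2 l x y\<bar> \<le> B" using bd(2)[OF l2(2), of x y] by (simp only: k2_cat[OF x y l])
    fix l' assume l': "l' < d"
    then have l2': "l' < 2 * d" "d + l' < 2 * d" by auto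
    show "\<bar>k21 l' l x y\<bar> \<le> B" using bd(3)[OF l2'(1) l2(2), of x y] by (simp only: k21_cat[OF x y l l'])
    show "\<bar>k22 l' l x y\<bar> \<le> B" using bd(3)[OF l2'(2) l2(2), of x y] by (simp only: k22_cat[OF x y l l'])
  qed (use d N V params in auto)
  then interpret S: svgd_setting d k H ip N V B A \<alpha> C c .
  define U where "U = 2 * K + real N powr (1 / (1 - \<alpha>))"
  note F = step_size_facts[OF params(3,4) d N K a(1,2) D_def \<eta>_def T_def U_def]
  have C1: "a * S.C1 \<le> 1/2" and \<kappa>: "37 * a * S.\<kappa> \<le> 1/36" and \<kappa>0: "S.\<kappa> \<ge> 0" and C10: "S.C1 \<ge> 0"
    using a params by (simp_all add: S.C1_def S.\<kappa>_def)
  have b': "b = 2 * (2 * (C\<^sub>K\<^sub>L + 1) / a + c + 37 * a * S.\<kappa>2)"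
    by (simp only: b S.\<kappa>2_def S.\<kappa>_def)
  have small: "\<eta>\<^sup>2 * (real N * (real d * (U powr (2*\<alpha>) + real d))) * S.\<kappa> \<le> 1/36"
    using mult_right_mono[OF F(6) \<kappa>0] \<kappa> by linarith
  \<comment> \<open>Half of U accommodates the initial level K, the other half the growth, whose
    constant is made small by \<open>a\<close>.\<close>
  have KU: "K + S.C1 * (\<eta> * real T * (sqrt (real d) * U powr \<alpha>)) \<le> U"
  proof -
    have "S.C1 * (\<eta> * real T * (sqrt (real d) * U powr \<alpha>)) \<le> S.C1 * (a * U)" by (rule mult_left_mono[OF F(9) C10])
    also have "\<dots> = (a * S.C1) * U" by simp
    also have "\<dots> \<le> 1/2 * U" using C1 F(4) by (intro mult_right_mono) auto
    finally have "S.C1 * (\<eta> * real T * (sqrt (real d) * U powr \<alpha>)) \<le> U / 2" by simp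
    moreover have "K \<le> U / 2" by (simp add: U_def)
    ultimately show ?thesis by linarith
  qed
  have stay: "\<forall>X\<in>sublevel d N V K. \<forall>n<T. S.W (svgd d N V k \<eta> X n) \<le> U"
    by (intro ballI allI impI S.trajectory_bound[OF less_imp_le[OF F(2)] F(4) F(7) F(8) KU]) auto
  note main = S.averaged_discrepancy_bound[OF F(2) F(3) F(4) small stay p int less_imp_le[OF params(5)] KL]
  have "(\<integral>X. p0 X * indicator (sublevel d N V K) X * avg_ksd_sq d N V k H ip \<eta> T X \<partial>lebN N d)
      \<le> (2 * (C\<^sub>K\<^sub>L + 1) / a + c + 37 * a * S.\<kappa>2) * real d * D / real N"
    by (rule order_trans[OF main(2) S.loss_bound[OF F(2) F(1) params(5) a(1) less_imp_le[OF params(6)] F(5) F(3) F(10)]])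
  also have "\<dots> = (b * real d * D / real N) / 2"
  proof -
    have "x * y * z / w = (2 * x * y * z / w) / 2" for x y z w :: real by simp
    then show ?thesis unfolding b' .
  qed
  finally have bound: "(\<integral>X. p0 X * indicator (sublevel d N V K) X * avg_ksd_sq d N V k H ip \<eta> T X \<partial>lebN N d)
      \<le> (b * real d * D / real N) / 2" .
  have "b > 0" unfolding b' using a params \<kappa>0 by (intro mult_pos_pos add_pos_nonneg) (auto simp: S.\<kappa>2_def)
  then have bpos: "b * real d * D / real N > 0" using d N F(1) by simp
  note R = restricted_mean_and_tail[OF p S.measurable_avg S.avg_nonneg S.sublevel_sets mass main(1) bound bpos]
  show "integrable (density (lebN N d) (restricted_density (lebN N d) p0 (sublevel d N V K))) (avg_ksd_sq d N V k H ip \<eta> T)"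
    by (rule R(1))
  show "(\<integral>x. avg_ksd_sq d N V k H ip \<eta> T x \<partial>density (lebN N d) (restricted_density (lebN N d) p0 (sublevel d N V K)))
       \<le> b * real d * D / real N"
    by (rule R(2))
  show "measure (density (lebN N d) p0) {x \<in> space (density (lebN N d) p0). avg_ksd_sq d N V k H ip \<eta> T x > b * real d * D / (real N * \<epsilon>)}
       \<le> \<epsilon> + (LINT z:(space (lebN N d) - sublevel d N V K)|lebN N d. p0 z)" if "\<epsilon> > 0"
    using R(3)[OF that] by (simp only: divide_divide_eq_left)
qed

theorem theorem3:
  fixes B A \<alpha> C\<^sub>V c C\<^sub>K\<^sub>L :: real
  assumes "B > 0" and "A > 0" and "0 \<le> \<alpha>" and "\<alpha> < 1 / 2" and "c > 0" and "C\<^sub>K\<^sub>L > 0"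
  shows "\<exists>a>0. \<exists>b>0. \<forall>(d::nat) (N::nat) (V :: vec \<Rightarrow> real) (k :: vec \<Rightarrow> vec \<Rightarrow> real) H ip
           (p0 :: config \<Rightarrow> real) (K::real).
     d \<ge> 1 \<and> N \<ge> 1 \<and>
     twice_differentiable_Rd d V \<and> integrable (leb d) (\<lambda>x. exp (- V x)) \<and>
     symmetric_pd_kernel d k \<and> twice_differentiable_Rd (2 * d) (joint d k) \<and> rkhs d k H ip \<and>
     prob_density (lebN N d) p0 \<and>
     (\<forall>z\<in>Rd (2 * d). \<bar>joint d k z\<bar> \<le> B \<and>
        (\<forall>i<2 * d. \<bar>partial i (joint d k) z\<bar> \<le> B) \<and>
        (\<forall>i<2 * d. \<forall>j<2 * d. \<bar>partial i (partial j (joint d k)) z\<bar> \<le> B)) \<and>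
     bdd_below (V ` Rd d) \<and> (INF z\<in>Rd d. V z) > 0 \<and>
     (\<forall>x\<in>Rd d. L2_set (\<lambda>i. partial i V x) {..<d} \<le> A * V x powr \<alpha>) \<and>
     bdd_above ((\<lambda>z. op_norm d (hessian V z)) ` Rd d) \<and>
     (SUP z\<in>Rd d. op_norm d (hessian V z)) = C\<^sub>V \<and>
     bdd_above ((\<lambda>z. (\<Sum>i<d. partial i (k z) z * partial i V z)
        + k z z * laplacian d V z - laplacian d (k z) z) ` Rd d) \<and>
     (SUP z\<in>Rd d. (\<Sum>i<d. partial i (k z) z * partial i V z)
        + k z z * laplacian d V z - laplacian d (k z) z) = c * real d \<and>
     KL_le (lebN N d) p0 (target_prod d N V) (C\<^sub>K\<^sub>L * real N * real d) \<and>
     K > 0 \<and> (LINT z:sublevel d N V K|lebN N d. p0 z) \<ge> 1 / 2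
     \<longrightarrow>
     (let D = real d powr ((1 + \<alpha>) / (2 * (1 - \<alpha>))) + sqrt (real d) * K powr \<alpha> + real d;
          \<eta> = a / D * real N powr (- ((1 + \<alpha>) / (1 - 2 * \<alpha>)));
          T = nat \<lfloor>real N powr ((2 - \<alpha>) / (1 - 2 * \<alpha>))\<rfloor>;
          Q = avg_ksd_sq d N V k H ip \<eta> T;
          P\<^sub>K = density (lebN N d) (restricted_density (lebN N d) p0 (sublevel d N V K));
          P = density (lebN N d) p0
      in integrable P\<^sub>K Q \<and> (\<integral>x. Q x \<partial>P\<^sub>K) \<le> b * real d * D / real N \<and>
         (\<forall>\<epsilon>>0. measure P {x \<in> space P. Q x > b * real d * D / (real N * \<epsilon>)}
            \<le> \<epsilon> + (LINT z:(space (lebN N d) - sublevel d N V K)|lebN N d. p0 z)))"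
proof -
  \<comment> \<open>The value \<open>C\<^sub>V\<close> is an arbitrary real at this point; its
    absolute value keeps the constants built from it positive.\<close>
  define C where "C = \<bar>C\<^sub>V\<bar>"
  define C1 where "C1 = B * A + C * B\<^sup>2 * (6 * A\<^sup>2 + 1)"
  define \<kappa> where "\<kappa> = B\<^sup>2 * (20 + 128 * A\<^sup>2) * (2 * A\<^sup>2 + C\<^sup>2 + 1)"
  \<comment> \<open>The two fractions ensure \<open>a * C1 \<le> 1/2\<close> for confinement and
    \<open>37 * a * \<kappa> \<le> 1/36\<close> for the change of variables, with 1332 = 37 times
    36.\<close>
  define a where "a = min 1 (min (1 / (2 * C1 + 1)) (1 / (1332 * \<kappa> + 1)))"
  define b where "b = 2 * (2 * (C\<^sub>K\<^sub>L + 1) / a + c + 37 * a * (2 * \<kappa> + C * B\<^sup>2 * (2 * A\<^sup>2 + C\<^sup>2 + 1)))"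
  have C: "C \<ge> 0" "C\<^sub>V \<le> C" by (auto simp: C_def)
  have C1: "C1 \<ge> 0" and \<kappa>: "\<kappa> \<ge> 0" unfolding C1_def \<kappa>_def using assms C by auto
  have a0: "a > 0" using C1 \<kappa> by (simp add: a_def add_nonneg_pos)
  have a1: "a \<le> 1" by (simp add: a_def)
  have "a * C1 \<le> 1 / (2 * C1 + 1) * C1" using C1 by (intro mult_right_mono) (simp_all add: a_def)
  also have "\<dots> \<le> 1/2" using C1 by (simp add: divide_le_eq)
  finally have aC1: "a * (B * A + C * B\<^sup>2 * (6 * A\<^sup>2 + 1)) \<le> 1/2" unfolding C1_def .
  have "a * \<kappa> \<le> 1 / (1332 * \<kappa> + 1) * \<kappa>" using \<kappa> by (intro mult_right_mono) (simp_all add: a_def)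
  also have "\<dots> \<le> 1/1332" using \<kappa> by (simp add: divide_le_eq)
  finally have "37 * a * \<kappa> \<le> 1/36" by simp
  then have a\<kappa>: "37 * a * (B\<^sup>2 * (20 + 128 * A\<^sup>2) * (2 * A\<^sup>2 + C\<^sup>2 + 1)) \<le> 1/36" unfolding \<kappa>_def .
  have b0: "b > 0" unfolding b_def using a0 assms \<kappa> C by (intro mult_pos_pos add_pos_nonneg) auto
  note rate = svgd_rate[OF refl refl refl assms C a0 a1 aC1 a\<kappa> b_def[unfolded \<kappa>_def]]
  show ?thesis
    unfolding Let_def
    by (intro exI[of _ a] exI[of _ b] conjI a0 b0 allI impI; elim conjE; rule rate; assumption)
qed

end
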